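(* Let $\beta$ be an irrational real number which is intermittently badly approximable. Then $$\lambda\Bigl(\bigl\{x\in[0,1) : \liminf_{p\to\infty}p\,\lVert p\beta-x\rVert=0\bigr\}\Bigr)=1,$$ where $p$ runs over the prime numbers.
   Context: $\lVert y\rVert$ denotes the distance from $y\in\mathbf{R}$ to the nearest integer; $\lambda$ is Lebesgue measure. Intermittently badly approximable (i.b.a.): let $\beta\in\,]0,1[$ be irrational with continued fraction expansion $\beta=[0;a_1,a_2,\ldots]$, and for $k\geq1$ let $\frac{p_k}{q_k}=[0;a_1,\ldots,a_k]$ be its convergents. Then $\beta$ is i.b.a. if there exist a real number $0<\delta<1$, an integer $B\geq1$ and increasing sequences of integers $(j_k)_{k\geq1}$ and $(T_k)_{k\geq1}$ such that for all $k\geq1$: $a_{j_k}\leq B,\ \ldots,\ a_{j_k+T_k}\leq B$, and $T_k\geq\delta\log q_{j_k}$. *)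

theory Defs
  imports "HOL-Analysis.Analysis" "HOL-Computational_Algebra.Primes"
begin

definition dist_to_int :: "real \<Rightarrow> real" where
  "dist_to_int y = infdist y \<int>"

primrec gauss_orbit :: "real \<Rightarrow> nat \<Rightarrow> real" where
  "gauss_orbit \<beta> 0 = \<beta>"
| "gauss_orbit \<beta> (Suc n) = frac (1 / gauss_orbit \<beta> n)"

text \<open>For irrational \<open>\<beta>\<close> in \<open>]0,1[\<close> we have \<open>\<beta> = [0; a\<^sub>1, a\<^sub>2, \<dots>]\<close> with \<open>a\<^sub>k = partial_quotient \<beta> k\<close>
  for \<open>k \<ge> 1\<close>; the index \<open>0\<close> is not meaningful.\<close>

definition partial_quotient :: "real \<Rightarrow> nat \<Rightarrow> int" where
  "partial_quotient \<beta> k = \<lfloor>1 / gauss_orbit \<beta> (k - 1)\<rfloor>"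

text \<open>\<open>finite_cf [a\<^sub>1, \<dots>, a\<^sub>k] = [0; a\<^sub>1, \<dots>, a\<^sub>k]\<close>\<close>

primrec finite_cf :: "int list \<Rightarrow> rat" where
  "finite_cf [] = 0"
| "finite_cf (a # as) = 1 / (of_int a + finite_cf as)"

definition convergent_cf :: "real \<Rightarrow> nat \<Rightarrow> rat" where
  "convergent_cf \<beta> k = finite_cf (map (partial_quotient \<beta>) [1..<Suc k])"

text \<open>The denominator of the convergent in lowest terms: \<open>quotient_of\<close> returns the coprime pair
  with positive second component.\<close>

definition convergent_denom :: "real \<Rightarrow> nat \<Rightarrow> int" where
  "convergent_denom \<beta> k = snd (quotient_of (convergent_cf \<beta> k))"

text \<open>The sequences \<open>j\<close> and \<open>T\<close> are indexed by \<open>k \<ge> 1\<close>; their values at \<open>0\<close> are irrelevant.  ``Increasing''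
  is read strictly: constant \<open>j\<close> and \<open>T\<close> would make every irrational number qualify.  Taking \<open>T\<close> to be
  natural-valued loses nothing, as \<open>\<delta> * ln q \<ge> 0\<close> for \<open>q \<ge> 1\<close>.\<close>

definition intermittently_badly_approximable :: "real \<Rightarrow> bool" where
  "intermittently_badly_approximable \<beta> \<longleftrightarrow>
     0 < \<beta> \<and> \<beta> < 1 \<and> \<beta> \<notin> \<rat> \<and>
     (\<exists>(\<delta>::real) (B::int) (j :: nat \<Rightarrow> nat) (T :: nat \<Rightarrow> nat).
        0 < \<delta> \<and> \<delta> < 1 \<and> 1 \<le> B \<and>
        strict_mono_on {1..} j \<and> strict_mono_on {1..} T \<and>
        (\<forall>k\<ge>1. 1 \<le> j k \<and>
           (\<forall>i\<in>{j k..j k + T k}. partial_quotient \<beta> i \<le> B) \<and>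
           real (T k) \<ge> \<delta> * ln (real_of_int (convergent_denom \<beta> (j k)))))"

end

theory Submission
  imports Defs "HOL-Number_Theory.Number_Theory" "HOL-Computational_Algebra.Squarefree" "HOL-Real_Asymp.Real_Asymp"
begin

text \<open>An intermittently badly approximable \<open>\<beta>\<close> satisfies \<open>\<parallel>n \<beta>\<parallel> \<ge> c / max n Q\<close> for all \<open>n \<le> Z\<close> in infinitely
  many windows with \<open>Q = 2\<^bsup>m a\<^esup>\<close> and \<open>Z = 2\<^bsup>m (a + 4)\<^esup>\<close>.  Let \<open>F\<^sub>m\<close> be the sum of \<open>(ln p / m) 1\<^bsub>E p\<^esub>\<close>, where
  \<open>E p\<close> is the arc of radius \<open>\<epsilon> / 2\<^bsup>i + 1\<^esup>\<close> around \<open>p \<beta>\<close>, over the primes \<open>2\<^bsup>i\<^esup> < p \<le> 2\<^bsup>i + 1\<^esup>\<close> with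
  \<open>m (a + 1) \<le> i < m (a + 2)\<close>.  By Mertens its integral is at least \<open>\<epsilon> / 2\<close>.  It is bounded in
  \<open>L\<^sup>2\<close>: arcs of \<open>p < q\<close> meet only if \<open>\<parallel>(q - p) \<beta>\<parallel>\<close> is small, Selberg's sieve bounds the number of pairs
  with a given difference, and a lattice point count bounds the number of differences.  By the Vaughan method for
  \<open>\<Sum> \<Lambda>(n) exp (2 \<pi> i h n \<beta>)\<close>, the arcs become equidistributed along the windows.  If the points of a
  compact set \<open>K\<close> of positive measure satisfied \<open>p \<parallel>p \<beta> - x\<parallel> \<ge> \<epsilon>\<close> for all large primes, then \<open>F\<^sub>m\<close> would
  vanish on \<open>K\<close>; but a neighbourhood \<open>U\<close> of \<open>K\<close> with \<open>U - K\<close> tiny must carry a fixed share of the mass of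
  \<open>F\<^sub>m\<close>, contradicting the \<open>L\<^sup>2\<close> bound.\<close>

section \<open>Distance to the nearest integer\<close>

text \<open>The arcs of a single dyadic block have total length of order \<epsilon> / i, which tends
  to 0. Only a number of consecutive blocks proportional to log Q carries mass of order \<epsilon>,
  and the condition T_k >= \<delta> log q_{j_k} is what makes a window that long. Averaging over
  these blocks also makes Mertens sufficient, so no lower bound for the primes of an individual
  block is needed. The quotients before j_k are arbitrary, so below Q nothing better than c / Q is
  known; hence the primes start a factor 2^m above Q. The window ends well beyond the primes because
  the frequency h \<beta> uses up a factor |h| <= 2^m of its length. The second moment is bounded
  only up to a constant, so by itself it would give a set of positive measure. Equidistribution
  localises it: the mass that falls near K is proportional to the measure of K, while Cauchy-Schwarz
  shows that a tiny set cannot hold it.\<close>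

lemma dist_to_int_le: "dist_to_int y \<le> \<bar>y - of_int k\<bar>"
  unfolding dist_to_int_def by (metis Ints_of_int dist_real_def infdist_le)

lemma dist_to_int_attained: "\<exists>k::int. dist_to_int y = \<bar>y - of_int k\<bar>"
proof -
  have "closed (\<int>::real set)" by (rule closed_Ints)
  moreover have "(\<int>::real set) \<noteq> {}" by auto
  ultimately obtain z where "z \<in> \<int>" "infdist y \<int> = dist y z"
    using infdist_attains_inf by blast
  then show ?thesis by (auto simp: dist_to_int_def dist_real_def elim!: Ints_cases)
qed

lemma dist_to_int_nonneg: "0 \<le> dist_to_int y"
  by (simp add: dist_to_int_def infdist_nonneg)

lemma dist_to_int_minus: "dist_to_int (- y) = dist_to_int y"
proof -
  have "dist_to_int (- y) \<le> dist_to_int y" for y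
  proof -
    obtain k where "dist_to_int y = \<bar>y - of_int k\<bar>" using dist_to_int_attained by blast
    with dist_to_int_le[of "-y" "-k"] show ?thesis by simp
  qed
  from this[of y] this[of "-y"] show ?thesis by simp
qed

lemma dist_to_int_triangle: "dist_to_int (x + y) \<le> dist_to_int x + dist_to_int y"
proof -
  obtain k l where "dist_to_int x = \<bar>x - of_int k\<bar>" "dist_to_int y = \<bar>y - of_int l\<bar>"
    using dist_to_int_attained by meson
  with dist_to_int_le[of "x+y" "k+l"] show ?thesis by simp
qed

lemma dist_to_int_add_int [simp]: "dist_to_int (x + of_int k) = dist_to_int x"
proof -
  have "dist_to_int (x + of_int k) \<le> dist_to_int x" for x :: real and k
  proof -
    obtain l where "dist_to_int x = \<bar>x - of_int l\<bar>" using dist_to_int_attained by blast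
    with dist_to_int_le[of "x + of_int k" "l+k"] show ?thesis by simp
  qed
  from this[of x k] this[of "x + of_int k" "-k"] show ?thesis by simp
qed

lemma dist_to_int_le_half: "dist_to_int y \<le> 1/2"
  using dist_to_int_le[of y "round y"] of_int_round_abs_le[of y] by (simp add: abs_minus_commute)

section \<open>Lattice points in thin strips\<close>

text \<open>The bounded quotients begin at a denominator not exceeding \<open>Q\<close>. The earlier
  ones are arbitrary, so for n below \<open>Q\<close> only the bound at \<open>Q\<close> is
  available; between \<open>Q\<close> and \<open>Z\<close> the number behaves like a badly
  approximable one.\<close>

definition bad_window :: "real \<Rightarrow> real \<Rightarrow> real \<Rightarrow> real \<Rightarrow> bool" where
  "bad_window c Q Z \<beta> \<longleftrightarrow>
     (\<forall>n::nat. 1 \<le> n \<longrightarrow> real n \<le> Z \<longrightarrow> c / max (real n) Q \<le> dist_to_int (real n * \<beta>))"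

lemma bad_windowD:
  "bad_window c Q Z \<beta> \<Longrightarrow> 1 \<le> n \<Longrightarrow> real n \<le> Z \<Longrightarrow> c / max (real n) Q \<le> dist_to_int (real n * \<beta>)"
  by (auto simp: bad_window_def)

text \<open>Points (n, m n) on one line through the origin are multiples k (a, b) of a primitive
  vector. With D the error of (a, b) one has k a <= X and k D < Y, while a D >= c; multiplying gives
  k^2 c <= X Y.\<close>

lemma card_collinear_le:
  fixes X Y :: real and m :: "nat \<Rightarrow> int"
  assumes bad: "bad_window c Q Z \<beta>" and "0 < c" "0 < Q"
    and S: "\<And>n. n \<in> S \<Longrightarrow> 1 \<le> n \<and> real n \<le> X \<and> \<bar>real n * \<beta> - of_int (m n)\<bar> < Y"
    and "0 \<le> X" "0 \<le> Y" "X \<le> Z" "Y * Q \<le> c"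
    and col: "\<And>n n'. n \<in> S \<Longrightarrow> n' \<in> S \<Longrightarrow> int n * m n' = int n' * m n"
  shows "real (card S) \<le> sqrt (X * Y / c)"
proof (cases "S = {}")
  case True
  then show ?thesis using assms by simp
next
  case False
  then obtain n0 where n0: "n0 \<in> S" by blast
  define g where "g = gcd (int n0) (m n0)"
  have gpos: "g > 0" using S[OF n0] by (simp add: g_def)
  obtain a b where ab: "int n0 = a * g" "m n0 = b * g" "coprime a b"
    using gcd_coprime_exists[of "int n0" "m n0"] gpos unfolding g_def by auto
  have apos: "a > 0" using ab(1) S[OF n0] gpos
    by (metis linorder_not_less mult_le_0_iff of_nat_0_less_iff order_less_le_trans zero_less_one less_le_not_le)
  have rep: "\<exists>k\<ge>1. int n = k * a \<and> m n = k * b" if n: "n \<in> S" for n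
  proof -
    have "int n * (b * g) = (a * g) * m n" using col[OF n n0] ab by simp
    then have e: "int n * b = a * m n" using gpos by (simp add: algebra_simps)
    then have "a dvd int n * b" by simp
    then have "a dvd int n" using ab(3) by (simp add: coprime_dvd_mult_left_iff)
    then obtain k where k: "int n = k * a" by (metis dvd_def mult.commute)
    with e apos have "m n = k * b" by simp
    moreover have "k \<ge> 1" using k S[OF n] apos
      by (metis int_one_le_iff_zero_less linorder_not_less mult_le_0_iff not_one_le_zero of_nat_0_less_iff of_nat_le_0_iff order.strict_implies_order)
    ultimately show ?thesis using k by blast
  qed
  define K where "K = nat \<lfloor>sqrt (X * Y / c)\<rfloor>"
  define f where "f n = nat (int n div a)" for n
  have bound: "f n \<in> {1..K} \<and> int n = int (f n) * a" if n: "n \<in> S" for n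
  proof -
    obtain k where k: "k \<ge> 1" "int n = k * a" "m n = k * b" using rep[OF n] by blast
    have fk: "int (f n) = k" using k apos by (simp add: f_def)
    have rn: "real n = of_int k * of_int a" using k(2) by (metis of_int_mult of_int_of_nat_eq)
    have diff: "real n * \<beta> - of_int (m n) = of_int k * (of_int a * \<beta> - of_int b)"
      unfolding rn k(3) by (simp add: algebra_simps)
    define D where "D = \<bar>of_int a * \<beta> - of_int b\<bar>"
    have kD: "of_int k * D < Y" using S[OF n] diff k(1) by (simp add: D_def abs_mult)
    have D0: "D \<ge> 0" by (simp add: D_def)
    have "D \<le> of_int k * D" using k(1) D0 by (simp add: mult_le_cancel_right1)
    then have DY: "D < Y" using kD by linarith
    define a' where "a' = nat a"
    have a': "real a' = of_int a" "1 \<le> a'" using apos by (auto simp: a'_def)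
    have "real a' \<le> real n" using rn a' k(1) apos by (simp add: mult_le_cancel_right1)
    then have aZ: "real a' \<le> Z" using S[OF n] \<open>X \<le> Z\<close> by linarith
    have cm: "c / max (real a') Q \<le> D"
      using bad_windowD[OF bad a'(2) aZ] dist_to_int_le[of "real a' * \<beta>" b] a'(1) by (simp add: D_def)
    have "Y \<le> c / Q" using \<open>Y * Q \<le> c\<close> \<open>0 < Q\<close> by (simp add: pos_le_divide_eq)
    then have "c / max (real a') Q < c / Q" using cm DY by linarith
    \<comment> \<open>For a' <= Q the window would give D >= c / Q >= Y, against D < Y. So the
      maximum with Q is a', and a' D >= c.\<close>
    then have "real a' > Q" using \<open>0 < c\<close> \<open>0 < Q\<close> by (cases "real a' > Q") auto
    then have "c / real a' \<le> D" using cm by (simp add: max_def split: if_splits)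
    then have cD: "c \<le> real a' * D" using a'(2) by (simp add: pos_divide_le_eq mult.commute)
    have k0: "0 \<le> real_of_int k" using k(1) by simp
    have "(of_int k)^2 * c \<le> (of_int k)^2 * (real a' * D)" using cD by (intro mult_left_mono) auto
    also have "\<dots> = real n * (of_int k * D)" using rn a' by (simp add: power2_eq_square)
    also have "\<dots> \<le> X * Y" using S[OF n] kD D0 k0 \<open>0 \<le> X\<close> by (intro mult_mono) auto
    finally have "(of_int k)^2 \<le> X * Y / c" using \<open>0 < c\<close> by (simp add: pos_le_divide_eq)
    then have "of_int k \<le> sqrt (X * Y / c)" by (simp add: real_le_rsqrt)
    then have "k \<le> \<lfloor>sqrt (X * Y / c)\<rfloor>" by (simp add: le_floor_iff)
    then have "f n \<le> K" using fk by (simp add: K_def)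
    moreover have "1 \<le> f n" using fk k(1) by linarith
    ultimately show ?thesis using fk k by simp
  qed
  have inj: "inj_on f S"
  proof (rule inj_onI)
    fix x y assume "x \<in> S" "y \<in> S" "f x = f y"
    then show "x = y" using bound[of x] bound[of y] by (metis of_nat_eq_iff)
  qed
  have "card S = card (f ` S)" using inj by (simp add: card_image)
  also have "\<dots> \<le> card {1..K}" using bound by (intro card_mono) auto
  finally have "real (card S) \<le> real K" by simp
  also have "\<dots> \<le> sqrt (X * Y / c)" using assms by (simp add: K_def)
  finally show ?thesis .
qed

text \<open>The determinant is a multiple of d of absolute value less than 2 X Y <= d, hence zero:
  such lattice points are collinear with the origin.\<close>

lemma det_eq_0:
  fixes m1 m2 n1 n2 :: int
  assumes "int d dvd n1" "int d dvd n2" "0 \<le> n1" "0 \<le> n2" "of_int n1 \<le> X" "of_int n2 \<le> X"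
    and "\<bar>of_int n1 * \<beta> - of_int m1\<bar> < Y" "\<bar>of_int n2 * \<beta> - of_int m2\<bar> < Y"
    and "2 * X * Y \<le> real d" "0 < X"
  shows "n1 * m2 = n2 * m1"
proof -
  let ?D = "n1 * m2 - n2 * m1"
  have dv: "int d dvd ?D" using assms by (simp add: dvd_diff)
  have eq: "real_of_int ?D = of_int n2 * (of_int n1 * \<beta> - of_int m1) - of_int n1 * (of_int n2 * \<beta> - of_int m2)"
    by (simp add: algebra_simps)
  have a: "\<bar>of_int n2 * (of_int n1 * \<beta> - of_int m1)\<bar> \<le> X * \<bar>of_int n1 * \<beta> - of_int m1\<bar>"
    using assms by (simp add: abs_mult mult_right_mono)
  have b: "\<bar>of_int n1 * (of_int n2 * \<beta> - of_int m2)\<bar> \<le> X * \<bar>of_int n2 * \<beta> - of_int m2\<bar>"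
    using assms by (simp add: abs_mult mult_right_mono)
  have a': "X * \<bar>of_int n1 * \<beta> - of_int m1\<bar> < X * Y" using assms by (intro mult_strict_left_mono)
  have b': "X * \<bar>of_int n2 * \<beta> - of_int m2\<bar> < X * Y" using assms by (intro mult_strict_left_mono)
  have "real_of_int \<bar>?D\<bar> < real d" using a b a' b' eq assms(9) by (simp only: of_int_abs)
  then have "\<bar>?D\<bar> < int d" by linarith
  then have "?D = 0" using dv zdvd_not_zless[of "\<bar>?D\<bar>" "int d"] by auto
  then show ?thesis by simp
qed

text \<open>An interval of length d / (8 Y) holds only O(1 + sqrt (d / c)) points, because
  \<open>det_eq_0\<close> makes their differences collinear. About X Y / d such intervals are
  needed, whence the factor 1 / sqrt d. It makes the later sum over d with weight 1 / d converge,
  where a bound without it would cost a logarithm.\<close>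

lemma card_bohr_dvd_le:
  fixes X Y :: real
  assumes bad: "bad_window c Q Z \<beta>" and "0 < c" "0 < Q" "1 \<le> X" "0 < Y" "X \<le> Z" "2 * Y * Q \<le> c"
    and d: "1 \<le> d"
  shows "real (card {n::nat. 1 \<le> n \<and> real n \<le> X \<and> d dvd n \<and> dist_to_int (real n * \<beta>) < Y})
       \<le> 12 * (1 + 1 / (2 * sqrt c)) * X * Y / sqrt (real d) + sqrt (X * Y / c)" (is "real (card ?S) \<le> _")
proof -
  have finS: "finite ?S"
  proof (rule finite_subset)
    show "?S \<subseteq> {..nat \<lfloor>X\<rfloor>}" using \<open>1 \<le> X\<close> by (auto simp: le_nat_floor)
  qed simp
  have "\<exists>m. \<forall>n. dist_to_int (real n * \<beta>) = \<bar>real n * \<beta> - of_int (m n)\<bar>"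
    using dist_to_int_attained by (intro choice) auto
  then obtain m :: "nat \<Rightarrow> int" where m: "\<And>n. dist_to_int (real n * \<beta>) = \<bar>real n * \<beta> - of_int (m n)\<bar>"
    by blast
  \<comment> \<open>If 4 X Y <= d, all the points are already collinear with the origin and the last
    term suffices. Otherwise 1 <= 4 X Y / d absorbs the extra interval, and 8 + 4 gives the constant
    12.\<close>
  show ?thesis
  proof (cases "4 * X * Y \<le> real d")
    case True
    have "0 < X * Y" using assms by simp
    then have dXY: "2 * X * Y \<le> real d" using True by linarith
    have "0 < Y * Q" using assms by simp
    then have YQ: "Y * Q \<le> c" using assms(7) by linarith
    have "real (card ?S) \<le> sqrt (X * Y / c)"
    proof (rule card_collinear_le[OF bad \<open>0 < c\<close> \<open>0 < Q\<close>, where m = m])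
      fix n n' assume "n \<in> ?S" "n' \<in> ?S"
      then show "int n * m n' = int n' * m n"
        using det_eq_0[of d "int n" "int n'" X \<beta> "m n" Y "m n'"] dXY assms m by auto
    qed (use assms YQ m in auto)
    moreover have "0 \<le> 12 * (1 + 1 / (2 * sqrt c)) * X * Y / sqrt (real d)" using assms by simp
    ultimately show ?thesis by linarith
  next
    case False
    \<comment> \<open>Differences within one interval are shorter than L and have error below 2 Y,
      so \<open>det_eq_0\<close> asks for 4 L Y <= d.\<close>
    define L where "L = real d / (8 * Y)"
    have Lpos: "L > 0" using assms by (simp add: L_def)
    have LY: "8 * (L * Y) = real d" using assms by (simp add: L_def)
    define J where "J = nat \<lfloor>X / L\<rfloor>"
    define T where "T j = {n \<in> ?S. nat \<lfloor>real n / L\<rfloor> = j}" for j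
    have cov: "?S \<subseteq> (\<Union>j\<in>{..J}. T j)"
    proof
      fix n assume n: "n \<in> ?S"
      then have "real n \<le> X" by blast
      then have "real n / L \<le> X / L" using Lpos by (simp add: divide_right_mono)
      then have "nat \<lfloor>real n / L\<rfloor> \<le> J" unfolding J_def by (intro nat_mono floor_mono)
      then have "n \<in> T (nat \<lfloor>real n / L\<rfloor>)" "nat \<lfloor>real n / L\<rfloor> \<in> {..J}" using n unfolding T_def by simp_all
      then show "n \<in> (\<Union>j\<in>{..J}. T j)" by blast
    qed
    have TS: "T j \<subseteq> ?S" for j unfolding T_def by (rule Collect_restrict)
    have finT: "finite (T j)" for j using TS finS by (rule finite_subset)
    have finU: "finite (\<Union>j\<in>{..J}. T j)" using finT by (rule finite_UN_I[OF finite_atMost])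
    have "card ?S \<le> card (\<Union>j\<in>{..J}. T j)" by (rule card_mono[OF finU cov])
    also have "\<dots> \<le> (\<Sum>j\<in>{..J}. card (T j))" by (rule card_UN_le) simp
    finally have "real (card ?S) \<le> real (\<Sum>j\<in>{..J}. card (T j))" by (rule of_nat_mono)
    also have "\<dots> = (\<Sum>j\<in>{..J}. real (card (T j)))" by (rule of_nat_sum)
    finally have "real (card ?S) \<le> (\<Sum>j\<in>{..J}. real (card (T j)))" .
    also have "\<dots> \<le> (\<Sum>j\<in>{..J}. 1 + sqrt (real d / (4 * c)))"
    proof (rule sum_mono)
      fix j assume "j \<in> {..J}"
      show "real (card (T j)) \<le> 1 + sqrt (real d / (4 * c))"
      proof (cases "T j = {}")
        case True then show ?thesis using assms by simp
      next
        case ne: False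
        define n0 where "n0 = Min (T j)"
        have n0: "n0 \<in> T j" using ne finT[of j] by (simp add: n0_def)
        have le: "n0 \<le> n" if "n \<in> T j" for n using that finT[of j] by (simp add: n0_def)
        \<comment> \<open>Subtracting the least point keeps divisibility by d and doubles the error.
          The differences, unlike the points themselves, are short enough to lie on one line through
          the origin.\<close>
        define S' where "S' = (\<lambda>n. n - n0) ` (T j - {n0})"
        have inj: "inj_on (\<lambda>n. n - n0) (T j - {n0})"
          by (rule inj_onI) (use le in \<open>auto simp: le_diff_iff eq_diff_iff\<close>)
        have card: "card S' = card (T j) - 1"
          unfolding S'_def using inj n0 finT[of j] by (simp add: card_image)
        define m' where "m' k = m (k + n0) - m n0" for k
        have pr: "1 \<le> k \<and> real k \<le> min L X \<and> d dvd k \<and> \<bar>real k * \<beta> - of_int (m' k)\<bar> < 2 * Y"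
          if k: "k \<in> S'" for k
        proof -
          obtain n where n: "n \<in> T j" "n \<noteq> n0" "k = n - n0" using k by (auto simp: S'_def)
          have nn: "n0 \<le> n" using le n by blast
          then have kn: "real k = real n - real n0" using n by (simp add: of_nat_diff)
          have "nat \<lfloor>real n / L\<rfloor> = nat \<lfloor>real n0 / L\<rfloor>" using n n0 by (simp add: T_def)
          then have "\<lfloor>real n / L\<rfloor> = \<lfloor>real n0 / L\<rfloor>" using Lpos
            by (simp add: eq_nat_nat_iff)
          then have "real n / L - real n0 / L < 1"
            by linarith
          then have "real k / L < 1" by (simp add: kn diff_divide_distrib)
          then have "real k < L" using Lpos by simp
          moreover have "real k \<le> X" using n kn by (auto simp: T_def)
          moreover have "d dvd k" using n n0 by (auto simp: T_def)
          moreover have "1 \<le> k" using n nn by linarith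
          moreover have "\<bar>real k * \<beta> - of_int (m' k)\<bar> < 2 * Y"
          proof -
            have "real k * \<beta> - of_int (m' k) = (real n * \<beta> - of_int (m n)) - (real n0 * \<beta> - of_int (m n0))"
              using n nn by (simp add: kn m'_def algebra_simps)
            moreover have "\<bar>real n * \<beta> - of_int (m n)\<bar> < Y" "\<bar>real n0 * \<beta> - of_int (m n0)\<bar> < Y"
              using n n0 m by (auto simp: T_def)
            ultimately show ?thesis by linarith
          qed
          ultimately show ?thesis by simp
        qed
        have mLX: "0 < min L X" using Lpos assms by simp
        have "4 * (min L X * Y) \<le> 4 * (L * Y)" using assms by (intro mult_left_mono mult_right_mono) auto
        then have dXY: "2 * min L X * (2 * Y) \<le> real d" using LY by linarith
        have "real (card S') \<le> sqrt (min L X * (2 * Y) / c)"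
        proof (rule card_collinear_le[OF bad \<open>0 < c\<close> \<open>0 < Q\<close>, where m = m'])
          fix n n' assume nn: "n \<in> S'" "n' \<in> S'"
          show "int n * m' n' = int n' * m' n"
            using det_eq_0[of d "int n" "int n'" "min L X" \<beta> "m' n" "2*Y" "m' n'"] dXY mLX
              pr[OF nn(1)] pr[OF nn(2)] by simp
        next
          fix n assume "n \<in> S'"
          from pr[OF this] show "1 \<le> n \<and> real n \<le> min L X \<and> \<bar>real n * \<beta> - of_int (m' n)\<bar> < 2 * Y"
            by blast
        next
          show "0 \<le> min L X" "0 \<le> 2 * Y" "min L X \<le> Z" "2 * Y * Q \<le> c" using mLX assms(5-7) by simp_all
        qed
        also have "\<dots> \<le> sqrt (L * (2 * Y) / c)" using assms
          by (intro real_sqrt_le_mono divide_right_mono mult_right_mono) auto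
        also have "L * (2 * Y) / c = real d / (4 * c)" using \<open>0 < c\<close> \<open>0 < Y\<close> by (simp add: L_def)
        finally show ?thesis using card by linarith
      qed
    qed
    also have "\<dots> = (real J + 1) * (1 + sqrt (real d / (4 * c)))" by simp
    also have "\<dots> \<le> (12 * X * Y / real d) * (1 + sqrt (real d / (4 * c)))"
    proof (rule mult_right_mono)
      have "real J \<le> X / L" unfolding J_def using Lpos assms by simp
      also have "X / L = 8 * X * Y / real d" by (simp add: L_def)
      finally have "real J \<le> 8 * (X * Y / real d)" by simp
      moreover have "1 \<le> 4 * X * Y / real d" using False d by (simp add: pos_le_divide_eq)
      then have "1 \<le> 4 * (X * Y / real d)" by simp
      ultimately have "real J + 1 \<le> 12 * (X * Y / real d)" by linarith
      then show "real J + 1 \<le> 12 * X * Y / real d" by simp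
    qed (use assms in simp)
    also have "sqrt (real d / (4 * c)) = sqrt (real d) / (2 * sqrt c)"
      by (simp add: real_sqrt_divide real_sqrt_mult)
    also have "12 * X * Y / real d * (1 + sqrt (real d) / (2 * sqrt c))
        \<le> 12 * X * Y / real d * (sqrt (real d) * (1 + 1 / (2 * sqrt c)))"
    proof (intro mult_left_mono)
      have "1 \<le> sqrt (real d)" using d by simp
      then show "1 + sqrt (real d) / (2 * sqrt c) \<le> sqrt (real d) * (1 + 1 / (2 * sqrt c))"
        by (simp add: algebra_simps)
    qed (use assms in auto)
    also have "\<dots> = 12 * (1 + 1 / (2 * sqrt c)) * X * Y / sqrt (real d)"
    proof -
      have "12 * x * y / e * (s * b) = 12 * b * x * y / s" if "s * s = e" "s > 0" for x y e s b :: real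
        using that by (auto simp: field_simps)
      from this[of "sqrt (real d)" "real d" X Y] show ?thesis using d by simp
    qed
    moreover have "0 \<le> sqrt (X * Y / c)" using assms by simp
    ultimately show ?thesis by linarith
  qed
qed

text \<open>This is sigma(n) / n, the factor by which a shift n can raise the sieve bound for pairs
  p, p + n.\<close>

definition inv_divisor_sum :: "nat \<Rightarrow> real" where
  "inv_divisor_sum n = (\<Sum>d | d dvd n. 1 / real d)"

text \<open>Telescoping: for s = sqrt n and t = sqrt (n + 1), t^2 - s^2 = 1 gives 1 / t^3 <= 2 / s -
  2 / t.\<close>

lemma sum_inverse_powr_three_halves_le:
  "n \<ge> 1 \<Longrightarrow> (\<Sum>d=1..n. 1 / (real d * sqrt (real d))) \<le> 3 - 2 / sqrt (real n)"
proof (induction n rule: dec_induct)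
  case base then show ?case by simp
next
  case (step n)
  define s t where "s = sqrt (real n)" and "t = sqrt (real (Suc n))"
  have st: "0 < s" "s \<le> t" using step by (auto simp: s_def t_def)
  have sq: "s * s = real n" "t * t = real n + 1" by (auto simp: s_def t_def)
  have "1 / (t * t * t) \<le> 2 / (s * t * (s + t))"
  proof -
    have "s * (s + t) \<le> t * (t + t)" using st by (intro mult_mono) auto
    then have "t * (s * (s + t)) \<le> t * (t * (t + t))" using st by (intro mult_left_mono) auto
    then have "s * t * (s + t) \<le> 2 * (t * t * t)" by (simp add: algebra_simps)
    then show ?thesis using st by (simp add: divide_simps)
  qed
  also have "\<dots> = 2 * ((t - s) * (t + s)) / (s * t * (s + t))"
    using sq by (simp add: algebra_simps)
  also have "\<dots> = 2 * (t - s) / (s * t)" using st by (simp add: add.commute)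
  also have "\<dots> = 2 / s - 2 / t" using st by (simp add: field_simps)
  finally have "1 / (t * t * t) \<le> 2 / s - 2 / t" .
  moreover have "1 / (real (Suc n) * sqrt (real (Suc n))) = 1 / (t * t * t)" by (simp add: t_def)
  ultimately show ?case using step unfolding s_def t_def by (simp add: sum.cl_ivl_Suc)
qed

lemma harmonic_le: "n \<ge> 1 \<Longrightarrow> (\<Sum>d=1..n. 1 / real d) \<le> 1 + ln (real n)"
proof (induction n rule: dec_induct)
  case base then show ?case by simp
next
  case (step n)
  have "ln (real n / real (Suc n)) \<le> real n / real (Suc n) - 1"
    using step by (intro ln_le_minus_one) simp
  also have "\<dots> = - 1 / real (Suc n)" by (simp add: field_simps)
  finally have "1 / real (Suc n) \<le> ln (real (Suc n)) - ln (real n)"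
    using step by (simp add: ln_div del: of_nat_Suc)
  then show ?case using step by (simp add: sum.cl_ivl_Suc del: of_nat_Suc)
qed

text \<open>Expanding the divisor sum and exchanging summations yields the counts of
  \<open>card_bohr_dvd_le\<close> with weight 1 / d. The main term meets the convergent sum of
  d^(-3/2); only the collinear term pays a logarithm.\<close>

lemma sum_inv_divisor_sum_bohr_le:
  fixes X :: nat and Y :: real
  assumes bad: "bad_window c Q Z \<beta>" and "0 < c" "0 < Q" "1 \<le> X" "0 < Y" "real X \<le> Z" "2 * Y * Q \<le> c"
  shows "(\<Sum>n | 1 \<le> n \<and> n \<le> X \<and> dist_to_int (real n * \<beta>) < Y. inv_divisor_sum n)
     \<le> 36 * (1 + 1 / (2 * sqrt c)) * real X * Y + sqrt (real X * Y / c) * (1 + ln (real X))"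
proof -
  let ?S = "{n. 1 \<le> n \<and> n \<le> X \<and> dist_to_int (real n * \<beta>) < Y}"
  let ?T = "\<lambda>d. {n. 1 \<le> n \<and> real n \<le> real X \<and> d dvd n \<and> dist_to_int (real n * \<beta>) < Y}"
  define C where "C = 12 * (1 + 1 / (2 * sqrt c))"
  have C0: "0 \<le> C" using assms by (simp add: C_def)
  have "(\<Sum>n\<in>?S. inv_divisor_sum n) = (\<Sum>n\<in>?S. \<Sum>d\<in>{1..X}. if d dvd n then 1 / real d else 0)"
  proof (rule sum.cong)
    fix n assume n: "n \<in> ?S"
    have "inv_divisor_sum n = (\<Sum>d\<in>{d\<in>{1..X}. d dvd n}. 1 / real d)"
      unfolding inv_divisor_sum_def
      by (rule sum.cong) (use n in \<open>auto dest: dvd_imp_le intro: Nat.gr0I simp: Suc_le_eq\<close>)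
    then show "inv_divisor_sum n = (\<Sum>d\<in>{1..X}. if d dvd n then 1 / real d else 0)"
      by (subst sum.inter_filter[symmetric]) simp_all
  qed simp
  also have "\<dots> = (\<Sum>d\<in>{1..X}. \<Sum>n\<in>?S. if d dvd n then 1 / real d else 0)" by (rule sum.swap)
  also have "\<dots> = (\<Sum>d\<in>{1..X}. 1 / real d * real (card (?T d)))"
  proof (rule sum.cong)
    fix d assume "d \<in> {1..X}"
    have "(\<Sum>n\<in>?S. if d dvd n then 1 / real d else 0) = (\<Sum>n\<in>{n\<in>?S. d dvd n}. 1 / real d)"
      by (intro sum.inter_filter[symmetric]) simp
    also have "{n\<in>?S. d dvd n} = ?T d" by auto
    finally show "(\<Sum>n\<in>?S. if d dvd n then 1 / real d else 0) = 1 / real d * real (card (?T d))" by simp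
  qed simp
  also have "\<dots> \<le> (\<Sum>d\<in>{1..X}. 1 / real d * (C * real X * Y / sqrt (real d) + sqrt (real X * Y / c)))"
  proof (intro sum_mono mult_left_mono)
    fix d assume "d \<in> {1..X}"
    then show "real (card (?T d)) \<le> C * real X * Y / sqrt (real d) + sqrt (real X * Y / c)"
      unfolding C_def using assms by (intro card_bohr_dvd_le) auto
  qed simp
  also have "\<dots> = C * real X * Y * (\<Sum>d=1..X. 1 / (real d * sqrt (real d)))
      + sqrt (real X * Y / c) * (\<Sum>d=1..X. 1 / real d)"
    unfolding sum_distrib_left sum.distrib[symmetric] by (intro sum.cong) (simp_all add: distrib_left)
  also have "\<dots> \<le> C * real X * Y * 3 + sqrt (real X * Y / c) * (1 + ln (real X))"
  proof (intro add_mono mult_left_mono)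
    have "0 \<le> 2 / sqrt (real X)" by simp
    then show "(\<Sum>d=1..X. 1 / (real d * sqrt (real d))) \<le> 3"
      using sum_inverse_powr_three_halves_le[OF \<open>1 \<le> X\<close>] by linarith
  qed (use assms C0 harmonic_le[OF \<open>1 \<le> X\<close>] in auto)
  also have "C * real X * Y * 3 = 36 * (1 + 1 / (2 * sqrt c)) * real X * Y" unfolding C_def by simp
  finally show ?thesis .
qed

section \<open>Windows of bad approximability\<close>

fun cf_num :: "real \<Rightarrow> nat \<Rightarrow> int" where
  "cf_num \<beta> 0 = 1"
| "cf_num \<beta> (Suc 0) = 0"
| "cf_num \<beta> (Suc (Suc k)) = partial_quotient \<beta> (Suc k) * cf_num \<beta> (Suc k) + cf_num \<beta> k"

text \<open>Numerators and denominators are shifted by one: index Suc k belongs to p_k / q_k, and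
  index 0 to the conventional values p_{-1} = 1, q_{-1} = 0.\<close>

fun cf_den :: "real \<Rightarrow> nat \<Rightarrow> int" where
  "cf_den \<beta> 0 = 0"
| "cf_den \<beta> (Suc 0) = 1"
| "cf_den \<beta> (Suc (Suc k)) = partial_quotient \<beta> (Suc k) * cf_den \<beta> (Suc k) + cf_den \<beta> k"

definition cf_err :: "real \<Rightarrow> nat \<Rightarrow> real" where
  "cf_err \<beta> k = of_int (cf_den \<beta> k) * \<beta> - of_int (cf_num \<beta> k)"

text \<open>The remainder x replaces the final 0, so that appending a quotient merely changes x;
  this allows induction from the right end of the list.\<close>

primrec finite_cf_tail :: "int list \<Rightarrow> rat \<Rightarrow> rat" where
  "finite_cf_tail [] x = x"
| "finite_cf_tail (a # as) x = 1 / (of_int a + finite_cf_tail as x)"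

lemma finite_cf_tail_0: "finite_cf_tail as 0 = finite_cf as"
  by (induction as) auto

lemma finite_cf_tail_snoc: "finite_cf_tail (as @ [a]) x = finite_cf_tail as (1 / (of_int a + x))"
  by (induction as) auto

lemma abs_le_abs_add: "0 \<le> x * y \<Longrightarrow> \<bar>x\<bar> \<le> \<bar>x + y\<bar>" for x y :: real
  by (auto simp: zero_le_mult_iff)

context
  fixes \<beta> :: real
  assumes irr: "\<beta> \<notin> \<rat>" and beta01: "0 < \<beta>" "\<beta> < 1"
begin

lemma gauss_orbit_props: "gauss_orbit \<beta> k \<notin> \<rat> \<and> 0 < gauss_orbit \<beta> k \<and> gauss_orbit \<beta> k < 1"
proof (induction k)
  case 0 then show ?case using irr beta01 by simp
next
  case (Suc k)
  let ?x = "gauss_orbit \<beta> k"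
  have "1 / ?x \<notin> \<rat>" using Suc by (metis Rats_divide Rats_1 div_by_1 divide_divide_eq_right mult_1)
  then have f: "frac (1 / ?x) \<notin> \<rat>"
    unfolding frac_def by (metis Rats_add Rats_of_int add.commute diff_add_cancel)
  then have "frac (1 / ?x) \<noteq> 0" by (metis Rats_0)
  then have "0 < frac (1 / ?x)" using frac_ge_0[of "1/?x"] by linarith
  then show ?case using f by (simp add: frac_lt_1)
qed

lemma partial_quotient_ge_1: "partial_quotient \<beta> (Suc k) \<ge> 1"
  using gauss_orbit_props[of k] by (simp add: partial_quotient_def le_floor_iff)

lemma gauss_orbit_Suc_eq: "gauss_orbit \<beta> (Suc k) = 1 / gauss_orbit \<beta> k - of_int (partial_quotient \<beta> (Suc k))"
  by (simp add: frac_def partial_quotient_def)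

lemma cf_den_pos: "cf_den \<beta> k \<ge> 0 \<and> cf_den \<beta> (Suc k) \<ge> 1"
proof (induction k)
  case (Suc k)
  have "1 * 1 \<le> partial_quotient \<beta> (Suc k) * cf_den \<beta> (Suc k)"
    using Suc partial_quotient_ge_1[of k] by (intro mult_mono) auto
  then show ?case using Suc by simp
qed simp

lemma cf_den_mono_Suc: "cf_den \<beta> k \<le> cf_den \<beta> (Suc k)"
proof (cases k)
  case (Suc l)
  have "1 * cf_den \<beta> (Suc l) \<le> partial_quotient \<beta> (Suc l) * cf_den \<beta> (Suc l)"
    using partial_quotient_ge_1[of l] cf_den_pos[of l] by (intro mult_right_mono) auto
  then show ?thesis unfolding Suc cf_den.simps using cf_den_pos[of l] by linarith
qed simp

lemma cf_den_mono: "k \<le> l \<Longrightarrow> cf_den \<beta> k \<le> cf_den \<beta> l"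
  using cf_den_mono_Suc by (rule lift_Suc_mono_le)

lemma cf_den_double: "2 * cf_den \<beta> k \<le> cf_den \<beta> (Suc (Suc k))"
proof -
  have "1 * cf_den \<beta> (Suc k) \<le> partial_quotient \<beta> (Suc k) * cf_den \<beta> (Suc k)"
    using partial_quotient_ge_1[of k] cf_den_pos[of k] by (intro mult_right_mono) auto
  then show ?thesis using cf_den_mono_Suc[of k] by simp
qed

text \<open>Whatever the quotients, denominators double every two steps. This converts the number of
  bounded quotients into the length of a window.\<close>

lemma cf_den_growth: "2 ^ n * cf_den \<beta> k \<le> cf_den \<beta> (k + 2 * n)"
proof (induction n)
  case (Suc n)
  have "2 ^ Suc n * cf_den \<beta> k \<le> 2 * cf_den \<beta> (k + 2 * n)" using Suc by simp
  also have "\<dots> \<le> cf_den \<beta> (Suc (Suc (k + 2 * n)))" by (rule cf_den_double)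
  finally show ?case by simp
qed simp

lemma cf_det: "cf_num \<beta> (Suc k) * cf_den \<beta> k - cf_num \<beta> k * cf_den \<beta> (Suc k) = (- 1) ^ Suc k"
proof (induction k)
  case (Suc k)
  have "cf_num \<beta> (Suc (Suc k)) * cf_den \<beta> (Suc k) - cf_num \<beta> (Suc k) * cf_den \<beta> (Suc (Suc k))
     = - (cf_num \<beta> (Suc k) * cf_den \<beta> k - cf_num \<beta> k * cf_den \<beta> (Suc k))"
    by (simp add: algebra_simps)
  then show ?case using Suc by simp
qed simp

lemma finite_cf_tail_eq:
  "0 \<le> x \<Longrightarrow> finite_cf_tail (map (partial_quotient \<beta>) [1..<Suc k]) x =
     (of_int (cf_num \<beta> (Suc k)) + x * of_int (cf_num \<beta> k)) /
     (of_int (cf_den \<beta> (Suc k)) + x * of_int (cf_den \<beta> k))"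
proof (induction k arbitrary: x)
  case (Suc k)
  define a :: rat where "a = of_int (partial_quotient \<beta> (Suc k))"
  have a1: "a \<ge> 1" using partial_quotient_ge_1[of k] unfolding a_def by simp
  define y where "y = 1 / (a + x)"
  have ax: "a + x > 0" using a1 Suc by simp
  have y0: "y \<ge> 0" using ax by (simp add: y_def)
  have mul: "(a + x) * (u + y * v) = (a + x) * u + v" for u v
    using ax by (simp add: y_def distrib_left)
  have "finite_cf_tail (map (partial_quotient \<beta>) [1..<Suc (Suc k)]) x
     = finite_cf_tail (map (partial_quotient \<beta>) [1..<Suc k] @ [partial_quotient \<beta> (Suc k)]) x" by simp
  also have "\<dots> = finite_cf_tail (map (partial_quotient \<beta>) [1..<Suc k]) y"
    unfolding finite_cf_tail_snoc a_def y_def ..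
  also have "\<dots> = (of_int (cf_num \<beta> (Suc k)) + y * of_int (cf_num \<beta> k)) /
     (of_int (cf_den \<beta> (Suc k)) + y * of_int (cf_den \<beta> k))" using Suc.IH[OF y0] .
  also have "\<dots> = ((a + x) * (of_int (cf_num \<beta> (Suc k)) + y * of_int (cf_num \<beta> k))) /
     ((a + x) * (of_int (cf_den \<beta> (Suc k)) + y * of_int (cf_den \<beta> k)))" using ax by simp
  also have "(a + x) * (of_int (cf_num \<beta> (Suc k)) + y * of_int (cf_num \<beta> k)) =
      of_int (cf_num \<beta> (Suc (Suc k))) + x * of_int (cf_num \<beta> (Suc k))"
    unfolding mul by (simp add: distrib_right flip: a_def)
  also have "(a + x) * (of_int (cf_den \<beta> (Suc k)) + y * of_int (cf_den \<beta> k)) =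
      of_int (cf_den \<beta> (Suc (Suc k))) + x * of_int (cf_den \<beta> (Suc k))"
    unfolding mul by (simp add: distrib_right flip: a_def)
  finally show ?case .
qed simp

text \<open>The determinant identity \<open>cf_det\<close> makes p_k and q_k coprime, so the
  reduction in \<open>quotient_of\<close> changes nothing.\<close>

lemma convergent_denom_eq: "convergent_denom \<beta> k = cf_den \<beta> (Suc k)"
proof -
  have "coprime (cf_num \<beta> (Suc k)) (cf_den \<beta> (Suc k))"
  proof (rule coprimeI)
    fix d assume d: "d dvd cf_num \<beta> (Suc k)" "d dvd cf_den \<beta> (Suc k)"
    then have "d dvd cf_num \<beta> (Suc k) * cf_den \<beta> k - cf_num \<beta> k * cf_den \<beta> (Suc k)"
      by (intro dvd_diff dvd_mult dvd_mult2)
    then have "d dvd (- 1) ^ Suc k" unfolding cf_det .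
    then show "is_unit d" by (metis dvd_trans dvd_power_same is_unit_power_iff minus_one_mult_self
          dvd_triv_left power_mult_distrib power_one one_dvd mult_minus1 neg_one_even_power minus_dvd_iff dvd_refl)
  qed
  moreover have "convergent_cf \<beta> k = Fract (cf_num \<beta> (Suc k)) (cf_den \<beta> (Suc k))"
    using finite_cf_tail_eq[of 0 k] by (simp add: convergent_cf_def finite_cf_tail_0 Fract_of_int_quotient)
  ultimately show ?thesis
    using cf_den_pos[of k] by (simp add: convergent_denom_def quotient_of_Fract normalize_stable)
qed

lemma cf_err_Suc: "cf_err \<beta> (Suc k) = - gauss_orbit \<beta> k * cf_err \<beta> k"
proof (induction k)
  case 0 then show ?case by (simp add: cf_err_def)
next
  case (Suc k)
  let ?x = "gauss_orbit \<beta> k"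
  have x: "?x > 0" using gauss_orbit_props by blast
  have "cf_err \<beta> (Suc (Suc k)) = of_int (partial_quotient \<beta> (Suc k)) * cf_err \<beta> (Suc k) + cf_err \<beta> k"
    by (simp add: cf_err_def algebra_simps)
  also have "cf_err \<beta> k = - (1 / ?x) * cf_err \<beta> (Suc k)" using Suc x by simp
  finally show ?case unfolding gauss_orbit_Suc_eq by (simp add: algebra_simps)
qed

lemma abs_cf_err_Suc_le: "\<bar>cf_err \<beta> (Suc k)\<bar> \<le> \<bar>cf_err \<beta> k\<bar>"
  using gauss_orbit_props[of k] by (simp add: cf_err_Suc abs_mult mult_left_le_one_le)

text \<open>This is the determinant identity written in terms of the errors; consecutive errors have
  opposite signs by \<open>cf_err_Suc\<close>, so the absolute values add up.\<close>

lemma cf_err_sum: "of_int (cf_den \<beta> (Suc k)) * \<bar>cf_err \<beta> k\<bar> + of_int (cf_den \<beta> k) * \<bar>cf_err \<beta> (Suc k)\<bar> = 1"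
proof (induction k)
  case 0 then show ?case by (simp add: cf_err_def)
next
  case (Suc k)
  let ?x = "gauss_orbit \<beta> k" and ?a = "real_of_int (partial_quotient \<beta> (Suc k))"
  have x: "?x > 0" "gauss_orbit \<beta> (Suc k) > 0" using gauss_orbit_props by blast+
  have "\<bar>cf_err \<beta> k\<bar> = (1 / ?x) * \<bar>cf_err \<beta> (Suc k)\<bar>" using x by (simp add: cf_err_Suc[of k] abs_mult)
  moreover have "\<bar>cf_err \<beta> (Suc (Suc k))\<bar> = gauss_orbit \<beta> (Suc k) * \<bar>cf_err \<beta> (Suc k)\<bar>"
    using x by (simp only: cf_err_Suc[of "Suc k"] abs_mult abs_minus_cancel abs_of_pos)
  then have "\<bar>cf_err \<beta> (Suc (Suc k))\<bar> = (1 / ?x) * \<bar>cf_err \<beta> (Suc k)\<bar> - ?a * \<bar>cf_err \<beta> (Suc k)\<bar>"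
    unfolding gauss_orbit_Suc_eq by (simp add: left_diff_distrib)
  ultimately have e: "\<bar>cf_err \<beta> (Suc (Suc k))\<bar> = \<bar>cf_err \<beta> k\<bar> - ?a * \<bar>cf_err \<beta> (Suc k)\<bar>" by simp
  show ?case unfolding e using Suc by (simp add: algebra_simps)
qed

text \<open>Best approximation: by determinant +-1 two consecutive convergents form a basis of the
  lattice, so (n, m) = u (q, p) + v (q', p'). From 1 <= n < q' follow u \<noteq> 0 and u v <= 0, and
  as the two errors have opposite signs, their contributions reinforce each other.\<close>

lemma dist_to_int_ge_cf_err:
  assumes "1 \<le> n" "int n < cf_den \<beta> (Suc k)"
  shows "\<bar>cf_err \<beta> k\<bar> \<le> dist_to_int (real n * \<beta>)"
proof -
  obtain m where m: "dist_to_int (real n * \<beta>) = \<bar>real n * \<beta> - of_int m\<bar>"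
    using dist_to_int_attained by blast
  define s :: int where "s = (- 1) ^ Suc k"
  have ss: "s * s = 1" by (simp add: s_def flip: power_mult_distrib)
  let ?p = "cf_num \<beta> k" and ?p' = "cf_num \<beta> (Suc k)" and ?q = "cf_den \<beta> k" and ?q' = "cf_den \<beta> (Suc k)"
  have det: "?p' * ?q - ?p * ?q' = s" using cf_det[of k] by (simp add: s_def)
  define u v where "u = s * (int n * ?p' - m * ?q')" and "v = s * (m * ?q - int n * ?p)"
  have n_eq: "int n = u * ?q + v * ?q'"
  proof -
    have "u * ?q + v * ?q' = s * (?p' * ?q - ?p * ?q') * int n" by (simp add: u_def v_def algebra_simps)
    then show ?thesis using det ss by simp
  qed
  have m_eq: "m = u * ?p + v * ?p'"
  proof -
    have "u * ?p + v * ?p' = s * (?p' * ?q - ?p * ?q') * m" by (simp add: u_def v_def algebra_simps)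
    then show ?thesis using det ss by simp
  qed
  have e: "real n * \<beta> - of_int m = of_int u * cf_err \<beta> k + of_int v * cf_err \<beta> (Suc k)"
  proof -
    have "real n = of_int u * of_int ?q + of_int v * of_int ?q'"
      using n_eq by (metis of_int_add of_int_mult of_int_of_nat_eq)
    moreover have "real_of_int m = of_int u * of_int ?p + of_int v * of_int ?p'"
      using m_eq by (metis of_int_add of_int_mult)
    ultimately show ?thesis by (simp add: cf_err_def algebra_simps)
  qed
  have q: "?q \<ge> 0" "?q' \<ge> 1" using cf_den_pos by auto
  have u0: "u \<noteq> 0"
  proof
    assume "u = 0"
    then have nv: "int n = v * ?q'" using n_eq by simp
    then have "v * ?q' > 0" using assms by linarith
    then have "v > 0" using q by (simp add: zero_less_mult_iff)
    then have "1 * ?q' \<le> v * ?q'" using q by (intro mult_right_mono) auto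
    then show False using nv assms by linarith
  qed
  have uabs: "\<bar>cf_err \<beta> k\<bar> \<le> \<bar>of_int u * cf_err \<beta> k\<bar>"
  proof -
    have "1 \<le> \<bar>real_of_int u\<bar>" using u0 by linarith
    then show ?thesis by (simp add: abs_mult mult_le_cancel_right1)
  qed
  have x: "gauss_orbit \<beta> k > 0" using gauss_orbit_props by blast
  \<comment> \<open>Two nonzero coefficients of the same sign would make n at least
    \<open>?q'\<close> or at most 0.\<close>
  have "u * v \<le> 0"
  proof (rule ccontr)
    assume "\<not> u * v \<le> 0"
    then have uv: "u * v > 0" by simp
    then consider "u > 0" "v > 0" | "u < 0" "v < 0" by (auto simp: zero_less_mult_iff)
    then show False
    proof cases
      case 1
      then have "1 * ?q' \<le> v * ?q'" "0 \<le> u * ?q" using q by (auto intro!: mult_right_mono)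
      then show False using n_eq assms by linarith
    next
      case 2
      then have "v * ?q' \<le> 0" "u * ?q \<le> 0" using q by (auto simp: mult_le_0_iff)
      then show False using n_eq assms by linarith
    qed
  qed
  then have uv: "real_of_int u * of_int v \<le> 0" by (metis of_int_le_0_iff of_int_mult)
  have "(of_int u * cf_err \<beta> k) * (of_int v * cf_err \<beta> (Suc k)) =
     - (real_of_int u * of_int v) * (gauss_orbit \<beta> k * (cf_err \<beta> k * cf_err \<beta> k))"
    by (simp add: cf_err_Suc)
  also have "\<dots> \<ge> 0" by (rule mult_nonneg_nonneg) (use uv x in simp_all)
  finally have "\<bar>of_int u * cf_err \<beta> k\<bar> \<le> \<bar>of_int u * cf_err \<beta> k + of_int v * cf_err \<beta> (Suc k)\<bar>"
    by (rule abs_le_abs_add)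
  then show ?thesis using uabs m e by linarith
qed

lemma cf_err_ge: "1 / (2 * of_int (cf_den \<beta> (Suc k))) \<le> \<bar>cf_err \<beta> k\<bar>"
proof -
  let ?q = "real_of_int (cf_den \<beta> k)" and ?q' = "real_of_int (cf_den \<beta> (Suc k))"
  have q: "0 \<le> ?q" "?q \<le> ?q'" "?q' > 0" using cf_den_pos[of k] cf_den_mono_Suc[of k] by auto
  have "1 = ?q' * \<bar>cf_err \<beta> k\<bar> + ?q * \<bar>cf_err \<beta> (Suc k)\<bar>" using cf_err_sum[of k] by simp
  also have "\<dots> \<le> ?q' * \<bar>cf_err \<beta> k\<bar> + ?q' * \<bar>cf_err \<beta> k\<bar>"
    using q abs_cf_err_Suc_le[of k] by (intro add_mono mult_mono) auto
  finally have "1 \<le> \<bar>cf_err \<beta> k\<bar> * (2 * ?q')" by simp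
  then show ?thesis using q by (simp add: pos_divide_le_eq)
qed

text \<open>Locate n by q_{K-1} <= n < q_K; its distance is at least 1 / (2 q_K). If K lies in the
  bounded stretch, then q_K <= (B + 1) q_{K-1} <= (B + 1) n; if K <= J, then q_K <= q_J. In the
  shifted numbering q_K is \<open>cf_den \<beta> (Suc K)\<close>.\<close>

lemma bad_window_of_bounded_quotients:
  assumes B: "1 \<le> B" "\<And>i. J \<le> i \<Longrightarrow> i \<le> J + T \<Longrightarrow> partial_quotient \<beta> i \<le> B"
    and Z: "Z < of_int (cf_den \<beta> (Suc (J + T)))"
  shows "bad_window (1 / (2 * (of_int B + 1))) (of_int (cf_den \<beta> (Suc J))) Z \<beta>"
  unfolding bad_window_def
proof (intro allI impI)
  fix n :: nat assume n: "1 \<le> n" "real n \<le> Z"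
  define b where "b = real_of_int B"
  have b1: "1 \<le> b" using B by (simp add: b_def)
  define K where "K = (LEAST K. int n < cf_den \<beta> (Suc K))"
  have ex: "int n < cf_den \<beta> (Suc (J + T))" using n Z by linarith
  then have K: "int n < cf_den \<beta> (Suc K)" unfolding K_def by (rule LeastI)
  have KJT: "K \<le> J + T" unfolding K_def using ex by (rule Least_le)
  have "K \<noteq> 0" using K n by (intro notI) simp
  then obtain K' where K': "K = Suc K'" by (cases K) auto
  have nK: "cf_den \<beta> K \<le> int n"
  proof (rule ccontr)
    assume "\<not> ?thesis"
    then have "int n < cf_den \<beta> (Suc K')" using K' by simp
    then have "K \<le> K'" unfolding K_def by (rule Least_le)
    then show False using K' by simp
  qed
  have d: "1 / (2 * of_int (cf_den \<beta> (Suc K))) \<le> dist_to_int (real n * \<beta>)"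
    using cf_err_ge[of K] dist_to_int_ge_cf_err[OF n(1) K] by linarith
  define Q where "Q = real_of_int (cf_den \<beta> (Suc J))"
  have Q1: "Q \<ge> 1" using cf_den_pos[of J] by (simp add: Q_def)
  have qpos: "0 < real_of_int (cf_den \<beta> (Suc K))" using cf_den_pos[of K] by simp
  have "1 / (2 * (b + 1)) / max (real n) Q = 1 / (2 * ((b + 1) * max (real n) Q))" by (simp add: algebra_simps)
  also have "\<dots> \<le> 1 / (2 * of_int (cf_den \<beta> (Suc K)))"
  proof -
    have "real_of_int (cf_den \<beta> (Suc K)) \<le> (b + 1) * max (real n) Q"
    proof (cases "K \<le> J")
      case True
      then have "real_of_int (cf_den \<beta> (Suc K)) \<le> Q" unfolding Q_def using cf_den_mono[of "Suc K" "Suc J"] by simp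
      also have "\<dots> \<le> 1 * max (real n) Q" by simp
      also have "\<dots> \<le> (b + 1) * max (real n) Q" using b1 Q1 by (intro mult_right_mono) auto
      finally show ?thesis .
    next
      case False
      then have "partial_quotient \<beta> K \<le> B" using B KJT by simp
      then have "partial_quotient \<beta> K * cf_den \<beta> K \<le> B * cf_den \<beta> K"
        using cf_den_pos[of K] by (intro mult_right_mono) auto
      moreover have "cf_den \<beta> K' \<le> cf_den \<beta> K" using cf_den_mono_Suc[of K'] K' by simp
      ultimately have "cf_den \<beta> (Suc K) \<le> (B + 1) * cf_den \<beta> K" using K' by (simp add: algebra_simps)
      also have "\<dots> \<le> (B + 1) * int n" using nK B by (intro mult_left_mono) auto
      finally have "real_of_int (cf_den \<beta> (Suc K)) \<le> real_of_int ((B + 1) * int n)" by (simp only: of_int_le_iff)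
      also have "\<dots> = (b + 1) * real n" by (simp add: b_def)
      also have "\<dots> \<le> (b + 1) * max (real n) Q" using b1 by (intro mult_left_mono) auto
      finally show ?thesis .
    qed
    then show ?thesis using qpos by (intro divide_left_mono mult_left_mono mult_pos_pos) (use b1 Q1 in auto)
  qed
  also note d
  finally show "1 / (2 * (real_of_int B + 1)) / max (real n) (real_of_int (cf_den \<beta> (Suc J))) \<le> dist_to_int (real n * \<beta>)"
    unfolding b_def Q_def .
qed

end

lemma strict_mono_on_ge:
  fixes f :: "nat \<Rightarrow> nat"
  assumes "strict_mono_on {1..} f"
  shows "k \<ge> 1 \<Longrightarrow> f 1 + k \<le> f k + 1"
proof (induction k rule: dec_induct)
  case (step n)
  then have "f n < f (Suc n)" using assms by (intro strict_mono_onD[OF assms]) auto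
  then show ?case using step by simp
qed simp

lemma bad_window_weaken:
  assumes "bad_window c Q Z \<beta>" "0 \<le> c" "Q \<le> Q'" "Z' \<le> Z" "0 < Q"
  shows "bad_window c Q' Z' \<beta>"
  unfolding bad_window_def
proof (intro allI impI)
  fix n :: nat assume n: "1 \<le> n" "real n \<le> Z'"
  have "c / max (real n) Q' \<le> c / max (real n) Q"
    using assms by (intro divide_left_mono mult_pos_pos) auto
  also have "\<dots> \<le> dist_to_int (real n * \<beta>)" using bad_windowD[OF assms(1) n(1)] n(2) assms(4) by simp
  finally show "c / max (real n) Q' \<le> dist_to_int (real n * \<beta>)" .
qed

text \<open>A stretch of \<delta> log q bounded quotients lifts the denominator q to a fixed power
  of itself with exponent above 1; \<open>a\<close> is chosen so that this exponent exceeds 1 + 4 /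
  a. Rounding to powers of two gives every window the same shape.\<close>

lemma iba_imp_windows:
  assumes "intermittently_badly_approximable \<beta>"
  obtains c :: real and a :: nat where "0 < c" "2 \<le> a"
    "\<And>M. \<exists>m\<ge>M. bad_window c (2 ^ (m * a)) (2 ^ (m * (a + 4))) \<beta>"
proof -
  obtain \<delta> :: real and B :: int and j T :: "nat \<Rightarrow> nat" where
    b: "0 < \<beta>" "\<beta> < 1" "\<beta> \<notin> \<rat>" and \<delta>: "0 < \<delta>" and B: "1 \<le> B"
    and j: "strict_mono_on {1..} j" and T: "strict_mono_on {1..} T"
    and k1: "\<And>k. k \<ge> 1 \<Longrightarrow> 1 \<le> j k"
    and kB: "\<And>k i. k \<ge> 1 \<Longrightarrow> j k \<le> i \<Longrightarrow> i \<le> j k + T k \<Longrightarrow> partial_quotient \<beta> i \<le> B"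
    and kT: "\<And>k. k \<ge> 1 \<Longrightarrow> real (T k) \<ge> \<delta> * ln (real_of_int (convergent_denom \<beta> (j k)))"
    using assms unfolding intermittently_badly_approximable_def by auto
  define c where "c = 1 / (2 * (real_of_int B + 1))"
  \<comment> \<open>With L the binary logarithm of q, the hypothesis on T_k becomes t >= 16 L / a.
    Half of t counts doublings, so the exponent gains 8 L / a where 4 L / a is wanted; the surplus
    pays for rounding.\<close>
  define a where "a = max 2 (nat \<lceil>16 / (\<delta> * ln 2)\<rceil>)"
  have a2: "2 \<le> a" by (simp add: a_def)
  have "16 / (\<delta> * ln 2) \<le> real a" unfolding a_def by linarith
  then have a16: "16 \<le> real a * (\<delta> * ln 2)" using \<delta> by (simp add: pos_divide_le_eq)
  have c0: "0 < c" using B by (simp add: c_def)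
  show thesis
  proof (rule that[OF c0 a2])
    fix M :: nat
    \<comment> \<open>Both sequences increase strictly, so j_k >= k and T_k >= k - 1. The part 2 M a
      forces q >= 2^(M a), hence m >= M; the part 4 (a + 6) makes T_k large enough to cover the
      rounding.\<close>
    define k where "k = 4 * (a + 6) + 2 * (M * a) + 2"
    have kk: "k \<ge> 1" by (simp add: k_def)
    define J where "J = j k" define t where "t = T k"
    define q where "q = real_of_int (cf_den \<beta> (Suc J))"
    define L where "L = log 2 q"
    have q1: "q \<ge> 1" using cf_den_pos[OF b(3,1,2), of J] by (simp add: q_def)
    have qL: "q = 2 powr L" using q1 by (simp add: L_def)
    have jk: "J \<ge> k" using strict_mono_on_ge[OF j kk] k1[of 1] by (simp add: J_def)
    have tk: "t + 1 \<ge> k" using strict_mono_on_ge[OF T kk] by (simp add: t_def)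
    have LM: "real (M * a) \<le> L"
    proof -
      have "2 ^ (M * a) * cf_den \<beta> (Suc 0) \<le> cf_den \<beta> (Suc 0 + 2 * (M * a))"
        by (rule cf_den_growth[OF b(3,1,2)])
      also have "\<dots> \<le> cf_den \<beta> (Suc J)" using jk by (intro cf_den_mono[OF b(3,1,2)]) (simp add: k_def)
      finally have "real_of_int (2 ^ (M * a)) \<le> q" unfolding q_def by (simp only: of_int_le_iff) simp
      then have "2 powr real (M * a) \<le> 2 powr L" using qL powr_realpow[of 2 "M * a"] by (simp del: of_nat_mult)
      then show ?thesis by (simp del: of_nat_mult)
    qed
    then have L0: "L \<ge> 0" by (smt (verit) of_nat_0_le_iff)
    \<comment> \<open>The least m with q <= 2^(m a). Rounding up adds at most a + 4 to the exponent
      m (a + 4).\<close>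
    define m where "m = nat \<lceil>L / real a\<rceil>"
    have apos: "real a > 0" using a2 by simp
    have m_ge: "L / real a \<le> real m" unfolding m_def by linarith
    have m_le: "real m \<le> L / real a + 1" unfolding m_def using L0 apos by (simp add: of_nat_nat)
    have "M \<le> m"
    proof -
      have "real M \<le> L / real a" using LM apos by (simp add: pos_le_divide_eq)
      then show ?thesis using m_ge by linarith
    qed
    moreover have "bad_window c (2 ^ (m * a)) (2 ^ (m * (a + 4))) \<beta>"
    proof (rule bad_window_weaken)
      show "bad_window c q (of_int (cf_den \<beta> (Suc (J + t))) - 1) \<beta>"
        unfolding c_def q_def
        by (rule bad_window_of_bounded_quotients[OF b(3,1,2) B]) (use kB[OF kk] in \<open>auto simp: J_def t_def\<close>)
      show "0 \<le> c" using c0 by simp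
      show "0 < q" using q1 by simp
      have "L \<le> real (m * a)" using m_ge apos by (simp add: pos_divide_le_eq)
      then have "2 powr L \<le> 2 powr real (m * a)" by simp
      then show "q \<le> 2 ^ (m * a)" using qL powr_realpow[of 2 "m * a"] by (simp del: of_nat_mult)
      define h where "h = t div 2"
      have h: "real t \<le> 2 * real h + 1" unfolding h_def by linarith
      have "2 ^ h * cf_den \<beta> (Suc J) \<le> cf_den \<beta> (Suc J + 2 * h)" by (rule cf_den_growth[OF b(3,1,2)])
      also have "\<dots> \<le> cf_den \<beta> (Suc (J + t))" by (intro cf_den_mono[OF b(3,1,2)]) (simp add: h_def)
      finally have "real_of_int (2 ^ h * cf_den \<beta> (Suc J)) \<le> of_int (cf_den \<beta> (Suc (J + t)))"
        by (simp only: of_int_le_iff)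
      then have g1: "2 powr (real h + L) \<le> of_int (cf_den \<beta> (Suc (J + t)))"
        using qL by (simp add: powr_add powr_realpow q_def)
      have ln_q: "ln q = L * ln 2" unfolding qL by (simp add: ln_powr)
      have tL: "\<delta> * (L * ln 2) \<le> real t"
        using kT[OF kk] convergent_denom_eq[OF b(3,1,2)] ln_q by (simp add: J_def t_def q_def)
      have "16 * L \<le> real a * (\<delta> * ln 2) * L" using a16 L0 by (intro mult_right_mono) auto
      also have "\<dots> = real a * (\<delta> * (L * ln 2))" by simp
      also have "\<dots> \<le> real a * real t" using tL by (intro mult_left_mono) auto
      finally have "16 * (L / real a) \<le> real t" using apos by (simp add: pos_divide_le_eq mult.commute)
      moreover have "real t \<ge> 4 * (real a + 6)" using tk by (simp add: k_def)
      moreover have "real (m * (a + 4)) \<le> L + real a + 4 * (L / real a) + 4"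
      proof -
        have "real (m * (a + 4)) = real m * (real a + 4)" by simp
        also have "\<dots> \<le> (L / real a + 1) * (real a + 4)" using m_le by (intro mult_right_mono) auto
        also have "\<dots> = L + real a + 4 * (L / real a) + 4" using apos by (simp add: field_simps)
        finally show ?thesis .
      qed
      ultimately have "X + 1 \<le> real h + L"
        if "X = real (m * (a + 4))" "r = L / real a" for X r
        using h unfolding that[symmetric] by argo
      then have "real (m * (a + 4)) + 1 \<le> real h + L" by blast
      then have "2 powr (real (m * (a + 4)) + 1) \<le> 2 powr (real h + L)" by simp
      then have "2 * 2 ^ (m * (a + 4)) \<le> real_of_int (cf_den \<beta> (Suc (J + t)))"
        using g1 powr_realpow[of 2 "m * (a + 4)"] powr_add[of 2 "real (m * (a + 4))" 1] by (simp del: of_nat_mult)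
      moreover have "1 \<le> (2::real) ^ (m * (a + 4))" by simp
      ultimately show "2 ^ (m * (a + 4)) \<le> real_of_int (cf_den \<beta> (Suc (J + t))) - 1" by linarith
    qed
    ultimately show "\<exists>m\<ge>M. bad_window c (2 ^ (m * a)) (2 ^ (m * (a + 4))) \<beta>" by blast
  qed
qed

section \<open>Selberg's upper bound sieve for prime pairs\<close>

lemma sum_Pow_alternating:
  assumes "finite A"
  shows "(\<Sum>X\<in>Pow A. (- 1) ^ card X :: real) = (if A = {} then 1 else 0)"
proof -
  have "(\<Sum>X\<in>Pow A. (- 1) ^ card X :: real) = (\<Sum>X\<in>Pow A. (\<Prod>x\<in>X. - 1) * (\<Prod>x\<in>A - X. 1))"
    by simp
  also have "\<dots> = (\<Prod>x\<in>A. (- 1) + (1::real))" by (rule prod_add[OF assms, symmetric])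
  also have "\<dots> = (if A = {} then 1 else 0)" using assms by (simp add: card_gt_0_iff)
  finally show ?thesis .
qed

text \<open>Moebius inversion in the Boolean lattice: D is E joined with an arbitrary subset of K -
  E.\<close>

lemma sum_interval_alternating:
  assumes "finite K" "E \<subseteq> K"
  shows "(\<Sum>D | E \<subseteq> D \<and> D \<subseteq> K. (- 1) ^ card D :: real) = (if E = K then (- 1) ^ card E else 0)"
proof -
  have fE: "finite E" using assms finite_subset by blast
  have "(\<Sum>D | E \<subseteq> D \<and> D \<subseteq> K. (- 1) ^ card D :: real) = (\<Sum>X\<in>Pow (K - E). (- 1) ^ card E * (- 1) ^ card X)"
  proof (rule sum.reindex_bij_witness[where i = "\<lambda>X. E \<union> X" and j = "\<lambda>D. D - E"])
    fix D assume D: "D \<in> {D. E \<subseteq> D \<and> D \<subseteq> K}"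
    then have "card D = card E + card (D - E)"
      using assms(1) fE by (metis (no_types, lifting) card_Diff_subset card_mono finite_subset le_add_diff_inverse mem_Collect_eq)
    then show "(- 1) ^ card E * (- 1) ^ card (D - E) = ((- 1) ^ card D :: real)" by (simp add: power_add)
  qed (use assms in auto)
  also have "\<dots> = (- 1) ^ card E * (\<Sum>X\<in>Pow (K - E). (- 1) ^ card X)" by (simp add: sum_distrib_left)
  also have "\<dots> = (if E = K then (- 1) ^ card E else 0)"
    using assms by (subst sum_Pow_alternating) auto
  finally show ?thesis .
qed

text \<open>The optimal weights in Selberg's sieve, indexed by finite sets instead of squarefree
  numbers, so that gcd and lcm become intersection and union.\<close>

lemma selberg_weights:
  fixes f :: "'a \<Rightarrow> real"
  assumes fin: "finite \<D>" and finD: "\<And>D. D \<in> \<D> \<Longrightarrow> finite D"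
    and down: "\<And>D E. D \<in> \<D> \<Longrightarrow> E \<subseteq> D \<Longrightarrow> E \<in> \<D>" and "{} \<in> \<D>"
    and f: "\<And>D x. D \<in> \<D> \<Longrightarrow> x \<in> D \<Longrightarrow> f x > 1"
  defines "G \<equiv> \<Sum>D\<in>\<D>. \<Prod>x\<in>D. 1 / (f x - 1)"
  obtains w :: "'a set \<Rightarrow> real" where "w {} = 1" "\<And>D. D \<in> \<D> \<Longrightarrow> \<bar>w D\<bar> \<le> (\<Prod>x\<in>D. f x)"
    "(\<Sum>D\<in>\<D>. \<Sum>E\<in>\<D>. w D * w E / (\<Prod>x\<in>D \<union> E. f x)) = 1 / G"
proof -
  define F where "F D = (\<Prod>x\<in>D. f x)" for D
  define g where "g D = (\<Prod>x\<in>D. 1 / (f x - 1))" for D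
  define h where "h D = (\<Prod>x\<in>D. f x - 1)" for D
  have Fpos: "F D > 0" if "D \<in> \<D>" for D unfolding F_def using f[OF that] by (intro prod_pos) fastforce
  have gpos: "g D > 0" if "D \<in> \<D>" for D unfolding g_def using f[OF that] by (intro prod_pos) fastforce
  have hg: "h D * g D = 1" if "D \<in> \<D>" for D
  proof -
    have "h D * g D = (\<Prod>x\<in>D. (f x - 1) * (1 / (f x - 1)))" unfolding h_def g_def by (rule prod.distrib[symmetric])
    also have "\<dots> = (\<Prod>x\<in>D. 1)" using f[OF that] by (intro prod.cong) fastforce+
    finally show ?thesis by simp
  qed
  have G: "G = (\<Sum>D\<in>\<D>. g D)" by (simp add: G_def g_def)
  have Gpos: "G > 0" unfolding G using fin gpos \<open>{} \<in> \<D>\<close> by (intro sum_pos) auto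
  \<comment> \<open>In the variables y_K, the sum of w D / F D over D containing K, the quadratic
    form is diagonal, namely the sum of h K y_K^2, and w {} = 1 is a linear condition. By
    Cauchy-Schwarz the minimum is at y_K = (-1)^|K| g K / G; solving for w gives this
    formula.\<close>
  define w where "w D = (- 1) ^ card D * F D * (\<Sum>E | E \<in> \<D> \<and> D \<subseteq> E. g E) / G" for D
  have w_empty: "w {} = 1" using Gpos by (simp add: w_def F_def G)
  have w_bound: "\<bar>w D\<bar> \<le> F D" if D: "D \<in> \<D>" for D
  proof -
    have s: "0 \<le> (\<Sum>E | E \<in> \<D> \<and> D \<subseteq> E. g E)" "(\<Sum>E | E \<in> \<D> \<and> D \<subseteq> E. g E) \<le> G"
      unfolding G by (intro sum_nonneg sum_mono2; use gpos fin less_imp_le in blast)+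
    have "\<bar>w D\<bar> = F D * ((\<Sum>E | E \<in> \<D> \<and> D \<subseteq> E. g E) / G)"
      using Fpos[OF D] s Gpos by (simp add: w_def abs_mult)
    also have "\<dots> \<le> F D * 1" using Fpos[OF D] s Gpos by (intro mult_left_mono) auto
    finally show ?thesis by simp
  qed
  have inversion: "(\<Sum>D | D \<in> \<D> \<and> E \<subseteq> D. w D / F D) = (- 1) ^ card E * g E / G" if E: "E \<in> \<D>" for E
  proof -
    have "(\<Sum>D | D \<in> \<D> \<and> E \<subseteq> D. w D / F D)
        = (\<Sum>D | D \<in> \<D> \<and> E \<subseteq> D. \<Sum>K | K \<in> \<D> \<and> D \<subseteq> K. (- 1) ^ card D * g K / G)"
    proof (rule sum.cong)
      fix D assume "D \<in> {D. D \<in> \<D> \<and> E \<subseteq> D}"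
      then have "F D \<noteq> 0" using Fpos[of D] by auto
      then show "w D / F D = (\<Sum>K | K \<in> \<D> \<and> D \<subseteq> K. (- 1) ^ card D * g K / G)"
        by (simp add: w_def sum_distrib_left sum_divide_distrib)
    qed simp
    also have "\<dots> = (\<Sum>D\<in>{D\<in>\<D>. E \<subseteq> D}. \<Sum>K\<in>{K\<in>\<D>. E \<subseteq> K}. if D \<subseteq> K then (- 1) ^ card D * g K / G else 0)"
    proof (rule sum.cong)
      fix D assume "D \<in> {D\<in>\<D>. E \<subseteq> D}"
      then have e: "{K \<in> \<D>. D \<subseteq> K} = {K \<in> {K\<in>\<D>. E \<subseteq> K}. D \<subseteq> K}" by auto
      show "(\<Sum>K | K \<in> \<D> \<and> D \<subseteq> K. (- 1) ^ card D * g K / G)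
        = (\<Sum>K\<in>{K\<in>\<D>. E \<subseteq> K}. if D \<subseteq> K then (- 1) ^ card D * g K / G else 0)"
        unfolding e by (rule sum.inter_filter) (use fin in simp)
    qed simp
    also have "\<dots> = (\<Sum>K\<in>{K\<in>\<D>. E \<subseteq> K}. \<Sum>D\<in>{D\<in>\<D>. E \<subseteq> D}. if D \<subseteq> K then (- 1) ^ card D * g K / G else 0)"
      by (rule sum.swap)
    also have "\<dots> = (\<Sum>K\<in>{K\<in>\<D>. E \<subseteq> K}. (\<Sum>D | E \<subseteq> D \<and> D \<subseteq> K. (- 1) ^ card D) * (g K / G))"
    proof (rule sum.cong)
      fix K assume K: "K \<in> {K\<in>\<D>. E \<subseteq> K}"
      then have e: "{D. E \<subseteq> D \<and> D \<subseteq> K} = {D \<in> {D\<in>\<D>. E \<subseteq> D}. D \<subseteq> K}" using down by auto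
      show "(\<Sum>D\<in>{D\<in>\<D>. E \<subseteq> D}. if D \<subseteq> K then (- 1) ^ card D * g K / G else 0)
          = (\<Sum>D | E \<subseteq> D \<and> D \<subseteq> K. (- 1) ^ card D) * (g K / G)"
        unfolding e sum_distrib_right by (rule trans[OF sum.inter_filter[symmetric]]) (use fin in simp_all)
    qed simp
    also have "\<dots> = (\<Sum>K\<in>{K\<in>\<D>. E \<subseteq> K}. if E = K then (- 1) ^ card E * (g K / G) else 0)"
      by (intro sum.cong refl, subst sum_interval_alternating) (use finD in auto)
    also have "\<dots> = (- 1) ^ card E * g E / G" using fin E by (simp add: sum.delta)
    finally show ?thesis .
  qed
  \<comment> \<open>F (D \<union> E) = F D F E / F (D \<inter> E), and F (D \<inter> E), a product
    of factors (f - 1) + 1, is the sum of h K over K \<subseteq> D \<inter> E. This separates D from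
    E and diagonalises the form.\<close>
  have "(\<Sum>D\<in>\<D>. \<Sum>E\<in>\<D>. w D * w E / F (D \<union> E))
      = (\<Sum>D\<in>\<D>. \<Sum>E\<in>\<D>. \<Sum>K\<in>\<D>. if K \<subseteq> D \<and> K \<subseteq> E then h K * (w D / F D) * (w E / F E) else 0)"
  proof (intro sum.cong refl)
    fix D E assume DE: "D \<in> \<D>" "E \<in> \<D>"
    have fD: "finite D" "finite E" using DE finD by auto
    have "F (D \<union> E) * F (D \<inter> E) = F D * F E"
      unfolding F_def using fD by (rule prod.union_inter)
    moreover have "F (D \<union> E) > 0"
      unfolding F_def using f[OF DE(1)] f[OF DE(2)] by (intro prod_pos) fastforce
    ultimately have e: "1 / F (D \<union> E) = F (D \<inter> E) / (F D * F E)"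
      using Fpos[OF DE(1)] Fpos[OF DE(2)] by (simp add: field_simps)
    have "F (D \<inter> E) = (\<Prod>x\<in>D \<inter> E. (f x - 1) + 1)" by (simp add: F_def)
    also have "\<dots> = (\<Sum>X\<in>Pow (D \<inter> E). h X)"
      using fD by (subst prod_add) (simp_all add: h_def)
    also have "Pow (D \<inter> E) = {K\<in>\<D>. K \<subseteq> D \<and> K \<subseteq> E}" using down DE by auto
    finally have F: "F (D \<inter> E) = (\<Sum>K\<in>{K\<in>\<D>. K \<subseteq> D \<and> K \<subseteq> E}. h K)" .
    have "w D * w E / F (D \<union> E) = (1 / F (D \<union> E)) * (w D * w E)" by simp
    also have "\<dots> = F (D \<inter> E) * ((w D / F D) * (w E / F E))" unfolding e by simp
    also have "\<dots> = (\<Sum>K\<in>{K\<in>\<D>. K \<subseteq> D \<and> K \<subseteq> E}. h K * (w D / F D) * (w E / F E))"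
      unfolding F sum_distrib_right by (intro sum.cong) simp_all
    also have "\<dots> = (\<Sum>K\<in>\<D>. if K \<subseteq> D \<and> K \<subseteq> E then h K * (w D / F D) * (w E / F E) else 0)"
      using fin by (rule sum.inter_filter)
    finally show "w D * w E / F (D \<union> E) = (\<Sum>K\<in>\<D>. if K \<subseteq> D \<and> K \<subseteq> E then h K * (w D / F D) * (w E / F E) else 0)" .
  qed
  also have "\<dots> = (\<Sum>D\<in>\<D>. \<Sum>K\<in>\<D>. \<Sum>E\<in>\<D>. if K \<subseteq> D \<and> K \<subseteq> E then h K * (w D / F D) * (w E / F E) else 0)"
    by (intro sum.cong refl sum.swap)
  also have "\<dots> = (\<Sum>K\<in>\<D>. \<Sum>D\<in>\<D>. \<Sum>E\<in>\<D>. if K \<subseteq> D \<and> K \<subseteq> E then h K * (w D / F D) * (w E / F E) else 0)"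
    by (rule sum.swap)
  also have "\<dots> = (\<Sum>K\<in>\<D>. g K / (G * G))"
  proof (intro sum.cong refl)
    fix K assume K: "K \<in> \<D>"
    let ?s = "\<Sum>D\<in>{D\<in>\<D>. K \<subseteq> D}. w D / F D"
    have "(\<Sum>D\<in>\<D>. \<Sum>E\<in>\<D>. if K \<subseteq> D \<and> K \<subseteq> E then h K * (w D / F D) * (w E / F E) else 0)
      = (\<Sum>D\<in>\<D>. \<Sum>E\<in>\<D>. h K * ((if K \<subseteq> D then w D / F D else 0) * (if K \<subseteq> E then w E / F E else 0)))"
      by (intro sum.cong refl) auto
    also have "\<dots> = h K * ((\<Sum>D\<in>\<D>. if K \<subseteq> D then w D / F D else 0) * (\<Sum>E\<in>\<D>. if K \<subseteq> E then w E / F E else 0))"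
      by (subst sum_product) (simp only: sum_distrib_left)
    also have "(\<Sum>D\<in>\<D>. if K \<subseteq> D then w D / F D else 0) = ?s"
      using fin by (rule sum.inter_filter[symmetric])
    also have "?s = (- 1) ^ card K * g K / G" using inversion[OF K] by simp
    also have "h K * ((- 1) ^ card K * g K / G * ((- 1) ^ card K * g K / G)) = (h K * g K) * ((- 1) ^ card K * (- 1) ^ card K) * g K / (G * G)"
      by simp
    also have "\<dots> = g K / (G * G)" using hg[OF K] by (simp flip: power_add)
    finally show "(\<Sum>D\<in>\<D>. \<Sum>E\<in>\<D>. if K \<subseteq> D \<and> K \<subseteq> E then h K * (w D / F D) * (w E / F E) else 0) = g K / (G * G)" .
  qed
  also have "\<dots> = 1 / G" using Gpos by (simp add: G flip: sum_divide_distrib)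
  finally show thesis using that[of w] w_empty w_bound by (simp add: F_def)
qed

section \<open>Residue counts by the Chinese remainder theorem\<close>

lemma card_crt:
  fixes a b :: nat
  assumes "coprime a b" "a > 0" "b > 0"
  shows "card {t. t < a * b \<and> P (t mod a) \<and> R (t mod b)} = card {t. t < a \<and> P t} * card {t. t < b \<and> R t}"
proof -
  have "bij_betw (\<lambda>t. (t mod a, t mod b)) {t. t < a * b \<and> P (t mod a) \<and> R (t mod b)} ({t. t < a \<and> P t} \<times> {t. t < b \<and> R t})"
    unfolding bij_betw_def
  proof
    show "inj_on (\<lambda>t. (t mod a, t mod b)) {t. t < a * b \<and> P (t mod a) \<and> R (t mod b)}"
    proof (rule inj_onI)
      fix x y assume x: "x \<in> {t. t < a * b \<and> P (t mod a) \<and> R (t mod b)}" and y: "y \<in> {t. t < a * b \<and> P (t mod a) \<and> R (t mod b)}"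
        and e: "(x mod a, x mod b) = (y mod a, y mod b)"
      have "[x = y] (mod a)" "[x = y] (mod b)" using e by (auto simp: cong_def)
      then have "[x = y] (mod (a * b))" using assms(1) by (simp add: coprime_cong_mult_nat)
      then show "x = y" using x y by (simp add: cong_def)
    qed
    show "(\<lambda>t. (t mod a, t mod b)) ` {t. t < a * b \<and> P (t mod a) \<and> R (t mod b)} = {t. t < a \<and> P t} \<times> {t. t < b \<and> R t}"
    proof (intro equalityI subsetI)
      fix z assume "z \<in> (\<lambda>t. (t mod a, t mod b)) ` {t. t < a * b \<and> P (t mod a) \<and> R (t mod b)}"
      then show "z \<in> {t. t < a \<and> P t} \<times> {t. t < b \<and> R t}" using assms by auto
    next
      fix z assume "z \<in> {t. t < a \<and> P t} \<times> {t. t < b \<and> R t}"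
      then obtain u v where z: "z = (u, v)" "u < a" "v < b" "P u" "R v" by blast
      obtain t where t: "t < a * b" "[t = u] (mod a)" "[t = v] (mod b)"
        using binary_chinese_remainder_unique_nat[OF assms(1), of u v] assms by auto
      then have "t mod a = u" "t mod b = v" using z by (auto simp: cong_def)
      then show "z \<in> (\<lambda>t. (t mod a, t mod b)) ` {t. t < a * b \<and> P (t mod a) \<and> R (t mod b)}"
        using t z by (intro image_eqI[where x = t]) auto
    qed
  qed
  then have "card {t. t < a * b \<and> P (t mod a) \<and> R (t mod b)} = card ({t. t < a \<and> P t} \<times> {t. t < b \<and> R t})"
    by (rule bij_betw_same_card)
  then show ?thesis by (simp add: card_cartesian_product)
qed

text \<open>For a prime l this counts the roots of t (t + n) modulo l: they are 0 and -n, which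
  coincide exactly if l divides n.\<close>

definition twin_roots :: "nat \<Rightarrow> nat \<Rightarrow> nat" where
  "twin_roots n l = (if l dvd n then 1 else 2)"

lemma card_twin_roots:
  assumes "prime (l::nat)"
  shows "card {t. t < l \<and> l dvd t * (t + n)} = twin_roots n l"
proof -
  have l: "l > 1" using assms prime_gt_1_nat by blast
  define s where "s = (l - n mod l) mod l"
  have sl: "s < l" using l by (simp add: s_def)
  have ls: "l dvd s + n"
  proof -
    have "(s + n) mod l = ((l - n mod l) + n mod l) mod l"
      by (simp add: s_def mod_add_left_eq mod_add_right_eq)
    also have "(l - n mod l) + n mod l = l" using l by (simp add: le_add_diff_inverse2 less_imp_le)
    finally show ?thesis by (simp add: dvd_eq_mod_eq_0)
  qed
  have "{t. t < l \<and> l dvd t * (t + n)} = {0, s}"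
  proof (intro equalityI subsetI)
    fix t assume "t \<in> {t. t < l \<and> l dvd t * (t + n)}"
    then have t: "t < l" "l dvd t \<or> l dvd t + n" using assms by (auto simp: prime_dvd_mult_iff)
    show "t \<in> {0, s}"
    proof (cases "l dvd t")
      case True then show ?thesis using t by (metis gr0I insertI1 nat_dvd_not_less)
    next
      case False
      then have "l dvd t + n" using t by blast
      then have "[t + n = s + n] (mod l)" using ls by (simp add: cong_def dvd_eq_mod_eq_0)
      then have "[t = s] (mod l)" by (simp add: cong_add_rcancel_nat)
      then show ?thesis using t sl by (simp add: cong_def)
    qed
  next
    fix t assume "t \<in> {0, s}"
    then show "t \<in> {t. t < l \<and> l dvd t * (t + n)}" using l sl ls by auto
  qed
  moreover have "s = 0 \<longleftrightarrow> l dvd n"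
  proof
    assume "s = 0" then show "l dvd n" using ls by simp
  next
    assume "l dvd n"
    then have "l dvd s" using ls by (simp add: dvd_add_left_iff)
    then show "s = 0" using sl by (metis gr0I nat_dvd_not_less)
  qed
  ultimately show ?thesis by (simp add: twin_roots_def card_insert_if)
qed

lemma card_twin_roots_prod:
  assumes "finite D" "\<And>l. l \<in> D \<Longrightarrow> prime (l::nat)"
  shows "card {t. t < \<Prod>D \<and> (\<forall>l\<in>D. l dvd t * (t + n))} = (\<Prod>l\<in>D. twin_roots n l)"
  using assms
proof (induction D rule: finite_induct)
  case empty then show ?case by simp
next
  case (insert l D)
  have l: "prime l" using insert by simp
  have D0: "\<Prod>D > 0" using insert by (intro prod_pos) (auto simp: prime_gt_0_nat)
  have cop: "coprime l (\<Prod>D)"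
    using insert by (intro prod_coprime_right) (metis insertCI primes_coprime)
  have md: "d dvd (t mod m) * (t mod m + n) \<longleftrightarrow> d dvd t * (t + n)" if "d dvd m" for d t m :: nat
  proof -
    have "[t mod m = t] (mod d)" using that by (simp add: cong_def mod_mod_cancel)
    then have "[(t mod m) * (t mod m + n) = t * (t + n)] (mod d)"
      by (intro cong_mult cong_add cong_refl)
    then show ?thesis by (rule cong_dvd_iff)
  qed
  have e: "{t. t < \<Prod>(insert l D) \<and> (\<forall>l\<in>insert l D. l dvd t * (t + n))}
     = {t. t < l * \<Prod>D \<and> l dvd (t mod l) * (t mod l + n) \<and> (\<forall>l\<in>D. l dvd (t mod \<Prod>D) * (t mod \<Prod>D + n))}"
  proof -
    have m1: "l' dvd (t mod \<Prod>D) * (t mod \<Prod>D + n) \<longleftrightarrow> l' dvd t * (t + n)" if "l' \<in> D" for l' t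
      by (rule md, rule dvd_prodI[of D l' "\<lambda>x. x"]) (use insert that in auto)
    have m2: "l dvd (t mod l) * (t mod l + n) \<longleftrightarrow> l dvd t * (t + n)" for t by (rule md) simp
    have m3: "\<Prod>(insert l D) = l * \<Prod>D" using insert.hyps by simp
    show ?thesis
    proof (rule Collect_cong)
      fix t
      have "(\<forall>l\<in>D. l dvd (t mod \<Prod>D) * (t mod \<Prod>D + n)) \<longleftrightarrow> (\<forall>l\<in>D. l dvd t * (t + n))"
        by (rule ball_cong[OF refl m1])
      then show "(t < \<Prod>(insert l D) \<and> (\<forall>l\<in>insert l D. l dvd t * (t + n))) \<longleftrightarrow>
        (t < l * \<Prod>D \<and> l dvd (t mod l) * (t mod l + n) \<and> (\<forall>l\<in>D. l dvd (t mod \<Prod>D) * (t mod \<Prod>D + n)))"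
        unfolding m2 m3 by blast
    qed
  qed
  have "card {t. t < \<Prod>(insert l D) \<and> (\<forall>l\<in>insert l D. l dvd t * (t + n))}
      = card {t. t < l \<and> l dvd t * (t + n)} * card {t. t < \<Prod>D \<and> (\<forall>l\<in>D. l dvd t * (t + n))}"
    unfolding e by (rule card_crt[OF cop prime_gt_0_nat[OF l] D0,
          of "\<lambda>x. l dvd x * (x + n)" "\<lambda>x. \<forall>l\<in>D. l dvd x * (x + n)"])
  also have "card {t. t < l \<and> l dvd t * (t + n)} = twin_roots n l" by (rule card_twin_roots[OF l])
  also have "card {t. t < \<Prod>D \<and> (\<forall>l\<in>D. l dvd t * (t + n))} = (\<Prod>l\<in>D. twin_roots n l)"
    using insert by simp
  also have "twin_roots n l * (\<Prod>l\<in>D. twin_roots n l) = (\<Prod>l\<in>insert l D. twin_roots n l)"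
    using insert.hyps by simp
  finally show ?case .
qed

lemma card_periodic_period:
  fixes d :: nat
  assumes "d > 0"
  shows "card {t. N < t \<and> t \<le> N + d \<and> P (t mod d)} = card {t. t < d \<and> P t}"
proof -
  have inj: "inj_on (\<lambda>t. t mod d) {N<..N + d}"
  proof (rule inj_onI)
    have *: "x \<le> y \<Longrightarrow> x mod d = y mod d \<Longrightarrow> x \<in> {N<..N + d} \<Longrightarrow> y \<in> {N<..N + d} \<Longrightarrow> x = y" for x y
    proof -
      assume a: "x \<le> y" "x mod d = y mod d" "x \<in> {N<..N + d}" "y \<in> {N<..N + d}"
      then have "d dvd y - x" by (metis mod_eq_dvd_iff_nat)
      moreover have "y - x < d" using a by auto
      ultimately have "y - x = 0" by (metis gr0I nat_dvd_not_less)
      then show "x = y" using a by simp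
    qed
    fix x y assume "x \<in> {N<..N + d}" "y \<in> {N<..N + d}" "x mod d = y mod d"
    then show "x = y" using *[of x y] *[of y x] by (cases "x \<le> y") auto
  qed
  have "(\<lambda>t. t mod d) ` {N<..N + d} = {..<d}"
  proof (rule card_subset_eq)
    show "(\<lambda>t. t mod d) ` {N<..N + d} \<subseteq> {..<d}" using assms by auto
    show "card ((\<lambda>t. t mod d) ` {N<..N + d}) = card {..<d}" using inj by (simp add: card_image)
  qed simp
  then have img: "(\<lambda>t. t mod d) ` {N<..N + d} = {..<d}" .
  have "(\<lambda>t. t mod d) ` {t. N < t \<and> t \<le> N + d \<and> P (t mod d)} = {t. t < d \<and> P t}"
  proof (intro equalityI subsetI)
    fix x assume "x \<in> {t. t < d \<and> P t}"
    then have x: "x \<in> {..<d}" "P x" by auto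
    then obtain t where "t \<in> {N<..N + d}" "x = t mod d" unfolding img[symmetric] by blast
    then show "x \<in> (\<lambda>t. t mod d) ` {t. N < t \<and> t \<le> N + d \<and> P (t mod d)}"
      using x by (intro image_eqI[of _ _ t]) auto
  qed (use assms in auto)
  moreover have "inj_on (\<lambda>t. t mod d) {t. N < t \<and> t \<le> N + d \<and> P (t mod d)}"
    by (rule inj_on_subset[OF inj]) auto
  ultimately show ?thesis using card_image by fastforce
qed

lemma card_periodic_mult:
  fixes d :: nat
  assumes "d > 0"
  shows "card {t. N < t \<and> t \<le> N + k * d \<and> P (t mod d)} = k * card {t. t < d \<and> P t}"
proof (induction k)
  case (Suc k)
  have e: "{t. N < t \<and> t \<le> N + Suc k * d \<and> P (t mod d)}
     = {t. N < t \<and> t \<le> N + k * d \<and> P (t mod d)} \<union> {t. N + k * d < t \<and> t \<le> (N + k * d) + d \<and> P (t mod d)}"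
    by auto
  have "card {t. N < t \<and> t \<le> N + Suc k * d \<and> P (t mod d)} = card {t. N < t \<and> t \<le> N + k * d \<and> P (t mod d)} + card {t. N + k * d < t \<and> t \<le> (N + k * d) + d \<and> P (t mod d)}"
    unfolding e by (rule card_Un_disjoint) auto
  then show ?case using Suc card_periodic_period[OF assms, of "N + k * d" P] by simp
qed simp

text \<open>Complete periods contribute exactly. The incomplete one and its expected contribution
  both lie between 0 and d.\<close>

lemma card_periodic_approx:
  fixes d :: nat
  assumes "d > 0"
  shows "\<bar>real (card {t. N < t \<and> t \<le> N + M \<and> P (t mod d)}) - real M * real (card {t. t < d \<and> P t}) / real d\<bar> \<le> real d"
proof -
  define q r where "q = M div d" and "r = M mod d"
  have M: "M = q * d + r" and r: "r < d" using assms by (auto simp: q_def r_def)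
  define c where "c = card {t. t < d \<and> P t}"
  have cd: "c \<le> d"
  proof -
    have "c \<le> card {..<d}" unfolding c_def by (intro card_mono) auto
    then show ?thesis by simp
  qed
  let ?A = "{t. N < t \<and> t \<le> N + M \<and> P (t mod d)}"
  let ?B = "{t. N < t \<and> t \<le> N + q * d \<and> P (t mod d)}"
  have fA: "finite ?A" by (rule finite_subset[of _ "{..N + M}"]) auto
  have B: "card ?B = q * c" unfolding c_def by (rule card_periodic_mult[OF assms])
  have lo: "card ?B \<le> card ?A" using fA M by (intro card_mono) auto
  have "card ?A \<le> card (?B \<union> {N + q * d<..N + M})"
    by (intro card_mono) (auto intro: finite_subset[of _ "{..N + q * d}"])
  also have "\<dots> \<le> card ?B + card {N + q * d<..N + M}" by (rule card_Un_le)
  finally have hi: "card ?A \<le> q * c + r" using B M by simp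
  have e: "real M * real c / real d = real q * real c + real r * real c / real d"
    using assms by (simp add: M field_simps)
  have "real r * real c / real d \<le> real r * real d / real d" using cd by (intro divide_right_mono mult_left_mono) auto
  then have "real r * real c / real d \<le> real d" using assms r by simp
  moreover have "0 \<le> real r * real c / real d" by simp
  moreover have "real q * real c \<le> real (card ?A)" using of_nat_mono[OF lo, where ?'a = real] unfolding B of_nat_mult .
  moreover have "real (card ?A) \<le> real q * real c + real d"
    using of_nat_mono[OF hi, where ?'a = real] r unfolding of_nat_add of_nat_mult by linarith
  ultimately show ?thesis unfolding c_def[symmetric] e by linarith
qed

text \<open>The squarefree numbers up to R, encoded by their sets of prime factors as
  \<open>selberg_weights\<close> requires.\<close>

definition prime_sets :: "nat \<Rightarrow> nat set set" where
  "prime_sets R = {D. finite D \<and> (\<forall>l\<in>D. prime l) \<and> \<Prod>D \<le> R}"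

lemma prime_setsD:
  assumes "D \<in> prime_sets R"
  shows "finite D" "\<And>l. l \<in> D \<Longrightarrow> prime l" "\<Prod>D \<le> R" "\<Prod>D \<ge> 1" "\<And>l. l \<in> D \<Longrightarrow> l \<le> R"
proof -
  show D: "finite D" "\<And>l. l \<in> D \<Longrightarrow> prime l" "\<Prod>D \<le> R" using assms by (auto simp: prime_sets_def)
  have "\<Prod>D > 0" using D by (intro prod_pos) (auto simp: prime_gt_0_nat)
  then show "\<Prod>D \<ge> 1" by simp
  fix l assume "l \<in> D"
  then have "l dvd \<Prod>D" using D(1) dvd_prodI[of D l "\<lambda>x. x"] by simp
  then have "l \<le> \<Prod>D" using \<open>\<Prod>D > 0\<close> by (rule dvd_imp_le)
  then show "l \<le> R" using D(3) by simp
qed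

lemma finite_prime_sets: "finite (prime_sets R)"
  by (rule finite_subset[of _ "Pow {..R}"]) (use prime_setsD(5) in auto)

lemma empty_in_prime_sets: "R \<ge> 1 \<Longrightarrow> {} \<in> prime_sets R"
  by (simp add: prime_sets_def)

lemma prime_sets_down:
  assumes "D \<in> prime_sets R" "E \<subseteq> D"
  shows "E \<in> prime_sets R"
proof -
  note D = prime_setsD[OF assms(1)]
  have "\<Prod>E dvd \<Prod>D" using D(1) assms(2) by (rule prod_dvd_prod_subset)
  then have "\<Prod>E \<le> \<Prod>D" using D(4) by (intro dvd_imp_le) auto
  then show ?thesis using D assms(2) by (auto simp: prime_sets_def intro: finite_subset)
qed

lemma prime_dvd_prod_primes_iff:
  assumes "finite D" "\<And>l. l \<in> D \<Longrightarrow> prime (l::nat)" "prime p"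
  shows "p dvd \<Prod>D \<longleftrightarrow> p \<in> D"
proof
  assume "p dvd \<Prod>D"
  then obtain q where "q \<in> D" "p dvd q" using assms prime_dvd_prod_iff[of D p "\<lambda>x. x"] by auto
  then show "p \<in> D" using assms primes_dvd_imp_eq by metis
next
  assume "p \<in> D" then show "p dvd \<Prod>D" using assms(1) dvd_prodI[of D p "\<lambda>x. x"] by simp
qed

lemma inj_on_Prod_prime_sets: "inj_on Prod (prime_sets R)"
proof (rule inj_onI)
  fix D E assume D: "D \<in> prime_sets R" and E: "E \<in> prime_sets R" and e: "\<Prod>D = \<Prod>E"
  show "D = E"
    using prime_dvd_prod_primes_iff[of D] prime_dvd_prod_primes_iff[of E] prime_setsD[OF D] prime_setsD[OF E] e
    by (metis subsetI subset_antisym)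
qed

lemma card_prime_sets_le: "card (prime_sets R) \<le> R"
proof -
  have "card (prime_sets R) = card (Prod ` prime_sets R)" by (simp add: card_image inj_on_Prod_prime_sets)
  also have "\<dots> \<le> card {1..R}" using prime_setsD(3,4) by (intro card_mono) auto
  finally show ?thesis by simp
qed

text \<open>The reciprocal of the proportion of residues modulo l that the sieve removes; it plays
  the role of f in \<open>selberg_weights\<close>.\<close>

definition twin_density_inv :: "nat \<Rightarrow> nat \<Rightarrow> real" where
  "twin_density_inv n l = real l / real (twin_roots n l)"

text \<open>The G of \<open>selberg_weights\<close> for this sieve, so its reciprocal is the sieved
  density.\<close>

definition twin_sieve_sum :: "nat \<Rightarrow> nat \<Rightarrow> real" where
  "twin_sieve_sum n R = (\<Sum>D\<in>prime_sets R. \<Prod>l\<in>D. 1 / (twin_density_inv n l - 1))"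

text \<open>For odd n both classes modulo 2 are roots and the value at 2 is 1, where the weights
  would divide by zero. Hence the restriction to even n.\<close>

lemma twin_density_inv_gt_1: "even n \<Longrightarrow> prime l \<Longrightarrow> twin_density_inv n l > 1"
  using prime_ge_2_nat[of l] by (cases "l = 2") (auto simp: twin_density_inv_def twin_roots_def)

lemma twin_density_inv_le: "prime l \<Longrightarrow> twin_density_inv n l \<le> real l"
  by (auto simp: twin_density_inv_def twin_roots_def)

text \<open>Selberg's majorant is the square of the sum of w D over those D all of whose primes
  divide t (t + n). If t and t + n are primes above R, only D = {} occurs and the square is 1. The
  error comes from at most R^2 pairs of sets, with weights at most R each and a modulus at most R^2:
  in all R^6.\<close>

lemma card_twin_primes_le:
  assumes "even n" "1 \<le> R" "R \<le> N"
  shows "real (card {p. N < p \<and> p \<le> N + M \<and> prime p \<and> prime (p + n)}) \<le> real M / twin_sieve_sum n R + real R ^ 6"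
proof -
  let ?D = "prime_sets R"
  let ?f = "twin_density_inv n"
  have f1: "?f l > 1" if "D \<in> ?D" "l \<in> D" for D l
    using that prime_setsD(2) twin_density_inv_gt_1[OF assms(1)] by blast
  have "\<exists>w. w {} = 1 \<and> (\<forall>D\<in>?D. \<bar>w D\<bar> \<le> (\<Prod>l\<in>D. ?f l)) \<and>
    (\<Sum>D\<in>?D. \<Sum>E\<in>?D. w D * w E / (\<Prod>l\<in>D \<union> E. ?f l)) = 1 / twin_sieve_sum n R"
    unfolding twin_sieve_sum_def
  proof (rule selberg_weights[where f = ?f, OF finite_prime_sets[of R] prime_setsD(1)[of _ R] prime_sets_down[of _ R]
        empty_in_prime_sets[OF assms(2)] f1])
    fix w :: "nat set \<Rightarrow> real"
    assume "w {} = 1" "\<And>D. D \<in> ?D \<Longrightarrow> \<bar>w D\<bar> \<le> (\<Prod>l\<in>D. ?f l)"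
      "(\<Sum>D\<in>?D. \<Sum>E\<in>?D. w D * w E / (\<Prod>l\<in>D \<union> E. ?f l)) = 1 / (\<Sum>D\<in>?D. \<Prod>l\<in>D. 1 / (?f l - 1))"
    then show "\<exists>w. w {} = 1 \<and> (\<forall>D\<in>?D. \<bar>w D\<bar> \<le> (\<Prod>l\<in>D. ?f l)) \<and>
      (\<Sum>D\<in>?D. \<Sum>E\<in>?D. w D * w E / (\<Prod>l\<in>D \<union> E. ?f l)) = 1 / (\<Sum>D\<in>?D. \<Prod>l\<in>D. 1 / (?f l - 1))"
      by (intro exI[of _ w]) simp
  qed
  then obtain w where w: "w {} = 1" "\<And>D. D \<in> ?D \<Longrightarrow> \<bar>w D\<bar> \<le> (\<Prod>l\<in>D. ?f l)"
    "(\<Sum>D\<in>?D. \<Sum>E\<in>?D. w D * w E / (\<Prod>l\<in>D \<union> E. ?f l)) = 1 / twin_sieve_sum n R"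
    by blast
  define I where "I = {t. N < t \<and> t \<le> N + M}"
  have finI: "finite I" unfolding I_def by (rule finite_subset[of _ "{..N + M}"]) auto
  define S where "S D t \<longleftrightarrow> (\<forall>l\<in>D. l dvd t * (t + n))" for D t
  define Z where "Z t = (\<Sum>D\<in>?D. if S D t then w D else 0)" for t
  have wR: "\<bar>w D\<bar> \<le> real R" if D: "D \<in> ?D" for D
  proof -
    have "(\<Prod>l\<in>D. ?f l) \<le> (\<Prod>l\<in>D. real l)"
    proof (rule prod_mono)
      fix l assume l: "l \<in> D"
      show "0 \<le> ?f l \<and> ?f l \<le> real l"
        using f1[OF D l] twin_density_inv_le[OF prime_setsD(2)[OF D l], of n] by linarith
    qed
    also have "\<dots> = real (\<Prod>D)" by simp
    also have "\<dots> \<le> real R" using prime_setsD(3)[OF D] by (rule of_nat_mono)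
    finally show ?thesis using w(2)[OF D] by linarith
  qed
  have "real (card {p. N < p \<and> p \<le> N + M \<and> prime p \<and> prime (p + n)})
      = (\<Sum>t\<in>I. if prime t \<and> prime (t + n) then 1 else 0)"
  proof -
    have "{p. N < p \<and> p \<le> N + M \<and> prime p \<and> prime (p + n)} = {t\<in>I. prime t \<and> prime (t + n)}"
      unfolding I_def by blast
    then show ?thesis using finI by (simp add: sum.If_cases Int_def)
  qed
  also have "\<dots> \<le> (\<Sum>t\<in>I. Z t ^ 2)"
  proof (rule sum_mono)
    fix t assume t: "t \<in> I"
    show "(if prime t \<and> prime (t + n) then 1 else 0) \<le> Z t ^ 2"
    proof (cases "prime t \<and> prime (t + n)")
      case True
      have "S D t \<longleftrightarrow> D = {}" if D: "D \<in> ?D" for D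
      proof
        assume SD: "S D t"
        show "D = {}"
        proof (rule ccontr)
          assume "D \<noteq> {}"
          then obtain l where l: "l \<in> D" by blast
          then have pl: "prime l" "l \<le> R" using prime_setsD[OF D] by auto
          have "l dvd t \<or> l dvd t + n" using SD l pl by (auto simp: S_def prime_dvd_mult_iff)
          then have "l = t \<or> l = t + n" using True pl primes_dvd_imp_eq by blast
          then show False using t pl assms by (auto simp: I_def)
        qed
      qed (simp add: S_def)
      then have "Z t = (\<Sum>D\<in>?D. if D = {} then w D else 0)" unfolding Z_def by (intro sum.cong) auto
      also have "\<dots> = w {}" using finite_prime_sets[of R] empty_in_prime_sets[OF assms(2)] by (simp add: sum.delta)
      finally show ?thesis using w(1) by simp
    next
      case False
      then show ?thesis by (simp only: if_False zero_le_power2)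
    qed
  qed
  also have "\<dots> = (\<Sum>t\<in>I. \<Sum>D\<in>?D. \<Sum>E\<in>?D. if S (D \<union> E) t then w D * w E else 0)"
  proof (intro sum.cong refl)
    fix t
    have "Z t ^ 2 = (\<Sum>D\<in>?D. \<Sum>E\<in>?D. (if S D t then w D else 0) * (if S E t then w E else 0))"
      unfolding Z_def power2_eq_square by (rule sum_product)
    also have "\<dots> = (\<Sum>D\<in>?D. \<Sum>E\<in>?D. if S (D \<union> E) t then w D * w E else 0)"
      by (intro sum.cong refl) (auto simp: S_def)
    finally show "Z t ^ 2 = (\<Sum>D\<in>?D. \<Sum>E\<in>?D. if S (D \<union> E) t then w D * w E else 0)" .
  qed
  also have "\<dots> = (\<Sum>D\<in>?D. \<Sum>E\<in>?D. \<Sum>t\<in>I. if S (D \<union> E) t then w D * w E else 0)"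
    by (subst sum.swap, intro sum.cong refl, rule sum.swap)
  also have "\<dots> = (\<Sum>D\<in>?D. \<Sum>E\<in>?D. w D * w E * real (card {t\<in>I. S (D \<union> E) t}))"
    using finI by (intro sum.cong refl) (simp add: sum.If_cases Int_def)
  also have "\<dots> \<le> (\<Sum>D\<in>?D. \<Sum>E\<in>?D. w D * w E * (real M / (\<Prod>l\<in>D \<union> E. ?f l)) + real R ^ 4)"
  proof (intro sum_mono)
    fix D E assume D: "D \<in> ?D" and E: "E \<in> ?D"
    define K where "K = D \<union> E"
    have K: "finite K" "\<And>l. l \<in> K \<Longrightarrow> prime l" using prime_setsD[OF D] prime_setsD[OF E] by (auto simp: K_def)
    have Kpos: "\<Prod>K > 0" using K by (intro prod_pos) (auto simp: prime_gt_0_nat)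
    have "\<Prod>K * \<Prod>(D \<inter> E) = \<Prod>D * \<Prod>E"
      unfolding K_def using prime_setsD(1)[OF D] prime_setsD(1)[OF E] by (rule prod.union_inter)
    moreover have "\<Prod>(D \<inter> E) \<ge> 1" using prime_setsD(4)[OF prime_sets_down[OF D, of "D \<inter> E"]] by auto
    then have "\<Prod>K * 1 \<le> \<Prod>K * \<Prod>(D \<inter> E)" by (rule mult_le_mono2)
    ultimately have "\<Prod>K \<le> \<Prod>D * \<Prod>E" by linarith
    also have "\<dots> \<le> R * R" using prime_setsD(3)[OF D] prime_setsD(3)[OF E] by (rule mult_le_mono)
    finally have KR: "\<Prod>K \<le> R * R" .
    have per: "S K t \<longleftrightarrow> S K (t mod \<Prod>K)" for t
    proof -
      have "l dvd (t mod \<Prod>K) * (t mod \<Prod>K + n) \<longleftrightarrow> l dvd t * (t + n)" if l: "l \<in> K" for l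
      proof -
        have "l dvd \<Prod>K" using K(1) l dvd_prodI[of K l "\<lambda>x. x"] by simp
        then have "[t mod \<Prod>K = t] (mod l)" by (simp add: cong_def mod_mod_cancel)
        then have "[(t mod \<Prod>K) * (t mod \<Prod>K + n) = t * (t + n)] (mod l)"
          by (intro cong_mult cong_add cong_refl)
        then show ?thesis by (rule cong_dvd_iff)
      qed
      then show ?thesis unfolding S_def by blast
    qed
    have set_eq: "{t\<in>I. S K t} = {t. N < t \<and> t \<le> N + M \<and> S K (t mod \<Prod>K)}"
      unfolding I_def using per by blast
    have cnt: "card {t. t < \<Prod>K \<and> S K t} = (\<Prod>l\<in>K. twin_roots n l)"
      unfolding S_def using K by (rule card_twin_roots_prod)
    have dens: "real (\<Prod>l\<in>K. twin_roots n l) / real (\<Prod>K) = 1 / (\<Prod>l\<in>K. ?f l)"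
      by (simp add: twin_density_inv_def prod_dividef)
    have ap: "\<bar>real (card {t\<in>I. S K t}) - real M / (\<Prod>l\<in>K. ?f l)\<bar> \<le> real (\<Prod>K)"
      using card_periodic_approx[OF Kpos, of N M "S K"]
      unfolding set_eq cnt times_divide_eq_right[symmetric] dens by simp
    have "\<bar>w D * w E * (real (card {t\<in>I. S K t}) - real M / (\<Prod>l\<in>K. ?f l))\<bar> \<le> (real R * real R) * real (R * R)"
      unfolding abs_mult using ap of_nat_mono[OF KR, where ?'a = real] wR[OF D] wR[OF E]
      by (intro mult_mono) auto
    also have "\<dots> = real R ^ 4" by (simp add: power4_eq_xxxx)
    finally show "w D * w E * real (card {t\<in>I. S (D \<union> E) t}) \<le> w D * w E * (real M / (\<Prod>l\<in>D \<union> E. ?f l)) + real R ^ 4"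
      unfolding K_def[symmetric] right_diff_distrib by linarith
  qed
  also have "\<dots> = real M * (\<Sum>D\<in>?D. \<Sum>E\<in>?D. w D * w E / (\<Prod>l\<in>D \<union> E. ?f l)) + real (card ?D) * real (card ?D) * real R ^ 4"
    by (simp add: sum.distrib sum_distrib_left mult.commute mult.left_commute)
  also have "\<dots> \<le> real M * (1 / twin_sieve_sum n R) + real R * real R * real R ^ 4"
    unfolding w(3) using card_prime_sets_le[of R] by (intro add_left_mono mult_right_mono mult_mono) auto
  also have "real R * real R * real R ^ 4 = real R ^ 6" by (simp add: power_numeral_reduce)
  finally show ?thesis by simp
qed

section \<open>Lower bound for the Selberg sum\<close>

lemma sum_inverse_squares_le: "(\<Sum>u=1..n. 1 / (real u)\<^sup>2) \<le> 2"
proof -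
  have *: "n \<ge> 1 \<Longrightarrow> (\<Sum>u=1..n. 1 / (real u)\<^sup>2) \<le> 2 - 1 / real n"
  proof (induction n rule: dec_induct)
    case (step n)
    have "1 / (real (Suc n))\<^sup>2 \<le> 1 / (real n * real (Suc n))"
      using step by (intro divide_left_mono) (auto simp: power2_eq_square)
    also have "\<dots> = 1 / real n - 1 / real (Suc n)" using step by (simp add: field_simps)
    finally show ?case using step by (simp add: sum.cl_ivl_Suc)
  qed simp
  show ?thesis
  proof (cases "n \<ge> 1")
    case True
    have "2 - 1 / real n \<le> 2" by simp
    with *[OF True] show ?thesis by (rule order_trans)
  qed simp
qed

lemma ln_le_harmonic: "n \<ge> 1 \<Longrightarrow> ln (real n) \<le> (\<Sum>m=1..n. 1 / real m)"
proof -
  assume n: "n \<ge> 1"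
  have "ln (real (Suc n)) \<le> (\<Sum>m=1..n. 1 / real m)" for n
  proof (induction n)
    case (Suc n)
    have "ln (real (Suc (Suc n)) / real (Suc n)) \<le> real (Suc (Suc n)) / real (Suc n) - 1"
      by (intro ln_le_minus_one) auto
    also have "\<dots> = 1 / real (Suc n)" by (simp add: field_simps)
    finally have "ln (real (Suc (Suc n))) \<le> ln (real (Suc n)) + 1 / real (Suc n)" by (subst (asm) ln_div) auto
    then show ?case using Suc by (simp add: sum.cl_ivl_Suc del: of_nat_Suc)
  qed simp
  moreover have "ln (real n) \<le> ln (real (Suc n))" using n by simp
  ultimately show ?thesis using order_trans by blast
qed

lemma Prod_prime_factors_squarefree:
  assumes "squarefree (b::nat)"
  shows "\<Prod>(prime_factors b) = b"
proof -
  have b: "b \<noteq> 0" using assms by (intro notI) simp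
  have "b = (\<Prod>p\<in>prime_factors b. p ^ multiplicity p b)" using prod_prime_factors[OF b] by simp
  also have "\<dots> = (\<Prod>p\<in>prime_factors b. p)"
    using assms squarefree_factorial_semiring'[OF b] by (intro prod.cong) auto
  finally show ?thesis by simp
qed

text \<open>Write m = u^2 d b with u^2 the square part, d the gcd of the squarefree part with n, and
  b squarefree and coprime to n. So the harmonic sum is at most the sum of 1 / u^2, which is at most
  2, times sigma(n) / n, times the sum of 1 / b.\<close>

lemma harmonic_le_coprime_sum:
  assumes "S \<ge> 1" "n \<ge> 1"
  shows "ln (real S) \<le> 2 * inv_divisor_sum n * (\<Sum>B\<in>prime_sets S. \<Prod>l\<in>B. if l dvd n then 0 else 1 / real l)"
proof -
  define X where "X = {1..S} \<times> {d. d dvd n} \<times> prime_sets S"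
  \<comment> \<open>The factors 0 at primes dividing n discard all B that are not coprime to
    n.\<close>
  define F where "F = (\<lambda>(u::nat, d::nat, B). 1 / (real u)\<^sup>2 * (1 / real d) * (\<Prod>l\<in>B. if l dvd n then 0 else 1 / real l))"
  define b where "b m = squarefree_part m div gcd (squarefree_part m) n" for m :: nat
  define j where "j m = (square_part m, gcd (squarefree_part m) n, prime_factors (b m))" for m
  have fin: "finite X" using assms finite_prime_sets by (simp add: X_def)
  have bprop: "squarefree (b m)" "coprime (b m) n" "gcd (squarefree_part m) n * b m = squarefree_part m"
      "\<Prod>(prime_factors (b m)) = b m" "b m dvd m" if "m \<ge> 1" for m
  proof -
    let ?d = "squarefree_part m"
    have sq: "squarefree ?d" by simp
    show e: "gcd ?d n * b m = ?d" by (simp add: b_def)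
    then have bd: "b m dvd ?d" by (metis dvd_triv_right)
    then show sb: "squarefree (b m)" using sq squarefree_mono by blast
    show "coprime (b m) n"
    proof (rule ccontr)
      assume "\<not> coprime (b m) n"
      then obtain p where "prime p" "p dvd gcd (b m) n" using prime_factor_nat coprime_iff_gcd_eq_1 by blast
      then have p: "prime p" "p dvd b m" "p dvd n" by auto
      then have "p dvd gcd ?d n" using bd by (meson dvd_trans gcd_greatest)
      then have "p * p dvd gcd ?d n * b m" using p by (intro mult_dvd_mono)
      then have "p\<^sup>2 dvd ?d" using e by (simp add: power2_eq_square)
      then have "p dvd 1" using sq squarefreeD by blast
      then show False using p by simp
    qed
    show "\<Prod>(prime_factors (b m)) = b m" using sb by (rule Prod_prime_factors_squarefree)
    have "?d dvd m" by (metis squarefree_decompose dvd_triv_left)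
    then show "b m dvd m" using bd dvd_trans by blast
  qed
  have inj: "inj_on j {1..S}"
  proof (rule inj_onI)
    fix x y assume x: "x \<in> {1..S}" and y: "y \<in> {1..S}" and e: "j x = j y"
    have x1: "x \<ge> 1" and y1: "y \<ge> 1" using x y by auto
    have e': "square_part x = square_part y" "gcd (squarefree_part x) n = gcd (squarefree_part y) n"
      "prime_factors (b x) = prime_factors (b y)" using e unfolding j_def by blast+
    have "b x = b y" using bprop(4)[OF x1] bprop(4)[OF y1] e'(3) by argo
    then have "squarefree_part x = squarefree_part y"
      using bprop(3)[OF x1] bprop(3)[OF y1] e'(2) by argo
    then show "x = y" using e'(1) squarefree_decompose[of x] squarefree_decompose[of y] by argo
  qed
  have val: "j m \<in> X \<and> F (j m) = 1 / real m" if m: "m \<in> {1..S}" for m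
  proof -
    have m1: "m \<ge> 1" using m by simp
    note bp = bprop[OF m1]
    have "b m \<le> m" using bp(5) m1 by (intro dvd_imp_le) auto
    then have PS: "prime_factors (b m) \<in> prime_sets S" using bp(4) m by (auto simp: prime_sets_def)
    have dec: "m = squarefree_part m * (square_part m)\<^sup>2" by (rule squarefree_decompose)
    have sp: "square_part m \<in> {1..S}"
    proof -
      have "square_part m \<noteq> 0" using m1 square_part_0_iff[of m] by linarith
      then have "square_part m \<ge> 1" by linarith
      moreover have "square_part m dvd m" by (metis dec dvd_triv_right dvd_trans dvd_power zero_less_numeral)
      then have "square_part m \<le> m" using m1 by (intro dvd_imp_le) auto
      ultimately show ?thesis using m by simp
    qed
    have "(\<Prod>l\<in>prime_factors (b m). if l dvd n then 0 else 1 / real l) = (\<Prod>l\<in>prime_factors (b m). 1 / real l)"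
    proof (intro prod.cong refl)
      fix l assume l: "l \<in> prime_factors (b m)"
      then have "prime l" "l dvd b m" by auto
      then have "\<not> l dvd n" using bp(2) by (metis coprime_common_divisor not_prime_unit)
      then show "(if l dvd n then 0 else 1 / real l) = 1 / real l" by simp
    qed
    also have "\<dots> = 1 / (\<Prod>l\<in>prime_factors (b m). real l)" by (simp add: prod_dividef)
    also have "(\<Prod>l\<in>prime_factors (b m). real l) = real (b m)"
      by (simp only: of_nat_prod[symmetric] bp(4))
    finally have P: "(\<Prod>l\<in>prime_factors (b m). if l dvd n then 0 else 1 / real l) = 1 / real (b m)" .
    have "real m = real (gcd (squarefree_part m) n) * real (b m) * (real (square_part m))\<^sup>2"
    proof -
      have "m = gcd (squarefree_part m) n * b m * (square_part m)\<^sup>2" unfolding bp(3) by (rule dec)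
      then have "real m = real (gcd (squarefree_part m) n * b m * (square_part m)\<^sup>2)" by (rule arg_cong)
      then show ?thesis by simp
    qed
    then have "F (j m) = 1 / real m" by (simp add: F_def j_def P)
    then show ?thesis using PS sp by (simp add: X_def j_def)
  qed
  have "ln (real S) \<le> (\<Sum>m\<in>{1..S}. 1 / real m)" using ln_le_harmonic[OF assms(1)] .
  also have "\<dots> = (\<Sum>m\<in>{1..S}. F (j m))" using val by (intro sum.cong) auto
  also have "\<dots> = sum F (j ` {1..S})" using inj by (simp add: sum.reindex)
  also have "\<dots> \<le> sum F X"
  proof (rule sum_mono2[OF fin])
    show "j ` {1..S} \<subseteq> X" using val by blast
    fix z show "0 \<le> F z"
      unfolding F_def by (cases z) (auto intro!: divide_nonneg_nonneg mult_nonneg_nonneg prod_nonneg)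
  qed
  also have "\<dots> = (\<Sum>u\<in>{1..S}. \<Sum>d | d dvd n. \<Sum>B\<in>prime_sets S. F (u, d, B))"
    unfolding X_def by (simp add: sum.cartesian_product)
  also have "\<dots> = (\<Sum>u=1..S. 1 / (real u)\<^sup>2) * (inv_divisor_sum n * (\<Sum>B\<in>prime_sets S. \<Prod>l\<in>B. if l dvd n then 0 else 1 / real l))"
  proof -
    let ?T = "\<Sum>B\<in>prime_sets S. \<Prod>l\<in>B. if l dvd n then 0 else 1 / real l"
    have "(\<Sum>B\<in>prime_sets S. F (u, d, B)) = 1 / (real u)\<^sup>2 * (1 / real d * ?T)" for u d
      unfolding F_def prod.case sum_distrib_left by (intro sum.cong refl) simp
    then have "(\<Sum>u\<in>{1..S}. \<Sum>d | d dvd n. \<Sum>B\<in>prime_sets S. F (u, d, B))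
      = (\<Sum>u\<in>{1..S}. 1 / (real u)\<^sup>2 * (\<Sum>d | d dvd n. 1 / real d * ?T))"
      by (simp only: sum_distrib_left)
    also have "\<dots> = (\<Sum>u=1..S. 1 / (real u)\<^sup>2) * (inv_divisor_sum n * ?T)"
      by (simp only: inv_divisor_sum_def sum_distrib_right)
    finally show ?thesis .
  qed
  also have "\<dots> \<le> 2 * (inv_divisor_sum n * (\<Sum>B\<in>prime_sets S. \<Prod>l\<in>B. if l dvd n then 0 else 1 / real l))"
    using sum_inverse_squares_le unfolding inv_divisor_sum_def
    by (intro mult_right_mono mult_nonneg_nonneg sum_nonneg prod_nonneg) auto
  finally show ?thesis by simp
qed

text \<open>The expansion of \<open>\<Prod>(x (1 + y) + y) = \<Prod>((1 + x)(1 + y) - 1)\<close>: the pairs \<open>(A, B)\<close> with \<open>A \<union> B = D\<close>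
  are parametrised by \<open>A\<close> and \<open>C = A \<inter> B\<close>.\<close>

lemma prod_union_pairs:
  fixes x y :: "'a \<Rightarrow> real"
  assumes "finite D"
  shows "(\<Sum>A\<in>Pow D. \<Sum>C\<in>Pow A. prod x A * prod y ((D - A) \<union> C)) = (\<Prod>l\<in>D. x l * (1 + y l) + y l)"
proof -
  have "(\<Sum>C\<in>Pow A. prod x A * prod y ((D - A) \<union> C)) = (\<Prod>l\<in>A. x l * (1 + y l)) * prod y (D - A)"
    if A: "A \<in> Pow D" for A
  proof -
    have fA: "finite A" using A assms finite_subset by blast
    have "(\<Sum>C\<in>Pow A. prod x A * prod y ((D - A) \<union> C)) = (\<Sum>C\<in>Pow A. prod x A * prod y (D - A) * (prod y C * (\<Prod>l\<in>A - C. 1)))"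
    proof (intro sum.cong refl)
      fix C assume C: "C \<in> Pow A"
      then have "finite C" using fA finite_subset by blast
      then have "prod y ((D - A) \<union> C) = prod y (D - A) * prod y C"
        using C assms by (intro prod.union_disjoint) auto
      then show "prod x A * prod y ((D - A) \<union> C) = prod x A * prod y (D - A) * (prod y C * (\<Prod>l\<in>A - C. 1))" by simp
    qed
    also have "\<dots> = prod x A * prod y (D - A) * (\<Prod>l\<in>A. y l + 1)"
      unfolding sum_distrib_left[symmetric] prod_add[OF fA] ..
    finally show ?thesis by (simp add: prod.distrib add.commute mult_ac)
  qed
  then have "(\<Sum>A\<in>Pow D. \<Sum>C\<in>Pow A. prod x A * prod y ((D - A) \<union> C)) = (\<Sum>A\<in>Pow D. (\<Prod>l\<in>A. x l * (1 + y l)) * prod y (D - A))"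
    by (intro sum.cong) auto
  also have "\<dots> = (\<Prod>l\<in>D. x l * (1 + y l) + y l)" by (rule prod_add[OF assms, symmetric])
  finally show ?thesis .
qed

text \<open>The local factor is 2 / (l - 2) if l does not divide n and 1 / (l - 1) otherwise; it
  dominates x (1 + y) + y with x = 1 / l and y = 1 / l or 0 respectively. By
  \<open>prod_union_pairs\<close> the Selberg sum up to S^2 therefore exceeds a product of two
  harmonic-type sums up to S, whence the square of a logarithm.\<close>

lemma twin_sieve_sum_ge:
  assumes "even n" "n \<ge> 1" "S \<ge> 1"
  shows "(ln (real S))\<^sup>2 / (4 * inv_divisor_sum n) \<le> twin_sieve_sum n (S * S)"
proof -
  define x where "x l = 1 / real l" for l :: nat
  define y where "y l = (if l dvd n then 0 else 1 / real l)" for l :: nat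
  have x0: "x l \<ge> 0" and y0: "y l \<ge> 0" for l by (auto simp: x_def y_def)
  let ?D = "prime_sets (S * S)"
  \<comment> \<open>A \<union> B, A and A \<inter> B together determine B, so distinct pairs keep
    distinct images.\<close>
  define j where "j = (\<lambda>(A, B). (A \<union> B, A, A \<inter> B :: nat set))"
  define X where "X = (SIGMA D:?D. SIGMA A:Pow D. Pow A)"
  define F where "F = (\<lambda>(D, A, C). prod x A * prod y ((D - A) \<union> C))"
  have "finite X" unfolding X_def
    using finite_prime_sets prime_setsD(1) by (intro finite_SigmaI) (auto intro: finite_subset)
  have inj: "inj_on j (prime_sets S \<times> prime_sets S)" by (rule inj_onI) (auto simp: j_def)
  have un: "A \<union> B \<in> ?D" if A: "A \<in> prime_sets S" and B: "B \<in> prime_sets S" for A B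
  proof -
    have fin: "finite A" "finite B" using prime_setsD(1)[OF A] prime_setsD(1)[OF B] .
    have "\<Prod>(A \<union> B) * \<Prod>(A \<inter> B) = \<Prod>A * \<Prod>B" using fin by (rule prod.union_inter)
    moreover have "\<Prod>(A \<inter> B) \<ge> 1" using prime_setsD(4)[OF prime_sets_down[OF A, of "A \<inter> B"]] by auto
    then have "\<Prod>(A \<union> B) * 1 \<le> \<Prod>(A \<union> B) * \<Prod>(A \<inter> B)" by (rule mult_le_mono2)
    moreover have "\<Prod>A * \<Prod>B \<le> S * S" using prime_setsD(3)[OF A] prime_setsD(3)[OF B] by (rule mult_le_mono)
    ultimately have "\<Prod>(A \<union> B) \<le> S * S" by linarith
    then show ?thesis using fin prime_setsD(2)[OF A] prime_setsD(2)[OF B] by (auto simp: prime_sets_def)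
  qed
  have jX: "j ` (prime_sets S \<times> prime_sets S) \<subseteq> X" using un by (auto simp: j_def X_def)
  have H0: "inv_divisor_sum n > 0"
  proof -
    have "1 / real 1 \<le> inv_divisor_sum n"
      unfolding inv_divisor_sum_def using assms by (intro member_le_sum) auto
    then show ?thesis by simp
  qed
  have one: "inv_divisor_sum 1 = 1" by (simp add: inv_divisor_sum_def)
  have "ln (real S) \<le> 2 * (\<Sum>A\<in>prime_sets S. \<Prod>l\<in>A. if l dvd 1 then 0 else 1 / real l)"
    using harmonic_le_coprime_sum[OF assms(3), of 1] one by simp
  also have "(\<Sum>A\<in>prime_sets S. \<Prod>l\<in>A. if l dvd 1 then 0 else 1 / real l) = (\<Sum>A\<in>prime_sets S. prod x A)"
  proof (intro sum.cong prod.cong refl)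
    fix A l assume "A \<in> prime_sets S" "l \<in> A"
    then have "prime l" by (rule prime_setsD(2))
    then show "(if l dvd 1 then 0 else 1 / real l) = x l" by (auto simp: x_def)
  qed
  finally have A: "ln (real S) / 2 \<le> (\<Sum>A\<in>prime_sets S. prod x A)" by simp
  have "ln (real S) \<le> (2 * inv_divisor_sum n) * (\<Sum>B\<in>prime_sets S. prod y B)"
    using harmonic_le_coprime_sum[OF assms(3,2)] by (simp add: y_def)
  then have B: "ln (real S) / (2 * inv_divisor_sum n) \<le> (\<Sum>B\<in>prime_sets S. prod y B)"
    using H0 by (simp add: pos_divide_le_eq mult.commute)
  have L0: "ln (real S) \<ge> 0" using assms by simp
  have "(ln (real S))\<^sup>2 / (4 * inv_divisor_sum n) = (ln (real S) / 2) * (ln (real S) / (2 * inv_divisor_sum n))"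
    by (simp add: power2_eq_square)
  also have "\<dots> \<le> (\<Sum>A\<in>prime_sets S. prod x A) * (\<Sum>B\<in>prime_sets S. prod y B)"
    using A B L0 H0 by (intro mult_mono) (auto intro!: sum_nonneg prod_nonneg x0)
  also have "\<dots> = (\<Sum>(A, B)\<in>prime_sets S \<times> prime_sets S. prod x A * prod y B)"
    by (simp add: sum_product sum.cartesian_product)
  also have "\<dots> = (\<Sum>z\<in>prime_sets S \<times> prime_sets S. F (j z))"
  proof (intro sum.cong refl)
    fix z :: "nat set \<times> nat set"
    obtain A B where z: "z = (A, B)" by (cases z)
    have "(A \<union> B - A) \<union> (A \<inter> B) = B" by blast
    then show "(case z of (A, B) \<Rightarrow> prod x A * prod y B) = F (j z)" by (simp add: z F_def j_def)
  qed
  also have "\<dots> = sum F (j ` (prime_sets S \<times> prime_sets S))" using inj by (simp add: sum.reindex)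
  also have "\<dots> \<le> sum F X"
    using \<open>finite X\<close> jX by (rule sum_mono2) (auto simp: F_def intro!: mult_nonneg_nonneg prod_nonneg x0 y0)
  also have "\<dots> = (\<Sum>D\<in>?D. \<Sum>A\<in>Pow D. \<Sum>C\<in>Pow A. F (D, A, C))"
  proof -
    have "(\<Sum>D\<in>?D. \<Sum>A\<in>Pow D. \<Sum>C\<in>Pow A. F (D, A, C)) = (\<Sum>D\<in>?D. \<Sum>(A, C)\<in>(SIGMA A:Pow D. Pow A). F (D, A, C))"
      using prime_setsD(1) by (intro sum.cong refl sum.Sigma) (auto intro: finite_subset)
    also have "\<dots> = (\<Sum>(D, A, C)\<in>X. F (D, A, C))"
      unfolding X_def using finite_prime_sets prime_setsD(1)
      by (subst sum.Sigma) (auto intro!: finite_SigmaI intro: finite_subset sum.cong)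
    finally show ?thesis by (simp add: case_prod_unfold)
  qed
  also have "\<dots> = (\<Sum>D\<in>?D. \<Prod>l\<in>D. x l * (1 + y l) + y l)"
    unfolding F_def prod.case using prime_setsD(1) by (intro sum.cong refl prod_union_pairs)
  also have "\<dots> \<le> (\<Sum>D\<in>?D. \<Prod>l\<in>D. 1 / (twin_density_inv n l - 1))"
  proof (intro sum_mono prod_mono conjI)
    fix D l assume "D \<in> ?D" "l \<in> D"
    then have l: "prime l" using prime_setsD(2) by blast
    show "0 \<le> x l * (1 + y l) + y l" using x0[of l] y0[of l] by simp
    show "x l * (1 + y l) + y l \<le> 1 / (twin_density_inv n l - 1)"
    proof (cases "l dvd n")
      case True
      then show ?thesis using prime_ge_2_nat[OF l]
        by (simp add: x_def y_def twin_density_inv_def twin_roots_def frac_le)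
    next
      case False
      then have "l \<noteq> 2" using assms by auto
      then have "real l \<ge> 3" using prime_ge_2_nat[OF l] by simp
      then have "1 / r * (1 + 1 / r) + 1 / r \<le> 1 / (r / 2 - 1)" if "r = real l" for r
        using that by (simp add: divide_simps) (simp add: algebra_simps)
      then show ?thesis using False by (simp add: x_def y_def twin_density_inv_def twin_roots_def)
    qed
  qed
  finally show ?thesis unfolding twin_sieve_sum_def .
qed

lemma inv_divisor_sum_ge_1:
  assumes "n \<ge> 1"
  shows "inv_divisor_sum n \<ge> 1"
proof -
  have "1 / real 1 \<le> inv_divisor_sum n"
    unfolding inv_divisor_sum_def using assms by (intro member_le_sum) auto
  then show ?thesis by simp
qed

text \<open>The sieve level is R = 4^k with k = i div 24. Then R^6 = 2^(12 k) is about 2^(i / 2),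
  negligible even against 2^i / i^2, while log R is still of order i. The constant covers 4 * 96^2 =
  36864 from the main term and 576 from the error.\<close>

lemma card_twin_primes_dyadic_le:
  assumes i: "i \<ge> 1" and n: "n \<ge> 1"
  shows "real (card {p. 2 ^ i < p \<and> p \<le> 2 ^ i + 2 ^ i \<and> prime p \<and> prime (p + n)})
    \<le> 40000 * 2 ^ i / (real i)\<^sup>2 * inv_divisor_sum n" (is "real (card ?T) \<le> _")
proof -
  let ?H = "inv_divisor_sum n"
  have H: "?H \<ge> 1" using n by (rule inv_divisor_sum_ge_1)
  have rhs0: "0 \<le> 40000 * 2 ^ i / (real i)\<^sup>2 * ?H" using H by simp
  consider "odd n" | "even n" "i < 24" | "even n" "i \<ge> 24" by linarith
  then show ?thesis
  proof cases
    case 1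
    have "?T = {}"
    proof (rule equals0I)
      fix p assume p: "p \<in> ?T"
      have "(2::nat) ^ 1 \<le> 2 ^ i" using i by (intro power_increasing) auto
      then have p2: "p > 2" using p by simp
      then have "odd p" using p prime_odd_nat by blast
      then have "even (p + n)" using 1 by simp
      moreover have "p + n > 2" using p2 by simp
      ultimately show False using p prime_odd_nat by blast
    qed
    then show ?thesis using rhs0 by (simp only: card.empty of_nat_0)
  next
    \<comment> \<open>Here k would be 0. The trivial count is enough, as i^2 is bounded.\<close>
    case 2
    have "card ?T \<le> card {(2::nat) ^ i<..2 ^ i + 2 ^ i}" by (intro card_mono) auto
    then have "real (card ?T) \<le> real (2 ^ i)" by (intro of_nat_mono) simp
    also have "\<dots> = 2 ^ i * 1 * 1" by simp
    also have "\<dots> \<le> 2 ^ i * (40000 / (real i)\<^sup>2) * ?H"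
    proof -
      have "(real i)\<^sup>2 \<le> 24\<^sup>2" using 2 by (intro power_mono) auto
      then have "1 \<le> 40000 / (real i)\<^sup>2" using i by (simp add: pos_le_divide_eq)
      then show ?thesis using H by (intro mult_mono) auto
    qed
    finally show ?thesis by (simp add: mult.commute mult.left_commute)
  next
    case 3
    define k where "k = i div 24"
    have k1: "k \<ge> 1" using 3 by (simp add: k_def)
    have ik: "24 * k \<le> i" "i \<le> 24 * k + 23" unfolding k_def by (simp, linarith)
    define S :: nat where "S = 2 ^ k"
    have S1: "S \<ge> 1" by (simp add: S_def)
    let ?G = "twin_sieve_sum n (S * S)"
    have SS: "S * S = 2 ^ (2 * k)" by (simp add: S_def power_add mult_2)
    have SN: "S * S \<le> 2 ^ i" unfolding SS using ik by (intro power_increasing) auto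
    have c: "real (card ?T) \<le> real (2 ^ i) / ?G + real (S * S) ^ 6"
      using 3(1) S1 SN by (intro card_twin_primes_le) auto
    have "ln (real S) = real k * ln 2" by (simp add: S_def ln_realpow)
    moreover have ln2: "1 / 2 \<le> ln (2::real)" using ln2_ge_two_thirds by simp
    have "real k * (1 / 2) \<le> real k * ln 2" by (intro mult_left_mono ln2) simp
    ultimately have "real k * (1 / 2) \<le> ln (real S)" by simp
    then have lnS: "real k / 2 \<le> ln (real S)" by simp
    have "real i \<le> 48 * real k" using ik k1 by linarith
    \<comment> \<open>96 = 2 * 48 combines i <= 48 k with ln S >= k / 2.\<close>
    then have "real i / 96 \<le> ln (real S)" using lnS by linarith
    then have "(real i / 96)\<^sup>2 \<le> (ln (real S))\<^sup>2" by (intro power_mono) auto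
    then have "(real i / 96)\<^sup>2 / (4 * ?H) \<le> (ln (real S))\<^sup>2 / (4 * ?H)" using H by (intro divide_right_mono) auto
    also have "\<dots> \<le> ?G" using 3(1) n S1 by (rule twin_sieve_sum_ge)
    finally have G: "(real i / 96)\<^sup>2 / (4 * ?H) \<le> ?G" .
    have ipos: "0 < (real i / 96)\<^sup>2 / (4 * ?H)" using i H by simp
    have "real (2 ^ i) / ?G \<le> real (2 ^ i) / ((real i / 96)\<^sup>2 / (4 * ?H))"
      by (intro divide_left_mono[OF G] mult_pos_pos less_le_trans[OF ipos G] ipos) simp
    also have "\<dots> = 36864 * 2 ^ i / (real i)\<^sup>2 * ?H" by (simp add: power2_eq_square)
    finally have a: "real (2 ^ i) / ?G \<le> 36864 * 2 ^ i / (real i)\<^sup>2 * ?H" .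
    have b: "real (S * S) ^ 6 \<le> 576 * 2 ^ i / (real i)\<^sup>2 * ?H"
    proof -
      have "k < 2 ^ k" by (rule less_exp)
      then have "k + 1 \<le> 2 ^ k" by linarith
      then have "i \<le> 24 * 2 ^ k" using ik by linarith
      then have "i\<^sup>2 \<le> (24 * 2 ^ k)\<^sup>2" by (rule power_mono) simp
      then have "i\<^sup>2 * (S * S) ^ 6 \<le> (24 * 2 ^ k)\<^sup>2 * (2 ^ (2 * k)) ^ 6" unfolding SS by (intro mult_right_mono) auto
      also have "\<dots> = 576 * 2 ^ (14 * k)"
        by (simp add: power_mult_distrib flip: power_mult power_add)
      also have "\<dots> \<le> 576 * 2 ^ i" using ik by (intro mult_left_mono power_increasing) auto
      finally have "real (i\<^sup>2 * (S * S) ^ 6) \<le> real (576 * 2 ^ i)" by (rule of_nat_mono)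
      then have "(real i)\<^sup>2 * real (S * S) ^ 6 \<le> 576 * 2 ^ i" by simp
      then have "real (S * S) ^ 6 \<le> 576 * 2 ^ i / (real i)\<^sup>2" using i by (simp add: pos_le_divide_eq mult.commute)
      also have "\<dots> = 576 * 2 ^ i / (real i)\<^sup>2 * 1" by simp
      also have "\<dots> \<le> 576 * 2 ^ i / (real i)\<^sup>2 * ?H" using H by (intro mult_left_mono) auto
      finally show ?thesis .
    qed
    have "36864 * 2 ^ i / (real i)\<^sup>2 * ?H + 576 * 2 ^ i / (real i)\<^sup>2 * ?H \<le> 40000 * 2 ^ i / (real i)\<^sup>2 * ?H"
      using H by (simp add: add_divide_distrib[symmetric] distrib_right[symmetric] mult_right_mono divide_right_mono)
    then show ?thesis using a b c by linarith
  qed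
qed

section \<open>Estimates of Chebyshev and Mertens\<close>

lemma card_multiples:
  assumes "d \<ge> 1"
  shows "card {m\<in>{1..N}. d dvd m} = N div (d::nat)"
proof -
  have "{m\<in>{1..N}. d dvd m} = (\<lambda>k. d * k) ` {1..N div d}"
  proof (intro equalityI subsetI)
    fix m assume m: "m \<in> {m\<in>{1..N}. d dvd m}"
    then obtain k where k: "m = d * k" by auto
    then have "k \<ge> 1" "k \<le> N div d" using m assms by (auto simp: less_eq_div_iff_mult_less_eq mult.commute Suc_le_eq)
    then show "m \<in> (\<lambda>k. d * k) ` {1..N div d}" using k by auto
  next
    fix m assume "m \<in> (\<lambda>k. d * k) ` {1..N div d}"
    then show "m \<in> {m\<in>{1..N}. d dvd m}"
      using assms by (auto simp: less_eq_div_iff_mult_less_eq mult.commute Suc_le_eq)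
  qed
  moreover have "inj_on (\<lambda>k. d * k) {1..N div d}" using assms by (intro inj_onI) simp
  ultimately show ?thesis by (simp add: card_image)
qed

lemma real_div_bounds:
  "real (a div b) \<le> real a / real b" "real a / real b \<le> real (a div b) + 1"
  using floor_correct[of "real a / real b"] unfolding floor_divide_of_nat_eq by auto

text \<open>Legendre's formula: ln m is the sum of \<open>mangoldt d\<close> over d | m, and N div k
  counts the multiples of k up to N.\<close>

lemma ln_fact_eq_mangoldt: "ln (fact N) = (\<Sum>k=1..N. mangoldt k * real (N div k))"
proof -
  have "ln (fact N :: real) = (\<Sum>m=1..N. ln (real m))"
  proof (induction N)
    case (Suc N)
    have "ln (fact (Suc N) :: real) = ln (real (Suc N)) + ln (fact N)"
      by (simp add: ln_mult del: of_nat_Suc)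
    then show ?case using Suc by (simp add: sum.cl_ivl_Suc)
  qed simp
  also have "\<dots> = (\<Sum>m=1..N. \<Sum>d\<in>{1..N}. if d dvd m then mangoldt d else 0)"
  proof (intro sum.cong refl)
    fix m assume m: "m \<in> {1..N}"
    have "ln (real m) = (\<Sum>d | d dvd m. mangoldt d)" using mangoldt_sum[of m, where ?'a = real] m by simp
    also have "{d. d dvd m} = {d\<in>{1..N}. d dvd m}" using m by (auto dest: dvd_imp_le intro: Nat.gr0I simp: Suc_le_eq)
    also have "(\<Sum>d\<in>{d\<in>{1..N}. d dvd m}. mangoldt d) = (\<Sum>d\<in>{1..N}. if d dvd m then mangoldt d else 0)"
      by (rule sum.inter_filter) simp
    finally show "ln (real m) = (\<Sum>d\<in>{1..N}. if d dvd m then mangoldt d else 0)" .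
  qed
  also have "\<dots> = (\<Sum>d\<in>{1..N}. \<Sum>m=1..N. if d dvd m then mangoldt d else 0)" by (rule sum.swap)
  also have "\<dots> = (\<Sum>d\<in>{1..N}. mangoldt d * real (N div d))"
  proof (intro sum.cong refl)
    fix d assume "d \<in> {1..N}"
    then have d: "d \<ge> 1" by simp
    have "(\<Sum>m=1..N. if d dvd m then mangoldt d else 0) = (\<Sum>m\<in>{m\<in>{1..N}. d dvd m}. mangoldt d)"
      by (rule sum.inter_filter[symmetric]) simp
    also have "\<dots> = real (card {m\<in>{1..N}. d dvd m}) * mangoldt d" by simp
    finally show "(\<Sum>m=1..N. if d dvd m then mangoldt d else 0) = mangoldt d * real (N div d)"
      unfolding card_multiples[OF d] by simp
  qed
  finally show ?thesis .
qed

text \<open>Chebyshev's argument. In the logarithm of the central binomial coefficient, at most 4^n,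
  \<open>mangoldt k\<close> has the coefficient (2 n div k) - 2 (n div k), which is never negative
  and equals 1 on the block.\<close>

lemma mangoldt_block_le: "(\<Sum>k\<in>{n<..2 * n}. mangoldt k) \<le> 2 * real n * ln 2"
proof -
  have "ln (real (2 * n choose n)) = ln (fact (2 * n)) - 2 * ln (fact n :: real)"
  proof -
    have "real (2 * n choose n) = fact (2 * n) / (fact n * fact n)"
      by (subst binomial_fact) simp_all
    then show ?thesis by (simp add: ln_div ln_mult)
  qed
  also have "ln (fact n :: real) = (\<Sum>k=1..2*n. mangoldt k * real (n div k))"
    unfolding ln_fact_eq_mangoldt by (rule sum.mono_neutral_left) auto
  also have "ln (fact (2 * n)) - 2 * (\<Sum>k=1..2*n. mangoldt k * real (n div k))
     = (\<Sum>k=1..2*n. mangoldt k * (real (2 * n div k) - 2 * real (n div k)))"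
    unfolding ln_fact_eq_mangoldt by (simp add: sum_distrib_left sum_subtractf right_diff_distrib mult.left_commute)
  also have "\<dots> \<ge> (\<Sum>k\<in>{n<..2 * n}. mangoldt k * (real (2 * n div k) - 2 * real (n div k)))"
  proof (rule sum_mono2)
    fix k assume "k \<in> {1..2*n} - {n<..2*n}"
    then have k: "k \<ge> 1" by auto
    have "2 * (n div k) \<le> 2 * n div k" using k by (simp add: less_eq_div_iff_mult_less_eq)
    then have "2 * real (n div k) \<le> real (2 * n div k)" by linarith
    then show "0 \<le> mangoldt k * (real (2 * n div k) - 2 * real (n div k))"
      by (intro mult_nonneg_nonneg mangoldt_nonneg) simp
  qed auto
  also have "(\<Sum>k\<in>{n<..2 * n}. mangoldt k * (real (2 * n div k) - 2 * real (n div k))) = (\<Sum>k\<in>{n<..2 * n}. mangoldt k)"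
  proof (intro sum.cong refl)
    fix k assume k: "k \<in> {n<..2 * n}"
    have "2 * n div k = 1" using k by (intro div_nat_eqI) auto
    then show "mangoldt k * (real (2 * n div k) - 2 * real (n div k)) = mangoldt k" using k by simp
  qed
  finally have "(\<Sum>k\<in>{n<..2 * n}. mangoldt k) \<le> ln (real (2 * n choose n))" .
  also have "\<dots> \<le> ln (2 ^ (2 * n))"
  proof -
    have "real (2 * n choose n) \<le> real (2 ^ (2 * n))" by (intro of_nat_mono binomial_le_pow2)
    moreover have "2 * n choose n > 0" by simp
    ultimately show ?thesis by (subst ln_le_cancel_iff) auto
  qed
  also have "\<dots> = 2 * real n * ln 2" by (simp add: ln_realpow)
  finally show ?thesis .
qed

definition dyadic :: "nat \<Rightarrow> nat set" where
  "dyadic i = {2 ^ i<..2 ^ Suc i}"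

lemma finite_dyadic [simp]: "finite (dyadic i)"
  by (simp add: dyadic_def)

lemma mangoldt_dyadic_le: "(\<Sum>k\<in>dyadic i. mangoldt k :: real) \<le> 2 * 2 ^ i * ln 2"
  using mangoldt_block_le[of "2 ^ i"] by (simp add: dyadic_def)

lemma sum_dyadic_split:
  fixes f :: "nat \<Rightarrow> 'a::comm_monoid_add"
  shows "(\<Sum>k=1..2 ^ i. f k) = f 1 + (\<Sum>j<i. \<Sum>k\<in>dyadic j. f k)"
proof (induction i)
  case (Suc i)
  have "{1..2 ^ Suc i} = {1..2 ^ i} \<union> dyadic i" by (auto simp: dyadic_def)
  moreover have "sum f ({1..2 ^ i} \<union> dyadic i) = sum f {1..2 ^ i} + sum f (dyadic i)"
    by (rule sum.union_disjoint) (auto simp: dyadic_def)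
  ultimately show ?case using Suc by (simp add: add.assoc)
qed simp

lemma ln_fact_ge: "n \<ge> 1 \<Longrightarrow> real n * ln (real n) - real n \<le> ln (fact n)"
proof (induction n rule: dec_induct)
  case (step n)
  have "ln (real (Suc n) / real n) \<le> real (Suc n) / real n - 1" using step by (intro ln_le_minus_one) auto
  then have "ln (real (Suc n)) \<le> ln (real n) + 1 / real n" using step by (simp add: ln_div field_simps)
  then have "real n * ln (real (Suc n)) \<le> real n * (ln (real n) + 1 / real n)" by (intro mult_left_mono) auto
  also have "\<dots> = real n * ln (real n) + 1" using step by (simp add: distrib_left)
  finally have a: "real n * ln (real (Suc n)) \<le> real n * ln (real n) + 1" .
  have b: "ln (fact (Suc n) :: real) = ln (real (Suc n)) + ln (fact n)"
    by (simp add: ln_mult del: of_nat_Suc)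
  have c: "real (Suc n) * ln (real (Suc n)) = real n * ln (real (Suc n)) + ln (real (Suc n))"
    by (simp add: algebra_simps)
  show ?case unfolding b c using a step.IH by simp
qed simp

lemma ln_fact_le: "ln (fact n) \<le> real n * ln (real n)"
proof (cases "n = 0")
  case False
  have "(fact n :: real) \<le> real (n ^ n)" by (rule fact_le_power)
  then have "ln (fact n) \<le> ln (real (n ^ n))" using False by (subst ln_le_cancel_iff) auto
  then show ?thesis using False by (simp add: ln_realpow)
qed simp

text \<open>Mertens: comparing ln ((2^i)!) with Legendre's formula puts the sum of
  \<open>mangoldt k / k\<close> up to 2^i between i ln 2 - 1 and i ln 2 + 2 ln 2. Subtracting two
  levels loses at most 1 + 2 ln 2 <= 3, and replacing 1 / k by 1 / 2^i only increases a
  block.\<close>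

lemma sum_mangoldt_dyadic_ge:
  assumes "i0 \<le> i1"
  shows "real (i1 - i0) * ln 2 - 3 \<le> (\<Sum>i=i0..<i1. (\<Sum>k\<in>dyadic i. mangoldt k) / 2 ^ i)"
proof -
  define L where "L i = (\<Sum>k=1..2 ^ i. mangoldt k / real k :: real)" for i
  have lower: "real i * ln 2 - 1 \<le> L i" for i
  proof -
    have "ln (fact (2 ^ i)) = (\<Sum>k=1..2 ^ i. mangoldt k * real (2 ^ i div k))" by (rule ln_fact_eq_mangoldt)
    also have "\<dots> \<le> (\<Sum>k=1..2 ^ i. 2 ^ i * (mangoldt k / real k))"
    proof (rule sum_mono)
      fix k :: nat assume "k \<in> {1..2 ^ i}"
      have "real (2 ^ i div k) \<le> real (2 ^ i) / real k" by (rule real_div_bounds)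
      then have "mangoldt k * real (2 ^ i div k) \<le> mangoldt k * (real (2 ^ i) / real k)"
        by (intro mult_left_mono mangoldt_nonneg)
      then show "mangoldt k * real (2 ^ i div k) \<le> 2 ^ i * (mangoldt k / real k)" by (simp add: mult.commute)
    qed
    also have "\<dots> = 2 ^ i * L i" by (simp add: L_def sum_distrib_left)
    finally have "ln (fact (2 ^ i)) \<le> 2 ^ i * L i" .
    moreover have "2 ^ i * (real i * ln 2) - 2 ^ i \<le> ln (fact (2 ^ i))"
      using ln_fact_ge[of "2 ^ i"] by (simp add: ln_realpow)
    ultimately have "2 ^ i * (real i * ln 2 - 1) \<le> 2 ^ i * L i" by (simp add: right_diff_distrib)
    then show ?thesis by simp
  qed
  have psi: "(\<Sum>k=1..2 ^ i. mangoldt k) \<le> 2 * 2 ^ i * ln (2::real)" for i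
  proof -
    have "(\<Sum>k=1..2 ^ i. mangoldt k) = (\<Sum>j<i. \<Sum>k\<in>dyadic j. mangoldt k :: real)"
      by (subst sum_dyadic_split) simp
    also have "\<dots> \<le> (\<Sum>j<i. 2 * 2 ^ j * ln 2)" by (intro sum_mono mangoldt_dyadic_le)
    also have "\<dots> = 2 * ln 2 * (\<Sum>j<i. 2 ^ j)" by (simp add: sum_distrib_left mult_ac)
    also have "(\<Sum>j<i. (2::real) ^ j) = 2 ^ i - 1" by (simp add: sum_gp_strict)
    finally have "(\<Sum>k=1..2 ^ i. mangoldt k) \<le> 2 * ln (2::real) * (2 ^ i - 1)" .
    also have "\<dots> \<le> 2 * ln (2::real) * 2 ^ i" by (intro mult_left_mono) auto
    finally show ?thesis by (simp add: mult.commute mult.left_commute)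
  qed
  have upper: "L i \<le> real i * ln 2 + 2 * ln 2" for i
  proof -
    have "2 ^ i * L i = (\<Sum>k=1..2 ^ i. 2 ^ i * (mangoldt k / real k))" by (simp add: L_def sum_distrib_left)
    also have "\<dots> \<le> (\<Sum>k=1..2 ^ i. mangoldt k * real (2 ^ i div k) + mangoldt k)"
    proof (rule sum_mono)
      fix k :: nat assume k: "k \<in> {1..2 ^ i}"
      have "real (2 ^ i) / real k \<le> real (2 ^ i div k) + 1" by (rule real_div_bounds)
      then have "mangoldt k * (real (2 ^ i) / real k) \<le> mangoldt k * (real (2 ^ i div k) + 1)"
        by (intro mult_left_mono mangoldt_nonneg)
      then show "2 ^ i * (mangoldt k / real k) \<le> mangoldt k * real (2 ^ i div k) + mangoldt k"
        by (simp add: algebra_simps)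
    qed
    also have "\<dots> = ln (fact (2 ^ i)) + (\<Sum>k=1..2 ^ i. mangoldt k)"
      by (simp add: ln_fact_eq_mangoldt sum.distrib)
    also have "\<dots> \<le> 2 ^ i * (real i * ln 2) + 2 * 2 ^ i * ln 2"
      using ln_fact_le[of "2 ^ i"] psi[of i] by (simp add: ln_realpow)
    also have "\<dots> = 2 ^ i * (real i * ln 2 + 2 * ln 2)" by (simp add: algebra_simps)
    finally show ?thesis by simp
  qed
  have split: "L i1 = L i0 + (\<Sum>i=i0..<i1. \<Sum>k\<in>dyadic i. mangoldt k / real k)"
  proof -
    have "(\<Sum>i<i1. F i) = (\<Sum>i<i0. F i) + (\<Sum>i=i0..<i1. F i)" for F :: "nat \<Rightarrow> real"
    proof -
      have "{..<i1} = {..<i0} \<union> {i0..<i1}" using assms by auto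
      then show ?thesis using sum.union_disjoint[of "{..<i0}" "{i0..<i1}" F] by (simp add: ivl_disj_int)
    qed
    then show ?thesis unfolding L_def sum_dyadic_split by (simp only: add.assoc)
  qed
  have ln2: "ln (2::real) \<le> 1" using ln_le_minus_one[of 2] by simp
  have "real (i1 - i0) * ln 2 - 3 \<le> (real i1 * ln 2 - 1) - (real i0 * ln 2 + 2 * ln 2)"
    using ln2 assms by (simp add: of_nat_diff left_diff_distrib)
  also have "\<dots> \<le> L i1 - L i0" using lower upper by (intro diff_mono)
  also have "\<dots> = (\<Sum>i=i0..<i1. \<Sum>k\<in>dyadic i. mangoldt k / real k)" using split by simp
  also have "\<dots> \<le> (\<Sum>i=i0..<i1. (\<Sum>k\<in>dyadic i. mangoldt k) / 2 ^ i)"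
  proof (rule sum_mono)
    fix i assume "i \<in> {i0..<i1}"
    have "(\<Sum>k\<in>dyadic i. mangoldt k / real k) \<le> (\<Sum>k\<in>dyadic i. mangoldt k / 2 ^ i)"
    proof (rule sum_mono)
      fix k assume k: "k \<in> dyadic i"
      have "real (2 ^ i) \<le> real k" using k unfolding dyadic_def by (intro of_nat_mono) simp
      moreover have "k > 0" using k unfolding dyadic_def by (simp add: gr0I)
      ultimately show "mangoldt k / real k \<le> mangoldt k / 2 ^ i"
        by (intro divide_left_mono mangoldt_nonneg) auto
    qed
    then show "(\<Sum>k\<in>dyadic i. mangoldt k / real k) \<le> (\<Sum>k\<in>dyadic i. mangoldt k) / 2 ^ i"
      by (simp add: sum_divide_distrib)
  qed
  finally show ?thesis .
qed

text \<open>Only proper powers p^e contribute, so e >= 2. There are about 2^(i / 2) bases p, at most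
  i + 1 exponents, and each term is at most i + 1.\<close>

lemma mangoldt_nonprime_dyadic_le:
  "(\<Sum>k | k \<in> dyadic i \<and> \<not> prime k. mangoldt k) \<le> real (2 ^ (i div 2 + 1) * (i + 1)\<^sup>2)"
proof -
  let ?A = "{k. k \<in> dyadic i \<and> \<not> prime k \<and> primepow k}"
  define X :: "(nat \<times> nat) set" where "X = {1..2 ^ (i div 2 + 1)} \<times> {1..i + 1}"
  have sub: "?A \<subseteq> (\<lambda>(p, e). p ^ e) ` X"
  proof
    fix k assume k: "k \<in> ?A"
    then obtain p e where pe: "prime p" "e > 0" "k = p ^ e" by (auto simp: primepow_def)
    have "e \<noteq> 1" using k pe by auto
    then have e2: "e \<ge> 2" using pe by linarith
    have p2: "p \<ge> 2" using pe prime_ge_2_nat by blast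
    have k2: "k \<le> 2 ^ Suc i" using k by (simp add: dyadic_def)
    have "2 ^ e \<le> p ^ e" using p2 by (intro power_mono) auto
    then have "(2::nat) ^ e \<le> 2 ^ Suc i" using k2 unfolding pe(3) by (rule order_trans)
    then have "e \<le> Suc i" by (rule power_le_imp_le_exp[rotated]) simp
    moreover have "p \<le> 2 ^ (i div 2 + 1)"
    proof -
      have "p\<^sup>2 \<le> p ^ e" using p2 e2 by (intro power_increasing) auto
      also have "\<dots> \<le> 2 ^ Suc i" using k2 pe by simp
      also have "\<dots> \<le> 2 ^ (2 * (i div 2 + 1))" by (intro power_increasing) auto
      also have "\<dots> = (2 ^ (i div 2 + 1))\<^sup>2" by (simp only: power_mult[symmetric] mult.commute)
      finally show ?thesis by (rule power2_le_imp_le) simp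
    qed
    ultimately have "(p, e) \<in> X" using p2 e2 by (simp add: X_def)
    then show "k \<in> (\<lambda>(p, e). p ^ e) ` X" using pe by force
  qed
  have "finite X" by (simp add: X_def)
  then have "card ?A \<le> card X" using sub by (meson card_image_le card_mono finite_imageI order_trans)
  then have cA: "card ?A \<le> 2 ^ (i div 2 + 1) * (i + 1)" by (simp add: X_def)
  have "(\<Sum>k | k \<in> dyadic i \<and> \<not> prime k. mangoldt k) = (\<Sum>k\<in>?A. mangoldt k :: real)"
    by (intro sum.mono_neutral_right) (auto simp: mangoldt_def)
  also have "\<dots> \<le> (\<Sum>k\<in>?A. real (i + 1))"
  proof (rule sum_mono)
    fix k assume k: "k \<in> ?A"
    then have k0: "k > 0" "k \<le> 2 ^ Suc i" by (auto simp: dyadic_def intro: Nat.gr0I)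
    have "mangoldt k \<le> ln (real k)" using mangoldt_le[of k] k0 by simp
    also have "\<dots> \<le> ln (2 ^ Suc i)"
    proof -
      have "real k \<le> real (2 ^ Suc i)" using k0 by (intro of_nat_mono)
      then show ?thesis using k0 by (subst ln_le_cancel_iff) auto
    qed
    also have "\<dots> = real (Suc i) * ln 2" by (simp add: ln_realpow del: power_Suc)
    also have "\<dots> \<le> real (Suc i) * 1" using ln_le_minus_one[of 2] by (intro mult_left_mono) auto
    finally show "mangoldt k \<le> real (i + 1)" by simp
  qed
  also have "\<dots> = real (card ?A * (i + 1))" by (simp add: distrib_left)
  also have "\<dots> \<le> real (2 ^ (i div 2 + 1) * (i + 1) * (i + 1))" using cA by (intro of_nat_mono mult_right_mono) auto
  finally show ?thesis by (simp only: power2_eq_square mult.assoc)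
qed

section \<open>Exponential sums over primes\<close>

definition expi :: "real \<Rightarrow> complex" where
  "expi x = cis (2 * pi * x)"

lemma norm_expi [simp]: "norm (expi x) = 1"
  by (simp add: expi_def)

lemma expi_add: "expi (x + y) = expi x * expi y"
  by (simp add: expi_def cis_mult distrib_left)

lemma expi_of_int [simp]: "expi (of_int k) = 1"
  unfolding expi_def by (rule cis_multiple_2pi) simp

lemma expi_mult_nat: "expi (real n * x) = expi x ^ n"
  by (simp add: expi_def Complex.DeMoivre mult_ac)

lemma expi_cnj: "cnj (expi x) = expi (- x)"
  by (simp add: expi_def cis_cnj)

text \<open>Half of Jordan's inequality sin (pi s) >= 2 s, by the mean value theorem with cos >= 1/2
  up to 1/3 and by monotonicity beyond; the constant is immaterial.\<close>

lemma sin_pi_ge: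
  assumes "0 \<le> s" "s \<le> 1 / 2"
  shows "s \<le> sin (pi * s)"
proof (cases "s \<le> 1 / 3")
  case True
  show ?thesis
  proof (cases "s = 0")
    case False
    then have x0: "0 < pi * s" using assms by simp
    have "\<exists>z. 0 < z \<and> z < pi * s \<and> sin (pi * s) - sin 0 = (pi * s - 0) * cos z"
      by (rule MVT2[OF x0]) (auto intro!: derivative_eq_intros)
    then obtain z where z: "0 < z" "z < pi * s" "sin (pi * s) = pi * s * cos z" by auto
    have "pi * s \<le> pi * (1 / 3)" using True by (intro mult_left_mono) auto
    then have "z \<le> pi / 3" using z by linarith
    then have "cos (pi / 3) \<le> cos z" using z by (intro cos_monotone_0_pi_le) auto
    then have "1 / 2 \<le> cos z" by (simp add: cos_60)
    then have "pi * s * (1 / 2) \<le> sin (pi * s)" unfolding z(3) using x0 by (intro mult_left_mono) auto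
    moreover have "2 * s \<le> pi * s" using assms pi_ge_two by (intro mult_right_mono) auto
    ultimately show ?thesis by simp
  qed simp
next
  case False
  have "pi * (1 / 3) \<le> pi * s" "pi * s \<le> pi * (1 / 2)" using False assms by (intro mult_left_mono; simp)+
  then have "sin (pi / 3) \<le> sin (pi * s)" using pi_gt_zero by (intro sin_monotone_2pi_le) linarith+
  moreover have "1 / 2 \<le> sin (pi / 3)" by (simp add: sin_60)
  ultimately show ?thesis using assms by linarith
qed

lemma norm_expi_minus_1_ge: "2 * dist_to_int \<theta> \<le> norm (expi \<theta> - 1)"
proof -
  obtain k where k: "dist_to_int \<theta> = \<bar>\<theta> - of_int k\<bar>" using dist_to_int_attained by blast
  define s where "s = \<theta> - of_int k"
  have "expi \<theta> = expi (s + of_int k)" by (simp add: s_def)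
  also have "\<dots> = expi s" by (simp add: expi_add)
  finally have e: "expi \<theta> = expi s" .
  have "norm (expi s - 1) = 2 * \<bar>sin (pi * s)\<bar>"
    unfolding expi_def cis_conv_exp using dist_exp_i_1[of "2 * pi * s"] by simp
  moreover have "\<bar>s\<bar> \<le> \<bar>sin (pi * s)\<bar>"
  proof -
    have s: "\<bar>s\<bar> \<le> 1 / 2" using dist_to_int_le_half[of \<theta>] k by (simp add: s_def)
    have "\<bar>s\<bar> \<le> sin (pi * \<bar>s\<bar>)" using s by (intro sin_pi_ge) auto
    also have "\<dots> \<le> \<bar>sin (pi * s)\<bar>" by (cases "s \<ge> 0") auto
    finally show ?thesis .
  qed
  ultimately show ?thesis using e k by (simp add: s_def)
qed

lemma norm_expi_sum_le:
  assumes "0 < dist_to_int \<theta>"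
  shows "norm (\<Sum>n\<in>{A<..B}. expi (real n * \<theta>)) \<le> 1 / dist_to_int \<theta>"
proof (cases "A < B")
  case True
  let ?z = "expi \<theta>"
  have n: "2 * dist_to_int \<theta> \<le> norm (?z - 1)" by (rule norm_expi_minus_1_ge)
  then have z1: "?z \<noteq> 1" using assms by auto
  have "{A<..B} = {Suc A..B}" by auto
  then have "(\<Sum>n\<in>{A<..B}. expi (real n * \<theta>)) = (\<Sum>n=Suc A..B. ?z ^ n)" by (simp add: expi_mult_nat)
  also have "\<dots> = (?z ^ Suc A - ?z ^ Suc B) / (1 - ?z)" using z1 True by (simp add: sum_gp)
  finally have "norm (\<Sum>n\<in>{A<..B}. expi (real n * \<theta>)) = norm (?z ^ Suc A - ?z ^ Suc B) / norm (?z - 1)"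
    by (simp add: norm_divide norm_minus_commute)
  also have "\<dots> \<le> 2 / (2 * dist_to_int \<theta>)"
  proof (rule frac_le)
    have "norm (?z ^ Suc A - ?z ^ Suc B) \<le> norm (?z ^ Suc A) + norm (?z ^ Suc B)" by (rule norm_triangle_ineq4)
    then show "norm (?z ^ Suc A - ?z ^ Suc B) \<le> 2" by (simp add: norm_power norm_mult)
  qed (use assms n in auto)
  finally show ?thesis by simp
qed (use assms in auto)

lemma nat_interval_eq:
  fixes I :: "nat set"
  assumes "finite I" "\<And>x y z. x \<in> I \<Longrightarrow> y \<in> I \<Longrightarrow> x \<le> z \<Longrightarrow> z \<le> y \<Longrightarrow> z \<in> I" "0 \<notin> I"
  obtains A B where "I = {A<..B}"
proof (cases "I = {}")
  case True
  then show thesis using that[of 0 0] by simp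
next
  case False
  have mm: "Min I \<in> I" "Max I \<in> I" using assms(1) False by simp_all
  have "I = {Min I..Max I}"
  proof (intro equalityI subsetI)
    fix x assume "x \<in> I" then show "x \<in> {Min I..Max I}" using assms(1) by simp
  next
    fix x assume "x \<in> {Min I..Max I}" then show "x \<in> I" using assms(2)[OF mm] by simp
  qed
  moreover have "Min I \<noteq> 0" using mm assms(3) by metis
  then have "{Min I..Max I} = {Min I - 1<..Max I}" by auto
  ultimately show thesis using that by metis
qed

lemma norm_expi_sum_convex_le:
  fixes I :: "nat set"
  assumes "0 < dist_to_int \<theta>" "finite I" "\<And>x y z. x \<in> I \<Longrightarrow> y \<in> I \<Longrightarrow> x \<le> z \<Longrightarrow> z \<le> y \<Longrightarrow> z \<in> I" "0 \<notin> I"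
  shows "norm (\<Sum>n\<in>I. expi (real n * \<theta>)) \<le> 1 / dist_to_int \<theta>"
proof -
  obtain A B where "I = {A<..B}" by (rule nat_interval_eq[OF assms(2-4)])
  then show ?thesis using norm_expi_sum_le[OF assms(1)] by simp
qed

text \<open>Abel summation: monotone weights cost only a factor 2 \<open>a B\<close>. It will strip
  the logarithm from sums over intervals.\<close>

lemma norm_weighted_sum_le:
  fixes a :: "nat \<Rightarrow> real" and z :: "nat \<Rightarrow> complex"
  assumes "mono a" "\<And>n. 0 \<le> a n" and M: "\<And>B. norm (\<Sum>n\<in>{A<..B}. z n) \<le> M"
  shows "norm (\<Sum>n\<in>{A<..B}. of_real (a n) * z n) \<le> 2 * a B * M"
proof -
  define S where "S B = (\<Sum>n\<in>{A<..B}. z n)" for B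
  define T where "T B = (\<Sum>n\<in>{A<..B}. of_real (a n) * z n)" for B
  have M0: "0 \<le> M" using M[of 0] norm_ge_zero order_trans by blast
  \<comment> \<open>By Abel summation this difference is, up to sign, the sum of the increments of a
    times the partial sums S; the increments telescope.\<close>
  have *: "norm (T B - of_real (a B) * S B) \<le> a B * M" if "A \<le> B" for B
    using that
  proof (induction B rule: dec_induct)
    case base
    then show ?case using assms(2)[of A] M0 by (simp add: T_def S_def)
  next
    case (step B)
    have e: "{A<..Suc B} = insert (Suc B) {A<..B}" using step by auto
    have "T (Suc B) - of_real (a (Suc B)) * S (Suc B) = (T B - of_real (a B) * S B) - of_real (a (Suc B) - a B) * S B"
      unfolding T_def S_def e by (simp add: algebra_simps)
    then have "norm (T (Suc B) - of_real (a (Suc B)) * S (Suc B))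
      \<le> norm (T B - of_real (a B) * S B) + norm (of_real (a (Suc B) - a B) * S B)"
      by (metis norm_triangle_ineq4)
    also have "norm (of_real (a (Suc B) - a B) * S B) = (a (Suc B) - a B) * norm (S B)"
      using monoD[OF assms(1), of B "Suc B"] by (simp add: norm_mult del: of_real_diff)
    also have "norm (T B - of_real (a B) * S B) + (a (Suc B) - a B) * norm (S B) \<le> a B * M + (a (Suc B) - a B) * M"
      using step.IH M[of B] monoD[OF assms(1), of B "Suc B"] unfolding S_def by (intro add_mono mult_left_mono) auto
    also have "\<dots> = a (Suc B) * M" by (simp add: algebra_simps)
    finally show ?case .
  qed
  show ?thesis
  proof (cases "A \<le> B")
    case True
    have "norm (T B) \<le> norm (T B - of_real (a B) * S B) + norm (of_real (a B) * S B)"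
      by (metis diff_add_cancel norm_triangle_ineq)
    also have "\<dots> \<le> a B * M + a B * M"
      using *[OF True] M[of B] assms(2)[of B] unfolding S_def by (intro add_mono) (auto simp: norm_mult mult_left_mono)
    finally show ?thesis by (simp add: T_def algebra_simps)
  next
    case False
    then show ?thesis using assms(2)[of B] M0 by simp
  qed
qed

text \<open>With \<delta> = c / X this bounds twice the sum of 1 / (k \<delta>) over 1 <= k <= 1 /
  \<delta>.\<close>

definition spacing_bound :: "real \<Rightarrow> real \<Rightarrow> real" where
  "spacing_bound c X = 2 * (X / c) * (1 + ln (X / c))"

text \<open>For n <= X the signed distances of n \<alpha> to the nearest integer are
  \<delta>-separated with \<delta> = c / Y, because the differences of the n lie in the window as
  well. They also keep \<delta> away from 0, so the sum is dominated by two harmonic sums, one for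
  each sign.\<close>

lemma sum_inverse_dist_le:
  assumes bad: "bad_window c Q Z \<alpha>" and c: "0 < c" "c \<le> 1" and X: "real X \<le> Y" "Q \<le> Y" "real X \<le> Z" "1 \<le> Y"
  shows "(\<Sum>n=1..X. 1 / dist_to_int (real n * \<alpha>)) \<le> spacing_bound c Y"
proof -
  define \<delta> where "\<delta> = c / Y"
  have \<delta>0: "\<delta> > 0" using c X by (simp add: \<delta>_def)
  have \<delta>1: "\<delta> \<le> 1" using c X by (simp add: \<delta>_def)
  have dist_ge: "\<delta> \<le> dist_to_int (real n * \<alpha>)" if n: "n \<in> {1..X}" for n
  proof -
    have "\<delta> \<le> c / max (real n) Q" unfolding \<delta>_def
      using n c X by (intro divide_left_mono mult_pos_pos) (auto simp: max_def)
    also have "\<dots> \<le> dist_to_int (real n * \<alpha>)" using n X by (intro bad_windowD[OF bad]) auto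
    finally show ?thesis .
  qed
  have "\<exists>m. \<forall>n. dist_to_int (real n * \<alpha>) = \<bar>real n * \<alpha> - of_int (m n)\<bar>"
    using dist_to_int_attained by (intro choice) auto
  then obtain m :: "nat \<Rightarrow> int" where m: "\<And>n. dist_to_int (real n * \<alpha>) = \<bar>real n * \<alpha> - of_int (m n)\<bar>"
    by blast
  define s where "s n = real n * \<alpha> - of_int (m n)" for n
  define K where "K n = nat \<lfloor>\<bar>s n\<bar> / \<delta>\<rfloor>" for n
  \<comment> \<open>The sign and the index of the cell of length \<delta> that contains |s n|. The
    index is at least 1 since |s n| >= \<delta>, and no cell holds two n.\<close>
  define \<kappa> where "\<kappa> n = (s n \<ge> 0, K n)" for n
  define J where "J = nat \<lfloor>1 / \<delta>\<rfloor>"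
  have J: "real J \<le> 1 / \<delta>" "J \<ge> 1" using \<delta>0 \<delta>1 by (auto simp: J_def le_nat_iff le_floor_iff)
  have sd: "\<delta> \<le> \<bar>s n\<bar>" "\<bar>s n\<bar> \<le> 1 / 2" if "n \<in> {1..X}" for n
    using dist_ge[OF that] dist_to_int_le_half[of "real n * \<alpha>"] m[of n] by (auto simp: s_def)
  have K1: "K n \<in> {1..J}" "real (K n) * \<delta> \<le> \<bar>s n\<bar>" if n: "n \<in> {1..X}" for n
  proof -
    have "1 \<le> \<bar>s n\<bar> / \<delta>" using sd[OF n] \<delta>0 by (simp add: pos_le_divide_eq)
    then have "1 \<le> K n" by (simp add: K_def le_nat_iff le_floor_iff)
    moreover have "K n \<le> J" unfolding K_def J_def
      using sd[OF n] \<delta>0 by (intro nat_mono floor_mono divide_right_mono) auto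
    ultimately show "K n \<in> {1..J}" by simp
    have "real (K n) \<le> \<bar>s n\<bar> / \<delta>" using \<delta>0 by (simp add: K_def)
    then show "real (K n) * \<delta> \<le> \<bar>s n\<bar>" using \<delta>0 by (simp add: pos_le_divide_eq)
  qed
  have close: False if n: "n \<in> {1..X}" "n' \<in> {1..X}" "n < n'" and e: "\<kappa> n = \<kappa> n'" for n n'
  proof -
    have "\<lfloor>\<bar>s n\<bar> / \<delta>\<rfloor> = \<lfloor>\<bar>s n'\<bar> / \<delta>\<rfloor>" using e \<delta>0 by (simp add: \<kappa>_def K_def eq_nat_nat_iff)
    then have "\<bar>\<bar>s n\<bar> / \<delta> - \<bar>s n'\<bar> / \<delta>\<bar> < 1" by linarith
    then have "\<bar>\<bar>s n\<bar> - \<bar>s n'\<bar>\<bar> / \<delta> < 1" using \<delta>0 by (simp add: diff_divide_distrib[symmetric])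
    then have "\<bar>\<bar>s n\<bar> - \<bar>s n'\<bar>\<bar> < \<delta>" using \<delta>0 by (simp add: pos_divide_less_eq)
    moreover have "(s n \<ge> 0) = (s n' \<ge> 0)" using e by (simp add: \<kappa>_def)
    ultimately have "\<bar>s n' - s n\<bar> < \<delta>" by (auto simp: abs_if split: if_splits)
    moreover have "dist_to_int (real (n' - n) * \<alpha>) \<le> \<bar>real (n' - n) * \<alpha> - of_int (m n' - m n)\<bar>"
      by (rule dist_to_int_le)
    moreover have "real (n' - n) * \<alpha> - of_int (m n' - m n) = s n' - s n"
      using n by (simp add: s_def of_nat_diff algebra_simps)
    moreover have "\<delta> \<le> dist_to_int (real (n' - n) * \<alpha>)" using n by (intro dist_ge) auto
    ultimately show False by simp
  qed
  have inj: "inj_on \<kappa> {1..X}"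
    by (rule inj_onI) (metis close linorder_neqE_nat)
  have "(\<Sum>n=1..X. 1 / dist_to_int (real n * \<alpha>)) \<le> (\<Sum>n=1..X. (\<lambda>(b, k). 1 / (real k * \<delta>)) (\<kappa> n))"
  proof (rule sum_mono)
    fix n assume n: "n \<in> {1..X}"
    have k0: "0 < real (K n) * \<delta>" using K1[OF n] \<delta>0 by simp
    have s0: "0 < \<bar>s n\<bar>" using sd(1)[OF n] \<delta>0 by linarith
    have "1 / \<bar>s n\<bar> \<le> 1 / (real (K n) * \<delta>)"
      by (rule divide_left_mono[OF K1(2)[OF n] _ mult_pos_pos[OF s0 k0]]) simp
    then show "1 / dist_to_int (real n * \<alpha>) \<le> (\<lambda>(b, k). 1 / (real k * \<delta>)) (\<kappa> n)"
      by (simp add: \<kappa>_def m s_def)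
  qed
  also have "\<dots> = (\<Sum>(b, k)\<in>\<kappa> ` {1..X}. 1 / (real k * \<delta>))" using inj by (simp add: sum.reindex)
  also have "\<dots> \<le> (\<Sum>(b, k)\<in>(UNIV::bool set) \<times> {1..J}. 1 / (real k * \<delta>))"
    using K1(1) \<delta>0 by (intro sum_mono2) (auto simp: \<kappa>_def)
  also have "\<dots> = (\<Sum>b\<in>(UNIV::bool set). \<Sum>k\<in>{1..J}. 1 / (real k * \<delta>))" by (rule sum.cartesian_product[symmetric])
  also have "\<dots> = 2 * (\<Sum>k=1..J. 1 / (real k * \<delta>))" unfolding sum_constant by (simp add: card_UNIV_bool)
  also have "(\<Sum>k=1..J. 1 / (real k * \<delta>)) = 1 / \<delta> * (\<Sum>k=1..J. 1 / real k)"
    unfolding sum_distrib_left by (intro sum.cong refl) simp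
  also have "2 * (1 / \<delta> * (\<Sum>k=1..J. 1 / real k)) \<le> 2 * (1 / \<delta> * (1 + ln (1 / \<delta>)))"
  proof (intro mult_left_mono)
    have "ln (real J) \<le> ln (1 / \<delta>)" using J \<delta>0 by (subst ln_le_cancel_iff) auto
    then show "(\<Sum>k=1..J. 1 / real k) \<le> 1 + ln (1 / \<delta>)" using harmonic_le[OF J(2)] by linarith
  qed (use \<delta>0 in auto)
  finally show ?thesis using c X by (simp add: spacing_bound_def \<delta>_def)
qed

section \<open>Moebius inversion and the bilinear form of the von Mangoldt function\<close>

definition moebius_fun :: "nat \<Rightarrow> real" where
  "moebius_fun n = (if squarefree n then (- 1) ^ card (prime_factors n) else 0)"

lemma abs_moebius_fun_le: "\<bar>moebius_fun n\<bar> \<le> 1"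
  by (simp add: moebius_fun_def)

text \<open>The squarefree divisors of n correspond to the subsets of its prime factors, and the
  sign is the parity of the subset.\<close>

lemma sum_moebius_fun_divisors:
  assumes n: "n \<ge> 1"
  shows "(\<Sum>d | d dvd n. moebius_fun d) = (if n = 1 then 1 else 0)"
proof -
  let ?P = "prime_factors n"
  have pr: "\<And>l. l \<in> ?P \<Longrightarrow> prime l" by auto
  have fin: "finite {d. d dvd n}" using n by simp
  have "(\<Sum>d | d dvd n. moebius_fun d) = (\<Sum>d | d dvd n \<and> squarefree d. (- 1) ^ card (prime_factors d))"
    using fin by (intro sum.mono_neutral_cong_right) (auto simp: moebius_fun_def)
  also have "\<dots> = (\<Sum>X\<in>Pow ?P. (- 1) ^ card X)"
  proof (rule sum.reindex_bij_witness[where i = Prod and j = prime_factors])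
    fix d assume d: "d \<in> {d. d dvd n \<and> squarefree d}"
    then show "\<Prod>(prime_factors d) = d" using Prod_prime_factors_squarefree by blast
    show "prime_factors d \<in> Pow ?P" using d n by (simp add: dvd_prime_factors)
  next
    fix X assume X: "X \<in> Pow ?P"
    have fX: "finite X" using X finite_subset by blast
    have pX: "\<And>l. l \<in> X \<Longrightarrow> prime l" using X pr by blast
    have X0: "\<Prod>X \<noteq> 0" using fX pX by (simp add: prod_zero_iff) (metis not_prime_0)
    show "prime_factors (\<Prod>X) = X"
    proof (intro equalityI subsetI)
      fix p assume "p \<in> prime_factors (\<Prod>X)"
      then have "prime p" "p dvd \<Prod>X" by auto
      then show "p \<in> X" using prime_dvd_prod_primes_iff[of X p] fX pX by blast
    next
      fix p assume p: "p \<in> X"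
      then have "p dvd \<Prod>X" using prime_dvd_prod_primes_iff[of X p] fX pX by blast
      then show "p \<in> prime_factors (\<Prod>X)" using pX[OF p] X0 by (simp add: prime_factors_dvd)
    qed
    have "squarefree (\<Prod>X)" using pX
      by (intro squarefree_prod_coprime) (auto simp: primes_coprime squarefree_prime)
    moreover have "\<Prod>X dvd n"
    proof -
      have "\<Prod>X dvd \<Prod>?P" using X by (intro prod_dvd_prod_subset) auto
      also have "\<Prod>?P dvd (\<Prod>p\<in>?P. p ^ multiplicity p n)"
        by (intro prod_dvd_prod) (auto simp: prime_factors_multiplicity)
      also have "\<dots> = n" using prod_prime_factors[of n] n by simp
      finally show ?thesis .
    qed
    ultimately show "\<Prod>X \<in> {d. d dvd n \<and> squarefree d}" by simp
  qed simp
  also have "\<dots> = (if ?P = {} then 1 else 0)" by (rule sum_Pow_alternating) simp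
  also have "\<dots> = (if n = 1 then 1 else 0)" using n by (simp add: prime_factorization_empty_iff)
  finally show ?thesis .
qed

text \<open>The Dirichlet convolution of the constant 1 with \<open>mangoldt\<close> restricted to
  arguments above V.\<close>

definition mangoldt_above :: "nat \<Rightarrow> nat \<Rightarrow> real" where
  "mangoldt_above V r = (\<Sum>k | k dvd r \<and> V < k. mangoldt k)"

lemma finite_divisors_and: "r \<ge> 1 \<Longrightarrow> finite {k::nat. k dvd r \<and> P k}"
  by (rule finite_subset[of _ "{k. k dvd r}"]) auto

lemma mangoldt_above_bounds:
  assumes "r \<ge> 1"
  shows "0 \<le> mangoldt_above V r" "mangoldt_above V r \<le> ln (real r)"
proof -
  show "0 \<le> mangoldt_above V r" unfolding mangoldt_above_def by (intro sum_nonneg mangoldt_nonneg)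
  have "mangoldt_above V r \<le> (\<Sum>k | k dvd r. mangoldt k)"
    unfolding mangoldt_above_def using assms by (intro sum_mono2 mangoldt_nonneg) auto
  then show "mangoldt_above V r \<le> ln (real r)" using mangoldt_sum[of r, where ?'a = real] assms by simp
qed

lemma mangoldt_above_eq_0: "r \<ge> 1 \<Longrightarrow> r \<le> V \<Longrightarrow> mangoldt_above V r = 0"
proof -
  assume r: "r \<ge> 1" "r \<le> V"
  have "{k. k dvd r \<and> V < k} = {}" using r dvd_imp_le[of _ r] by fastforce
  then show ?thesis by (simp only: mangoldt_above_def sum.empty)
qed

lemma mangoldt_above_eq:
  assumes "r \<ge> 1"
  shows "mangoldt_above V r = ln (real r) - (\<Sum>k | k dvd r \<and> k \<le> V. mangoldt k)"
proof -
  have "ln (real r) = (\<Sum>k | k dvd r. mangoldt k)" using mangoldt_sum[of r, where ?'a = real] assms by simp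
  also have "{k. k dvd r} = {k. k dvd r \<and> V < k} \<union> {k. k dvd r \<and> k \<le> V}" by auto
  also have "(\<Sum>k\<in>{k. k dvd r \<and> V < k} \<union> {k. k dvd r \<and> k \<le> V}. mangoldt k :: real)
    = mangoldt_above V r + (\<Sum>k | k dvd r \<and> k \<le> V. mangoldt k)"
    unfolding mangoldt_above_def using assms finite_divisors_and by (intro sum.union_disjoint) auto
  finally show ?thesis by simp
qed

text \<open>The bilinear decomposition of \<open>mangoldt\<close>: the terms with small \<open>d\<close> are of type I after
  \<open>mangoldt_above_eq\<close>, and those with large \<open>d\<close> are of type II since \<open>mangoldt_above V\<close> vanishes on \<open>{1..V}\<close>.\<close>

lemma mangoldt_convolution:
  assumes "n \<ge> 1" "V < n"
  shows "mangoldt n = (\<Sum>d | d dvd n. moebius_fun d * mangoldt_above V (n div d))"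
proof -
  have fin: "finite {d. d dvd n}" using assms by simp
  have "(\<Sum>d | d dvd n. moebius_fun d * mangoldt_above V (n div d))
      = (\<Sum>d\<in>{d. d dvd n}. \<Sum>k\<in>{k. k dvd n}. if d * k dvd n \<and> V < k then moebius_fun d * mangoldt k else 0)"
  proof (intro sum.cong refl)
    fix d assume d: "d \<in> {d. d dvd n}"
    then have d0: "d > 0" using assms by (auto intro: Nat.gr0I)
    have "{k. k dvd n div d \<and> V < k} = {k\<in>{k. k dvd n}. d * k dvd n \<and> V < k}"
      using d d0 by (auto simp: dvd_div_iff_mult mult.commute intro: dvd_mult_right)
    then have "moebius_fun d * mangoldt_above V (n div d) = (\<Sum>k\<in>{k\<in>{k. k dvd n}. d * k dvd n \<and> V < k}. moebius_fun d * mangoldt k)"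
      by (simp only: mangoldt_above_def sum_distrib_left)
    also have "\<dots> = (\<Sum>k\<in>{k. k dvd n}. if d * k dvd n \<and> V < k then moebius_fun d * mangoldt k else 0)"
      using fin by (rule sum.inter_filter)
    finally show "moebius_fun d * mangoldt_above V (n div d)
      = (\<Sum>k\<in>{k. k dvd n}. if d * k dvd n \<and> V < k then moebius_fun d * mangoldt k else 0)" .
  qed
  also have "\<dots> = (\<Sum>k\<in>{k. k dvd n}. \<Sum>d\<in>{d. d dvd n}. if d * k dvd n \<and> V < k then moebius_fun d * mangoldt k else 0)"
    by (rule sum.swap)
  \<comment> \<open>The Moebius sum over the divisors of n / k vanishes unless k = n, and V < n
    ensures that this term is present.\<close>
  also have "\<dots> = (\<Sum>k\<in>{k. k dvd n}. if k = n then mangoldt n else 0)"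
  proof (intro sum.cong refl)
    fix k assume k: "k \<in> {k. k dvd n}"
    then have k0: "k > 0" using assms by (auto intro: Nat.gr0I)
    have nk: "n div k \<ge> 1" using k assms k0 by (simp add: Suc_le_eq div_greater_zero_iff dvd_imp_le)
    show "(\<Sum>d\<in>{d. d dvd n}. if d * k dvd n \<and> V < k then moebius_fun d * mangoldt k else 0) = (if k = n then mangoldt n else 0)"
    proof (cases "V < k")
      case True
      have e: "{d\<in>{d. d dvd n}. d * k dvd n} = {d. d dvd n div k}"
        using k k0 by (auto simp: dvd_div_iff_mult intro: dvd_mult_left)
      have "(\<Sum>d\<in>{d. d dvd n}. if d * k dvd n \<and> V < k then moebius_fun d * mangoldt k else 0)
        = (\<Sum>d\<in>{d\<in>{d. d dvd n}. d * k dvd n}. moebius_fun d * mangoldt k)"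
        using True by (subst sum.inter_filter[OF fin]) simp
      also have "\<dots> = (\<Sum>d | d dvd n div k. moebius_fun d) * mangoldt k" unfolding e by (simp add: sum_distrib_right)
      also have "\<dots> = (if n div k = 1 then 1 else 0) * mangoldt k" unfolding sum_moebius_fun_divisors[OF nk] ..
      also have "n div k = 1 \<longleftrightarrow> k = n" using k k0 by auto
      finally show ?thesis by simp
    next
      case False
      then show ?thesis using assms by auto
    qed
  qed
  also have "\<dots> = mangoldt n" using fin by (simp add: sum.delta)
  finally show ?thesis ..
qed

section \<open>Type I and type II sums\<close>

lemma sum_divisors_rearrange:
  fixes h :: "nat \<Rightarrow> nat \<Rightarrow> 'a::comm_monoid_add"
  assumes A: "finite A" "0 \<notin> A"
  shows "(\<Sum>r\<in>A. \<Sum>k | k dvd r \<and> k \<le> V. h k (r div k)) = (\<Sum>k\<in>{1..V}. \<Sum>s | k * s \<in> A. h k s)"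
proof -
  have fin1: "finite {k. k dvd r \<and> k \<le> V}" for r by (rule finite_subset[of _ "{..V}"]) auto
  have fin2: "finite {s. k * s \<in> A}" if "k \<in> {1..V}" for k
  proof -
    have "inj_on (\<lambda>s. k * s) {s. k * s \<in> A}" using that by (intro inj_onI) simp
    moreover have "finite ((\<lambda>s. k * s) ` {s. k * s \<in> A})" by (rule finite_subset[OF _ A(1)]) auto
    ultimately show ?thesis using finite_imageD by blast
  qed
  have "(\<Sum>r\<in>A. \<Sum>k | k dvd r \<and> k \<le> V. h k (r div k)) = (\<Sum>(r, k)\<in>(SIGMA r:A. {k. k dvd r \<and> k \<le> V}). h k (r div k))"
    using A fin1 by (intro sum.Sigma) auto
  also have "\<dots> = (\<Sum>(k, s)\<in>(SIGMA k:{1..V}. {s. k * s \<in> A}). h k s)"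
  proof (rule sum.reindex_bij_witness[where i = "\<lambda>(k, s). (k * s, k)" and j = "\<lambda>(r, k). (k, r div k)"])
    fix z assume z: "z \<in> (SIGMA r:A. {k. k dvd r \<and> k \<le> V})"
    then obtain r k where rk: "z = (r, k)" "r \<in> A" "k dvd r" "k \<le> V" by auto
    have "r \<noteq> 0" using rk(2) A(2) by metis
    then have "k \<noteq> 0" using rk by auto
    then show "(case case z of (r, k) \<Rightarrow> (k, r div k) of (k, s) \<Rightarrow> (k * s, k)) = z"
      "(case z of (r, k) \<Rightarrow> (k, r div k)) \<in> (SIGMA k:{1..V}. {s. k * s \<in> A})"
      "(case case z of (r, k) \<Rightarrow> (k, r div k) of (k, s) \<Rightarrow> h k s) = (case z of (r, k) \<Rightarrow> h k (r div k))"
      using rk by auto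
  next
    fix z assume z: "z \<in> (SIGMA k:{1..V}. {s. k * s \<in> A})"
    then obtain k s where "z = (k, s)" "k \<ge> 1" "k \<le> V" "k * s \<in> A" by auto
    then show "(case case z of (k, s) \<Rightarrow> (k * s, k) of (r, k) \<Rightarrow> (k, r div k)) = z"
      "(case z of (k, s) \<Rightarrow> (k * s, k)) \<in> (SIGMA r:A. {k. k dvd r \<and> k \<le> V})" by auto
  qed
  also have "\<dots> = (\<Sum>k\<in>{1..V}. \<Sum>s | k * s \<in> A. h k s)"
    using fin2 by (intro sum.Sigma[symmetric]) auto
  finally show ?thesis .
qed

text \<open>For d >= 1 this is an interval of integers, so exponential sums over it are
  geometric.\<close>

definition cofactors :: "nat \<Rightarrow> nat \<Rightarrow> nat set" where
  "cofactors i d = {r. d * r \<in> dyadic i}"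

lemma cofactors_props:
  assumes "d \<ge> 1"
  shows "finite (cofactors i d)" "0 \<notin> cofactors i d" "\<And>r. r \<in> cofactors i d \<Longrightarrow> 1 \<le> r \<and> r \<le> 2 ^ Suc i"
    "\<And>x y z. x \<in> cofactors i d \<Longrightarrow> y \<in> cofactors i d \<Longrightarrow> x \<le> z \<Longrightarrow> z \<le> y \<Longrightarrow> z \<in> cofactors i d"
proof -
  show b: "1 \<le> r \<and> r \<le> 2 ^ Suc i" if "r \<in> cofactors i d" for r
  proof -
    have r: "2 ^ i < d * r" "d * r \<le> 2 ^ Suc i" using that by (auto simp: cofactors_def dyadic_def)
    have "r \<noteq> 0" using r by (intro notI) simp
    moreover have "1 * r \<le> d * r" using assms by (intro mult_le_mono1)
    ultimately show ?thesis using r by linarith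
  qed
  have "cofactors i d \<subseteq> {..2 ^ Suc i}" using b by blast
  then show "finite (cofactors i d)" by (rule finite_subset) simp
  show "0 \<notin> cofactors i d" using b[of 0] by auto
  fix x y z assume "x \<in> cofactors i d" "y \<in> cofactors i d" "x \<le> z" "z \<le> y"
  then have "d * x \<le> d * z" "d * z \<le> d * y" "2 ^ i < d * x" "d * y \<le> 2 ^ Suc i"
    by (simp_all add: cofactors_def dyadic_def)
  then have "2 ^ i < d * z" "d * z \<le> 2 ^ Suc i" by linarith+
  then show "z \<in> cofactors i d" by (simp add: cofactors_def dyadic_def)
qed

lemma norm_expi_cofactors_le:
  assumes "d \<ge> 1" "0 < dist_to_int (real d * \<alpha>)"
  shows "norm (\<Sum>r\<in>cofactors i d. expi (real (d * r) * \<alpha>)) \<le> 1 / dist_to_int (real d * \<alpha>)"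
proof -
  have "norm (\<Sum>r\<in>cofactors i d. expi (real r * (real d * \<alpha>))) \<le> 1 / dist_to_int (real d * \<alpha>)"
    using assms(2) cofactors_props[OF assms(1)] by (intro norm_expi_sum_convex_le) blast+
  then show ?thesis by (simp add: mult_ac)
qed

lemma ln_real_nonneg: "0 \<le> ln (real n)"
  by (cases "n = 0") auto

lemma norm_ln_expi_cofactors_le:
  assumes d: "d \<ge> 1" and pos: "0 < dist_to_int (real d * \<alpha>)"
  shows "norm (\<Sum>r\<in>cofactors i d. of_real (ln (real r)) * expi (real (d * r) * \<alpha>))
     \<le> 2 * ln (2 ^ Suc i) * (1 / dist_to_int (real d * \<alpha>))"
proof -
  note cp = cofactors_props[OF d, where i = i]
  obtain A B where AB: "cofactors i d = {A<..B}" by (rule nat_interval_eq[OF cp(1) cp(4) cp(2)])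
  show ?thesis
  proof (cases "A < B")
    case True
    then have "B \<in> cofactors i d" using AB by simp
    then have B: "1 \<le> B" "B \<le> 2 ^ Suc i" using cp(3) by auto
    have "mono (\<lambda>n. ln (real n))"
    proof (rule monoI)
      fix x y :: nat assume "x \<le> y"
      then show "ln (real x) \<le> ln (real y)" using ln_real_nonneg[of y] by (cases "x = 0") auto
    qed
    then have "norm (\<Sum>r\<in>{A<..B}. of_real (ln (real r)) * expi (real r * (real d * \<alpha>)))
       \<le> 2 * ln (real B) * (1 / dist_to_int (real d * \<alpha>))"
      by (rule norm_weighted_sum_le[where a = "\<lambda>n. ln (real n)"]) (auto simp: ln_real_nonneg intro: norm_expi_sum_le pos)
    also have "\<dots> \<le> 2 * ln (2 ^ Suc i) * (1 / dist_to_int (real d * \<alpha>))"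
    proof (intro mult_right_mono mult_left_mono)
      have "real B \<le> real (2 ^ Suc i)" using B by (intro of_nat_mono)
      then show "ln (real B) \<le> ln (2 ^ Suc i)" using B by (subst ln_le_cancel_iff) auto
    qed (use pos in auto)
    finally show ?thesis unfolding AB by (simp add: mult_ac)
  next
    case False
    have "0 \<le> ln ((2::real) ^ Suc i)" by (simp add: ln_realpow del: power_Suc)
    then show ?thesis unfolding AB using False pos by simp
  qed
qed

text \<open>By \<open>mangoldt_above_eq\<close> the coefficient is ln r minus a sum over k <= V. The
  first part is smooth in r; in the second, r = k s leaves a geometric sum over s with frequency d k
  \<alpha>. Only multiples n \<alpha> with n <= U V occur; the two parts give 2 L B and L B.\<close>

lemma norm_type_I_le:
  assumes pos: "\<And>n. 1 \<le> n \<Longrightarrow> n \<le> U * V \<Longrightarrow> 0 < dist_to_int (real n * \<alpha>)"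
    and B: "(\<Sum>n=1..U * V. 1 / dist_to_int (real n * \<alpha>)) \<le> B"
    and UV: "1 \<le> U" "1 \<le> V" "U * V \<le> 2 ^ Suc i"
  shows "norm (\<Sum>d\<in>{1..U}. of_real (moebius_fun d) *
      (\<Sum>r\<in>cofactors i d. of_real (mangoldt_above V r) * expi (real (d * r) * \<alpha>))) \<le> 3 * ln (2 ^ Suc i) * B"
proof -
  define G where "G n = 1 / dist_to_int (real n * \<alpha>)" for n
  define L where "L = ln ((2::real) ^ Suc i)"
  have G0: "0 \<le> G n" for n by (simp add: G_def dist_to_int_nonneg)
  have L0: "0 \<le> L" unfolding L_def by (simp add: ln_realpow del: power_Suc)
  have inner: "norm (\<Sum>r\<in>cofactors i d. of_real (mangoldt_above V r) * expi (real (d * r) * \<alpha>))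
      \<le> 2 * L * G d + (\<Sum>k\<in>{1..V}. mangoldt k * G (d * k))" if d: "d \<in> {1..U}" for d
  proof -
    have d1: "d \<ge> 1" using d by simp
    note cp = cofactors_props[OF d1, where i = i]
    have dk: "1 \<le> d * k \<and> d * k \<le> U * V" if "k \<in> {1..V}" for k
      using d that by (auto intro: mult_le_mono simp: Suc_le_eq)
    have "(\<Sum>r\<in>cofactors i d. of_real (mangoldt_above V r) * expi (real (d * r) * \<alpha>))
       = (\<Sum>r\<in>cofactors i d. of_real (ln (real r)) * expi (real (d * r) * \<alpha>)
           - (\<Sum>k | k dvd r \<and> k \<le> V. of_real (mangoldt k) * expi (real (d * k * (r div k)) * \<alpha>)))"
    proof (intro sum.cong refl)
      fix r assume r: "r \<in> cofactors i d"
      then have r1: "r \<ge> 1" using cp(3) by blast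
      have "(\<Sum>k | k dvd r \<and> k \<le> V. of_real (mangoldt k) * expi (real (d * k * (r div k)) * \<alpha>))
         = (\<Sum>k | k dvd r \<and> k \<le> V. of_real (mangoldt k) * expi (real (d * r) * \<alpha>))"
        by (intro sum.cong refl) (auto simp: mult.assoc)
      then show "of_real (mangoldt_above V r) * expi (real (d * r) * \<alpha>) = of_real (ln (real r)) * expi (real (d * r) * \<alpha>)
           - (\<Sum>k | k dvd r \<and> k \<le> V. of_real (mangoldt k) * expi (real (d * k * (r div k)) * \<alpha>))"
        unfolding mangoldt_above_eq[OF r1] by (simp add: left_diff_distrib sum_distrib_right)
    qed
    also have "\<dots> = (\<Sum>r\<in>cofactors i d. of_real (ln (real r)) * expi (real (d * r) * \<alpha>))
       - (\<Sum>k\<in>{1..V}. \<Sum>s | k * s \<in> cofactors i d. of_real (mangoldt k) * expi (real (d * k * s) * \<alpha>))"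
      unfolding sum_subtractf sum_divisors_rearrange[OF cp(1,2), where V = V and h = "\<lambda>k s. of_real (mangoldt k) * expi (real (d * k * s) * \<alpha>)"] ..
    also have "norm \<dots> \<le> 2 * L * G d + (\<Sum>k\<in>{1..V}. mangoldt k * G (d * k))"
    proof (rule order_trans[OF norm_triangle_ineq4 add_mono])
      show "norm (\<Sum>r\<in>cofactors i d. of_real (ln (real r)) * expi (real (d * r) * \<alpha>)) \<le> 2 * L * G d"
        unfolding L_def G_def using dk[of 1] UV pos[of d] by (intro norm_ln_expi_cofactors_le[OF d1]) auto
      show "norm (\<Sum>k\<in>{1..V}. \<Sum>s | k * s \<in> cofactors i d. of_real (mangoldt k) * expi (real (d * k * s) * \<alpha>))
         \<le> (\<Sum>k\<in>{1..V}. mangoldt k * G (d * k))"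
      proof (rule order_trans[OF norm_sum sum_mono])
        fix k assume k: "k \<in> {1..V}"
        have "{s. k * s \<in> cofactors i d} = cofactors i (d * k)" by (simp add: cofactors_def mult.assoc)
        then have "(\<Sum>s | k * s \<in> cofactors i d. of_real (mangoldt k) * expi (real (d * k * s) * \<alpha>))
           = of_real (mangoldt k) * (\<Sum>s\<in>cofactors i (d * k). expi (real (d * k * s) * \<alpha>))"
          by (simp only: sum_distrib_left)
        then have "norm (\<Sum>s | k * s \<in> cofactors i d. of_real (mangoldt k) * expi (real (d * k * s) * \<alpha>))
           = mangoldt k * norm (\<Sum>s\<in>cofactors i (d * k). expi (real (d * k * s) * \<alpha>))"
          by (simp only: norm_mult norm_of_real abs_mangoldt)
        also have "\<dots> \<le> mangoldt k * G (d * k)"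
          unfolding G_def using dk[OF k] pos[of "d * k"]
          by (intro mult_left_mono mangoldt_nonneg norm_expi_cofactors_le) auto
        finally show "norm (\<Sum>s | k * s \<in> cofactors i d. of_real (mangoldt k) * expi (real (d * k * s) * \<alpha>))
           \<le> mangoldt k * G (d * k)" .
      qed
    qed
    finally show ?thesis .
  qed
  have "norm (\<Sum>d\<in>{1..U}. of_real (moebius_fun d) *
      (\<Sum>r\<in>cofactors i d. of_real (mangoldt_above V r) * expi (real (d * r) * \<alpha>)))
      \<le> (\<Sum>d\<in>{1..U}. 2 * L * G d + (\<Sum>k\<in>{1..V}. mangoldt k * G (d * k)))"
  proof (rule order_trans[OF norm_sum sum_mono])
    fix d assume d: "d \<in> {1..U}"
    let ?W = "\<Sum>r\<in>cofactors i d. of_real (mangoldt_above V r) * expi (real (d * r) * \<alpha>)"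
    have "norm (of_real (moebius_fun d) * ?W) \<le> 1 * norm ?W"
      unfolding norm_mult norm_of_real by (intro mult_right_mono abs_moebius_fun_le) simp
    then show "norm (of_real (moebius_fun d) * ?W) \<le> 2 * L * G d + (\<Sum>k\<in>{1..V}. mangoldt k * G (d * k))"
      using inner[OF d] by simp
  qed
  also have "\<dots> = 2 * L * (\<Sum>d\<in>{1..U}. G d) + (\<Sum>d\<in>{1..U}. \<Sum>k\<in>{1..V}. mangoldt k * G (d * k))"
    by (simp add: sum.distrib sum_distrib_left)
  also have "\<dots> \<le> 2 * L * B + L * B"
  proof (intro add_mono mult_left_mono)
    have "(\<Sum>d\<in>{1..U}. G d) \<le> (\<Sum>d\<in>{1..U * V}. G d)" using G0 UV by (intro sum_mono2) auto
    then show "(\<Sum>d\<in>{1..U}. G d) \<le> B" using B unfolding G_def by linarith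
    show "0 \<le> 2 * L" using L0 by simp
    \<comment> \<open>Collect the pairs by t = d k <= U V: the weights \<open>mangoldt k\<close>
      over k | t add up to ln t <= L.\<close>
    define F where "F = (\<lambda>(t, k). mangoldt k * G t)"
    define X where "X = (SIGMA t:{1..U * V}. {k. k dvd t})"
    have finX: "finite X" unfolding X_def by (intro finite_SigmaI) auto
    have inj: "inj_on (\<lambda>(d, k). (d * k, k)) ({1..U} \<times> {1..V})" by (rule inj_onI) auto
    have "(\<Sum>d\<in>{1..U}. \<Sum>k\<in>{1..V}. mangoldt k * G (d * k)) = (\<Sum>z\<in>{1..U} \<times> {1..V}. F ((\<lambda>(d, k). (d * k, k)) z))"
      unfolding F_def sum.cartesian_product by (intro sum.cong refl) auto
    also have "\<dots> = sum F ((\<lambda>(d, k). (d * k, k)) ` ({1..U} \<times> {1..V}))" using inj by (simp add: sum.reindex)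
    also have "\<dots> \<le> sum F X"
    proof (rule sum_mono2[OF finX])
      show "(\<lambda>(d, k). (d * k, k)) ` ({1..U} \<times> {1..V}) \<subseteq> X"
        unfolding X_def by (auto intro: mult_le_mono simp: Suc_le_eq)
      fix z show "0 \<le> F z" unfolding F_def using G0 by (auto intro!: mult_nonneg_nonneg mangoldt_nonneg split: prod.split)
    qed
    also have "sum F X = (\<Sum>t\<in>{1..U * V}. \<Sum>k | k dvd t. mangoldt k * G t)"
      unfolding X_def F_def by (intro sum.Sigma[symmetric]) auto
    also have "\<dots> \<le> (\<Sum>t\<in>{1..U * V}. L * G t)"
    proof (rule sum_mono)
      fix t assume t: "t \<in> {1..U * V}"
      have "(\<Sum>k | k dvd t. mangoldt k * G t) = ln (real t) * G t"
        using mangoldt_sum[of t, where ?'a = real] t by (simp add: sum_distrib_right[symmetric])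
      also have "\<dots> \<le> L * G t"
      proof (rule mult_right_mono[OF _ G0])
        have "t \<le> 2 ^ Suc i" using t UV by simp
        then have "real t \<le> real (2 ^ Suc i)" by (intro of_nat_mono)
        then show "ln (real t) \<le> L" unfolding L_def using t by (subst ln_le_cancel_iff) auto
      qed
      finally show "(\<Sum>k | k dvd t. mangoldt k * G t) \<le> L * G t" .
    qed
    also have "\<dots> \<le> L * B" unfolding sum_distrib_left[symmetric] using B L0 by (intro mult_left_mono) (auto simp: G_def)
    finally show "(\<Sum>d\<in>{1..U}. \<Sum>k\<in>{1..V}. mangoldt k * G (d * k)) \<le> L * B" .
  qed
  also have "2 * L * B + L * B = 3 * L * B" by simp
  finally show ?thesis unfolding L_def .
qed

lemma sum_abs_diff_le:
  fixes G :: "nat \<Rightarrow> real"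
  assumes "\<And>n. 0 \<le> G n" "r \<in> {1..Y}"
  shows "(\<Sum>s\<in>{1..Y} - {r}. G (nat \<bar>int r - int s\<bar>)) \<le> 2 * (\<Sum>n=1..Y. G n)"
proof -
  have "{1..Y} - {r} = {1..<r} \<union> {r<..Y}" using assms by auto
  then have "(\<Sum>s\<in>{1..Y} - {r}. G (nat \<bar>int r - int s\<bar>))
     = (\<Sum>s\<in>{1..<r}. G (nat \<bar>int r - int s\<bar>)) + (\<Sum>s\<in>{r<..Y}. G (nat \<bar>int r - int s\<bar>))"
    by (simp add: sum.union_disjoint disjoint_iff)
  also have "(\<Sum>s\<in>{1..<r}. G (nat \<bar>int r - int s\<bar>)) = (\<Sum>n\<in>{1..<r}. G n)"
    by (rule sum.reindex_bij_witness[where i = "\<lambda>n. r - n" and j = "\<lambda>s. r - s"]) (auto simp: nat_diff_distrib of_nat_diff)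
  also have "(\<Sum>s\<in>{r<..Y}. G (nat \<bar>int r - int s\<bar>)) = (\<Sum>n\<in>{1..Y - r}. G n)"
    by (rule sum.reindex_bij_witness[where i = "\<lambda>n. r + n" and j = "\<lambda>s. s - r"]) (auto simp: abs_if, simp add: nat_minus_as_int)
  also have "(\<Sum>n\<in>{1..<r}. G n) + (\<Sum>n\<in>{1..Y - r}. G n) \<le> (\<Sum>n=1..Y. G n) + (\<Sum>n=1..Y. G n)"
    using assms by (intro add_mono sum_mono2) auto
  finally show ?thesis by simp
qed

text \<open>Cauchy-Schwarz in d removes the Moebius coefficients. Opening the square leaves, for
  each pair r, s, a geometric sum over d with frequency (r - s) \<alpha>. The diagonal contributes
  2^j for each r, and for fixed r the differences hit every n at most twice, hence 2 B.\<close>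

lemma norm_type_II_le:
  assumes pos: "\<And>n. 1 \<le> n \<Longrightarrow> n \<le> 2 ^ (Suc i - j) \<Longrightarrow> 0 < dist_to_int (real n * \<alpha>)"
    and B: "(\<Sum>n=1..2 ^ (Suc i - j). 1 / dist_to_int (real n * \<alpha>)) \<le> B" and j: "j \<le> i"
  shows "(norm (\<Sum>d\<in>dyadic j. of_real (moebius_fun d) *
      (\<Sum>r\<in>cofactors i d. of_real (mangoldt_above V r) * expi (real (d * r) * \<alpha>))))\<^sup>2
    \<le> (ln (2 ^ Suc i))\<^sup>2 * 2 ^ Suc i * (2 ^ j + 2 * B)"
proof -
  define G where "G n = 1 / dist_to_int (real n * \<alpha>)" for n
  define L where "L = ln ((2::real) ^ Suc i)"
  \<comment> \<open>2^j < d and d r <= 2^(i + 1) force r <= Y.\<close>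
  define Y :: nat where "Y = 2 ^ (Suc i - j)"
  define b where "b r = mangoldt_above V r" for r
  define P where "P d r \<longleftrightarrow> d * r \<in> dyadic i" for d r
  define W where "W d = (\<Sum>r\<in>cofactors i d. of_real (b r) * expi (real (d * r) * \<alpha>))" for d
  have G0: "0 \<le> G n" for n by (simp add: G_def dist_to_int_nonneg)
  have Yj: "Y * 2 ^ j = 2 ^ Suc i" unfolding Y_def power_add[symmetric] using j by simp
  have cardj: "card (dyadic j) = 2 ^ j" by (simp add: dyadic_def)
  have bL: "0 \<le> b r \<and> b r \<le> L" if r: "r \<in> {1..Y}" for r
  proof -
    have "r \<le> 2 ^ Suc i"
    proof -
      have "Y * 1 \<le> Y * 2 ^ j" by (intro mult_le_mono2) simp
      then show ?thesis using r Yj by auto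
    qed
    then have "real r \<le> real (2 ^ Suc i)" by (intro of_nat_mono)
    then have "ln (real r) \<le> L" unfolding L_def using r by (subst ln_le_cancel_iff) auto
    then show ?thesis using mangoldt_above_bounds[of r V] r unfolding b_def by auto
  qed
  have W: "W d = (\<Sum>r\<in>{1..Y}. if P d r then of_real (b r) * expi (real (d * r) * \<alpha>) else 0)" if d: "d \<in> dyadic j" for d
  proof -
    have d2: "2 ^ j < d" using d by (simp add: dyadic_def)
    then have d1: "d \<ge> 1" by linarith
    have "cofactors i d = {r\<in>{1..Y}. P d r}"
    proof (intro equalityI subsetI)
      fix r assume r: "r \<in> cofactors i d"
      then have r1: "1 \<le> r" "d * r \<le> 2 ^ Suc i" using cofactors_props(3)[OF d1] by (auto simp: cofactors_def dyadic_def)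
      have "2 ^ j * r \<le> d * r" using d2 by (intro mult_le_mono1) simp
      also have "\<dots> \<le> 2 ^ j * Y" using r1 Yj by (simp add: mult.commute)
      finally have "r \<le> Y" by simp
      then show "r \<in> {r\<in>{1..Y}. P d r}" using r r1 by (simp add: P_def cofactors_def)
    qed (simp add: P_def cofactors_def)
    then show ?thesis unfolding W_def by (simp only: sum.inter_filter[OF finite_atLeastAtMost])
  qed
  \<comment> \<open>Three conditions on d, each describing an interval, so \<open>I r s\<close> is
    an interval too.\<close>
  define I where "I r s = {d \<in> dyadic j. P d r \<and> P d s}" for r s
  have K: "norm (\<Sum>d\<in>I r s. expi (real d * ((real r - real s) * \<alpha>))) \<le> (if r = s then 2 ^ j else G (nat \<bar>int r - int s\<bar>))"
    if r: "r \<in> {1..Y}" and s: "s \<in> {1..Y}" for r s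
  proof (cases "r = s")
    case True
    have "norm (\<Sum>d\<in>I r s. expi (real d * ((real r - real s) * \<alpha>))) \<le> (\<Sum>d\<in>I r s. 1)"
      by (rule order_trans[OF norm_sum]) simp
    also have "\<dots> = real (card (I r s))" by simp
    also have "\<dots> \<le> real (card (dyadic j))" unfolding I_def by (intro of_nat_mono card_mono) auto
    finally show ?thesis using True cardj by simp
  next
    case False
    define n where "n = nat \<bar>int r - int s\<bar>"
    have n: "1 \<le> n" "n \<le> Y" using False r s by (auto simp: n_def)
    have "(real r - real s) * \<alpha> = real n * \<alpha> \<or> (real r - real s) * \<alpha> = - (real n * \<alpha>)"
      by (cases "s \<le> r") (auto simp: n_def of_nat_diff nat_diff_distrib algebra_simps)
    then have dn: "dist_to_int ((real r - real s) * \<alpha>) = dist_to_int (real n * \<alpha>)"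
      using dist_to_int_minus by metis
    have conv: "z \<in> I r s" if "x \<in> I r s" "y \<in> I r s" "x \<le> z" "z \<le> y" for x y z
    proof -
      have "x * r \<le> z * r" "z * r \<le> y * r" "x * s \<le> z * s" "z * s \<le> y * s" using that by (auto intro: mult_le_mono1)
      moreover have "2 ^ i < x * r" "2 ^ i < x * s" "y * r \<le> 2 ^ Suc i" "y * s \<le> 2 ^ Suc i" "2 ^ j < x" "y \<le> 2 ^ Suc j"
        using that by (simp_all add: I_def P_def dyadic_def)
      ultimately have "2 ^ i < z * r" "2 ^ i < z * s" "z * r \<le> 2 ^ Suc i" "z * s \<le> 2 ^ Suc i" "2 ^ j < z" "z \<le> 2 ^ Suc j"
        using that(3,4) by linarith+
      then show ?thesis by (simp add: I_def P_def dyadic_def)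
    qed
    have "norm (\<Sum>d\<in>I r s. expi (real d * ((real r - real s) * \<alpha>))) \<le> 1 / dist_to_int ((real r - real s) * \<alpha>)"
    proof (rule norm_expi_sum_convex_le)
      show "0 < dist_to_int ((real r - real s) * \<alpha>)" unfolding dn using n pos by (simp add: Y_def)
      show "finite (I r s)" by (simp add: I_def)
      show "0 \<notin> I r s" by (simp add: I_def dyadic_def)
    qed (rule conv)
    then show ?thesis using False unfolding dn by (simp add: G_def n_def)
  qed
  have "(\<Sum>d\<in>dyadic j. (norm (W d))\<^sup>2) \<le> 2 ^ (Suc i - j) * (L\<^sup>2 * (2 ^ j + 2 * B))"
  proof -
    have "complex_of_real (\<Sum>d\<in>dyadic j. (norm (W d))\<^sup>2) = (\<Sum>d\<in>dyadic j. W d * cnj (W d))"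
      by (simp only: of_real_sum complex_norm_square)
    also have "\<dots> = (\<Sum>d\<in>dyadic j. \<Sum>r\<in>{1..Y}. \<Sum>s\<in>{1..Y}.
        if P d r \<and> P d s then of_real (b r * b s) * expi (real d * ((real r - real s) * \<alpha>)) else 0)"
    proof (intro sum.cong refl)
      fix d assume d: "d \<in> dyadic j"
      have "W d * cnj (W d) = (\<Sum>r\<in>{1..Y}. \<Sum>s\<in>{1..Y}. (if P d r then of_real (b r) * expi (real (d * r) * \<alpha>) else 0)
         * cnj (if P d s then of_real (b s) * expi (real (d * s) * \<alpha>) else 0))"
        unfolding W[OF d] cnj_sum by (rule sum_product)
      also have "\<dots> = (\<Sum>r\<in>{1..Y}. \<Sum>s\<in>{1..Y}.
        if P d r \<and> P d s then of_real (b r * b s) * expi (real d * ((real r - real s) * \<alpha>)) else 0)"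
      proof (intro sum.cong refl)
        fix r s
        have "expi (real (d * r) * \<alpha>) * cnj (expi (real (d * s) * \<alpha>)) = expi (real d * ((real r - real s) * \<alpha>))"
          unfolding expi_cnj expi_add[symmetric] by (simp add: algebra_simps)
        then show "(if P d r then of_real (b r) * expi (real (d * r) * \<alpha>) else 0)
            * cnj (if P d s then of_real (b s) * expi (real (d * s) * \<alpha>) else 0)
          = (if P d r \<and> P d s then of_real (b r * b s) * expi (real d * ((real r - real s) * \<alpha>)) else 0)"
          by (simp add: mult_ac)
      qed
      finally show "W d * cnj (W d) = (\<Sum>r\<in>{1..Y}. \<Sum>s\<in>{1..Y}.
        if P d r \<and> P d s then of_real (b r * b s) * expi (real d * ((real r - real s) * \<alpha>)) else 0)" .
    qed
    also have "\<dots> = (\<Sum>r\<in>{1..Y}. \<Sum>d\<in>dyadic j. \<Sum>s\<in>{1..Y}.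
        if P d r \<and> P d s then of_real (b r * b s) * expi (real d * ((real r - real s) * \<alpha>)) else 0)"
      by (rule sum.swap)
    also have "\<dots> = (\<Sum>r\<in>{1..Y}. \<Sum>s\<in>{1..Y}. \<Sum>d\<in>dyadic j.
        if P d r \<and> P d s then of_real (b r * b s) * expi (real d * ((real r - real s) * \<alpha>)) else 0)"
      by (intro sum.cong refl sum.swap)
    also have "\<dots> = (\<Sum>r\<in>{1..Y}. \<Sum>s\<in>{1..Y}. of_real (b r * b s) * (\<Sum>d\<in>I r s. expi (real d * ((real r - real s) * \<alpha>))))"
      unfolding I_def sum_distrib_left by (intro sum.cong refl sum.inter_filter[symmetric]) simp
    finally have e: "complex_of_real (\<Sum>d\<in>dyadic j. (norm (W d))\<^sup>2) = \<dots>" .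
    have "(\<Sum>d\<in>dyadic j. (norm (W d))\<^sup>2) = norm (complex_of_real (\<Sum>d\<in>dyadic j. (norm (W d))\<^sup>2))"
      unfolding norm_of_real by (intro abs_of_nonneg[symmetric] sum_nonneg) simp
    also have "\<dots> \<le> (\<Sum>r\<in>{1..Y}. \<Sum>s\<in>{1..Y}. L\<^sup>2 * (if r = s then 2 ^ j else G (nat \<bar>int r - int s\<bar>)))"
      unfolding e
    proof (rule order_trans[OF norm_sum sum_mono], rule order_trans[OF norm_sum sum_mono])
      fix r s assume rs: "r \<in> {1..Y}" "s \<in> {1..Y}"
      have "\<bar>b r * b s\<bar> \<le> L\<^sup>2" unfolding abs_mult power2_eq_square using bL[OF rs(1)] bL[OF rs(2)]
        by (intro mult_mono) auto
      then show "norm (of_real (b r * b s) * (\<Sum>d\<in>I r s. expi (real d * ((real r - real s) * \<alpha>))))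
        \<le> L\<^sup>2 * (if r = s then 2 ^ j else G (nat \<bar>int r - int s\<bar>))"
        unfolding norm_mult norm_of_real using K[OF rs] by (intro mult_mono) auto
    qed
    also have "\<dots> \<le> (\<Sum>r\<in>{1..Y}. L\<^sup>2 * (2 ^ j + 2 * B))"
    proof (rule sum_mono)
      fix r assume r: "r \<in> {1..Y}"
      have "(\<Sum>s\<in>{1..Y}. if r = s then 2 ^ j else G (nat \<bar>int r - int s\<bar>))
        = 2 ^ j + (\<Sum>s\<in>{1..Y} - {r}. if r = s then 2 ^ j else G (nat \<bar>int r - int s\<bar>))"
        using r by (subst sum.remove[of _ r]) auto
      also have "(\<Sum>s\<in>{1..Y} - {r}. if r = s then 2 ^ j else G (nat \<bar>int r - int s\<bar>)) = (\<Sum>s\<in>{1..Y} - {r}. G (nat \<bar>int r - int s\<bar>))"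
        by (intro sum.cong) auto
      finally have split: "(\<Sum>s\<in>{1..Y}. if r = s then 2 ^ j else G (nat \<bar>int r - int s\<bar>))
        = 2 ^ j + (\<Sum>s\<in>{1..Y} - {r}. G (nat \<bar>int r - int s\<bar>))" .
      have "(\<Sum>s\<in>{1..Y} - {r}. G (nat \<bar>int r - int s\<bar>)) \<le> 2 * (\<Sum>n=1..Y. G n)" using G0 r by (rule sum_abs_diff_le)
      moreover have "(\<Sum>n=1..Y. G n) \<le> B" using B unfolding G_def Y_def .
      ultimately have "(\<Sum>s\<in>{1..Y}. if r = s then 2 ^ j else G (nat \<bar>int r - int s\<bar>)) \<le> 2 ^ j + 2 * B"
        unfolding split by linarith
      then show "(\<Sum>s\<in>{1..Y}. L\<^sup>2 * (if r = s then 2 ^ j else G (nat \<bar>int r - int s\<bar>))) \<le> L\<^sup>2 * (2 ^ j + 2 * B)"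
        unfolding sum_distrib_left[symmetric] by (intro mult_left_mono) auto
    qed
    also have "\<dots> = real Y * (L\<^sup>2 * (2 ^ j + 2 * B))" by simp
    finally show ?thesis by (simp add: Y_def)
  qed
  then have W2: "(\<Sum>d\<in>dyadic j. (norm (W d))\<^sup>2) \<le> real Y * (L\<^sup>2 * (2 ^ j + 2 * B))" by (simp add: Y_def)
  have "norm (of_real (moebius_fun d) * W d) \<le> norm (W d)" for d
    unfolding norm_mult norm_of_real by (intro mult_left_le_one_le abs_moebius_fun_le) auto
  then have "norm (\<Sum>d\<in>dyadic j. of_real (moebius_fun d) * W d) \<le> (\<Sum>d\<in>dyadic j. norm (W d))"
    by (intro sum_norm_le)
  then have a: "(norm (\<Sum>d\<in>dyadic j. of_real (moebius_fun d) * W d))\<^sup>2 \<le> (\<Sum>d\<in>dyadic j. norm (W d))\<^sup>2"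
    by (intro power_mono) auto
  have b: "(\<Sum>d\<in>dyadic j. norm (W d))\<^sup>2 \<le> 2 ^ j * (\<Sum>d\<in>dyadic j. (norm (W d))\<^sup>2)"
    using Cauchy_Schwarz_ineq_sum[of "\<lambda>_. 1" "\<lambda>d. norm (W d)" "dyadic j"] cardj by simp
  have c: "2 ^ j * (\<Sum>d\<in>dyadic j. (norm (W d))\<^sup>2) \<le> 2 ^ j * (real Y * (L\<^sup>2 * (2 ^ j + 2 * B)))"
    using W2 by (intro mult_left_mono) auto
  have d: "2 ^ j * (real Y * (L\<^sup>2 * (2 ^ j + 2 * B))) = L\<^sup>2 * 2 ^ Suc i * (2 ^ j + 2 * B)"
  proof -
    have "real Y * 2 ^ j = 2 ^ Suc i" using Yj by (metis of_nat_mult of_nat_numeral of_nat_power)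
    then show ?thesis by (simp add: mult_ac)
  qed
  show ?thesis using order_trans[OF order_trans[OF a b] c] unfolding d unfolding W_def b_def L_def .
qed

lemma sum_dyadic_range:
  fixes f :: "nat \<Rightarrow> 'a::comm_monoid_add"
  assumes "u \<le> Suc i"
  shows "(\<Sum>k\<in>{2 ^ u<..2 ^ Suc i}. f k) = (\<Sum>j\<in>{u..i}. \<Sum>k\<in>dyadic j. f k)"
proof -
  have "(\<Sum>k\<in>{2 ^ u<..2 ^ (u + n)}. f k) = (\<Sum>j<n. \<Sum>k\<in>dyadic (u + j). f k)" for n
  proof (induction n)
    case (Suc n)
    have "{(2::nat) ^ u<..2 ^ (u + Suc n)} = {2 ^ u<..2 ^ (u + n)} \<union> dyadic (u + n)"
    proof -
      have "{k<..m} = {k<..l} \<union> {l<..m}" if "k \<le> l" "l \<le> m" for k l m :: nat using that by auto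
      from this[of "2 ^ u" "2 ^ (u + n)" "2 ^ Suc (u + n)"] show ?thesis
        unfolding dyadic_def add_Suc_right by (simp add: power_increasing)
    qed
    moreover have "sum f ({2 ^ u<..2 ^ (u + n)} \<union> dyadic (u + n)) = sum f {2 ^ u<..2 ^ (u + n)} + sum f (dyadic (u + n))"
      by (rule sum.union_disjoint) (auto simp: dyadic_def)
    ultimately show ?case using Suc by simp
  qed simp
  from this[of "Suc i - u"] have "(\<Sum>k\<in>{2 ^ u<..2 ^ Suc i}. f k) = (\<Sum>j<Suc i - u. \<Sum>k\<in>dyadic (u + j). f k)"
    using assms by simp
  also have "\<dots> = (\<Sum>j\<in>{u..i}. \<Sum>k\<in>dyadic j. f k)"
    by (rule sum.reindex_bij_witness[where i = "\<lambda>j. j - u" and j = "\<lambda>j. u + j"]) auto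
  finally show ?thesis .
qed

text \<open>Take U = V = 2^u. The part d <= U is of type I, where 3 u <= i + 1 gives U V <= 2^(i + 1
  - u); the blocks with u <= j <= i - u are of type II; beyond them the cofactor r is at most V and
  the coefficient vanishes. Thus only n <= 2^(i + 1 - u) enter, and these lie in the window.\<close>

lemma norm_mangoldt_expi_dyadic_le:
  assumes bad: "bad_window c Q Z \<alpha>" and c: "0 < c" "c \<le> 1" and u: "3 * u \<le> Suc i"
    and Q: "0 < Q" "Q \<le> 2 ^ (Suc i - u)" and Z: "2 ^ (Suc i - u) \<le> Z" and ui: "u \<le> i"
  defines "B \<equiv> spacing_bound c (2 ^ (Suc i - u))"
  shows "norm (\<Sum>n\<in>dyadic i. of_real (mangoldt n) * expi (real n * \<alpha>))
     \<le> 3 * ln (2 ^ Suc i) * B + real (Suc i) * sqrt ((ln (2 ^ Suc i))\<^sup>2 * 2 ^ Suc i * (2 ^ (i - u) + 2 * B))"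
proof -
  define U :: nat where "U = 2 ^ u"
  define Y :: nat where "Y = 2 ^ (Suc i - u)"
  define L where "L = ln ((2::real) ^ Suc i)"
  define T where "T d = of_real (moebius_fun d) *
      (\<Sum>r\<in>cofactors i d. of_real (mangoldt_above U r) * expi (real (d * r) * \<alpha>))" for d
  define R where "R = sqrt (L\<^sup>2 * 2 ^ Suc i * (2 ^ (i - u) + 2 * B))"
  have YZ: "real Y \<le> Z" using Z by (simp add: Y_def)
  have pos: "0 < dist_to_int (real n * \<alpha>)" if "1 \<le> n" "n \<le> Y" for n
  proof -
    have "real n \<le> Z" using of_nat_mono[OF that(2), where ?'a = real] YZ by linarith
    then have "c / max (real n) Q \<le> dist_to_int (real n * \<alpha>)" using that by (intro bad_windowD[OF bad])
    moreover have "0 < c / max (real n) Q" using c Q by (intro divide_pos_pos) auto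
    ultimately show ?thesis by linarith
  qed
  have sumB: "(\<Sum>n=1..X. 1 / dist_to_int (real n * \<alpha>)) \<le> B" if "X \<le> Y" for X
  proof -
    have "real X \<le> real Y" using that by (rule of_nat_mono)
    moreover have "real X \<le> Z" using calculation YZ by linarith
    ultimately show ?thesis unfolding B_def using Q by (intro sum_inverse_dist_le[OF bad c]) (auto simp: Y_def)
  qed
  have B0: "0 \<le> B" using sumB[of 0] by simp
  have UU: "U * U \<le> Y" unfolding U_def Y_def power_add[symmetric] using u by (intro power_increasing) auto
  have Y2: "Y \<le> 2 ^ Suc i" unfolding Y_def by (intro power_increasing) auto
  have U1: "1 \<le> U" by (simp add: U_def)
  have U2: "U \<le> 2 ^ Suc i" unfolding U_def using ui by (intro power_increasing) auto
  have S: "(\<Sum>n\<in>dyadic i. of_real (mangoldt n) * expi (real n * \<alpha>)) = (\<Sum>d\<in>{1..2 ^ Suc i}. T d)"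
  proof -
    have "(\<Sum>n\<in>dyadic i. of_real (mangoldt n) * expi (real n * \<alpha>))
      = (\<Sum>n\<in>dyadic i. \<Sum>d | d dvd n \<and> d \<le> 2 ^ Suc i. of_real (moebius_fun d * mangoldt_above U (n div d)) * expi (real (d * (n div d)) * \<alpha>))"
    proof (intro sum.cong refl)
      fix n assume n: "n \<in> dyadic i"
      have "U \<le> 2 ^ i" unfolding U_def using ui by (intro power_increasing) auto
      then have nU: "U < n" "1 \<le> n" "n \<le> 2 ^ Suc i" using n by (auto simp: dyadic_def)
      have "{d. d dvd n} = {d. d dvd n \<and> d \<le> 2 ^ Suc i}"
      proof (intro equalityI subsetI)
        fix d assume "d \<in> {d. d dvd n}"
        then have "d dvd n" "d \<le> n" using nU by (auto intro: dvd_imp_le)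
        then show "d \<in> {d. d dvd n \<and> d \<le> 2 ^ Suc i}" using nU by simp
      qed simp
      then have "mangoldt n = (\<Sum>d | d dvd n \<and> d \<le> 2 ^ Suc i. moebius_fun d * mangoldt_above U (n div d))"
        using mangoldt_convolution[OF nU(2,1)] by (simp only:)
      then have "of_real (mangoldt n) * expi (real n * \<alpha>)
        = (\<Sum>d | d dvd n \<and> d \<le> 2 ^ Suc i. of_real (moebius_fun d * mangoldt_above U (n div d)) * expi (real n * \<alpha>))"
        by (simp only: of_real_sum sum_distrib_right)
      also have "\<dots> = (\<Sum>d | d dvd n \<and> d \<le> 2 ^ Suc i. of_real (moebius_fun d * mangoldt_above U (n div d)) * expi (real (d * (n div d)) * \<alpha>))"
        by (intro sum.cong refl) auto
      finally show "of_real (mangoldt n) * expi (real n * \<alpha>)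
        = (\<Sum>d | d dvd n \<and> d \<le> 2 ^ Suc i. of_real (moebius_fun d * mangoldt_above U (n div d)) * expi (real (d * (n div d)) * \<alpha>))" .
    qed
    also have "\<dots> = (\<Sum>d\<in>{1..2 ^ Suc i}. \<Sum>r | d * r \<in> dyadic i. of_real (moebius_fun d * mangoldt_above U r) * expi (real (d * r) * \<alpha>))"
      by (rule sum_divisors_rearrange[where h = "\<lambda>d r. of_real (moebius_fun d * mangoldt_above U r) * expi (real (d * r) * \<alpha>)"])
        (simp_all add: dyadic_def)
    also have "\<dots> = (\<Sum>d\<in>{1..2 ^ Suc i}. T d)"
      unfolding T_def cofactors_def sum_distrib_left by (intro sum.cong refl) (simp add: mult.assoc)
    finally show ?thesis .
  qed
  have "{1..2 ^ Suc i} = {1..U} \<union> {U<..2 ^ Suc i}" using U1 U2 by auto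
  then have "(\<Sum>d\<in>{1..2 ^ Suc i}. T d) = (\<Sum>d\<in>{1..U} \<union> {U<..2 ^ Suc i}. T d)" by (simp only:)
  also have "\<dots> = (\<Sum>d\<in>{1..U}. T d) + (\<Sum>d\<in>{U<..2 ^ Suc i}. T d)"
    by (rule sum.union_disjoint) auto
  also have "(\<Sum>d\<in>{U<..2 ^ Suc i}. T d) = (\<Sum>j\<in>{u..i}. \<Sum>d\<in>dyadic j. T d)"
    unfolding U_def using ui by (intro sum_dyadic_range) simp
  finally have split: "(\<Sum>d\<in>{1..2 ^ Suc i}. T d) = (\<Sum>d\<in>{1..U}. T d) + (\<Sum>j\<in>{u..i}. \<Sum>d\<in>dyadic j. T d)" .
  have T1: "norm (\<Sum>d\<in>{1..U}. T d) \<le> 3 * L * B"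
    unfolding T_def L_def
  proof (rule norm_type_I_le)
    fix n assume "1 \<le> n" "n \<le> U * U" then show "0 < dist_to_int (real n * \<alpha>)" using pos UU by simp
  qed (use sumB[OF UU] U1 UU Y2 in auto)
  have R0: "0 \<le> R" unfolding R_def using B0 by simp
  have T2: "norm (\<Sum>d\<in>dyadic j. T d) \<le> R" if j: "j \<in> {u..i}" for j
  proof (cases "j \<le> i - u")
    case True
    have le: "2 ^ (Suc i - j) \<le> Y" unfolding Y_def using j by (intro power_increasing) auto
    have "(norm (\<Sum>d\<in>dyadic j. T d))\<^sup>2 \<le> L\<^sup>2 * 2 ^ Suc i * (2 ^ j + 2 * B)"
      unfolding T_def L_def
    proof (rule norm_type_II_le)
      fix n :: nat assume "1 \<le> n" "n \<le> 2 ^ (Suc i - j)" then show "0 < dist_to_int (real n * \<alpha>)" using pos le by simp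
    qed (use sumB[OF le] j in auto)
    also have "\<dots> \<le> L\<^sup>2 * 2 ^ Suc i * (2 ^ (i - u) + 2 * B)"
      using True by (intro mult_left_mono add_right_mono power_increasing) auto
    finally show ?thesis unfolding R_def by (rule real_le_rsqrt)
  next
    case False
    have "T d = 0" if d: "d \<in> dyadic j" for d
    proof -
      have "2 ^ (Suc i - u) \<le> (2::nat) ^ j" using False by (intro power_increasing) auto
      moreover have "2 ^ j < d" using d by (simp add: dyadic_def)
      ultimately have dl: "2 ^ (Suc i - u) < d" by linarith
      then have d1: "d \<ge> 1" by linarith
      have "mangoldt_above U r = 0" if r: "r \<in> cofactors i d" for r
      proof -
        have r1: "1 \<le> r" using cofactors_props(3)[OF d1 r] by simp
        have "d * r \<le> 2 ^ Suc i" using r by (simp add: cofactors_def dyadic_def)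
        also have "\<dots> = 2 ^ (Suc i - u) * U" unfolding U_def power_add[symmetric] using ui by simp
        also have "\<dots> \<le> d * U" using dl by (intro mult_le_mono1) simp
        finally have "r \<le> U" using d1 by simp
        then show ?thesis using r1 by (intro mangoldt_above_eq_0)
      qed
      then show ?thesis unfolding T_def by (simp add: sum.neutral)
    qed
    then show ?thesis using R0 by simp
  qed
  have "norm (\<Sum>j\<in>{u..i}. \<Sum>d\<in>dyadic j. T d) \<le> (\<Sum>j\<in>{u..i}. R)"
    by (rule sum_norm_le) (rule T2)
  also have "\<dots> = real (Suc i - u) * R" by simp
  also have "\<dots> \<le> real (Suc i) * R" using R0 by (intro mult_right_mono) auto
  finally have T3: "norm (\<Sum>j\<in>{u..i}. \<Sum>d\<in>dyadic j. T d) \<le> real (Suc i) * R" .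
  have "norm (\<Sum>n\<in>dyadic i. of_real (mangoldt n) * expi (real n * \<alpha>))
      \<le> norm (\<Sum>d\<in>{1..U}. T d) + norm (\<Sum>j\<in>{u..i}. \<Sum>d\<in>dyadic j. T d)"
    unfolding S split by (rule norm_triangle_ineq)
  also have "\<dots> \<le> 3 * L * B + real (Suc i) * R" using T1 T3 by (rule add_mono)
  finally show ?thesis unfolding R_def L_def .
qed

text \<open>With u = m the bound saves about 2^(-m / 2), which beats the powers of m coming from the
  logarithms. The lower end m (a + 1) of the range gives 2^(m a) <= 2^(i + 1 - m), and a >= 2 gives
  3 m <= i.\<close>

lemma norm_mangoldt_expi_dyadic_small:
  fixes c \<epsilon> :: real and a :: nat
  assumes c: "0 < c" "c \<le> 1" and a: "2 \<le> a" and \<epsilon>: "0 < \<epsilon>"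
  obtains M where "\<And>m i \<alpha>. M \<le> m \<Longrightarrow> m * (a + 1) \<le> i \<Longrightarrow> i < m * (a + 2) \<Longrightarrow>
    bad_window c (2 ^ (m * a)) (2 ^ (m * (a + 3))) \<alpha> \<Longrightarrow>
    norm (\<Sum>n\<in>dyadic i. of_real (mangoldt n) * expi (real n * \<alpha>)) \<le> \<epsilon> * 2 ^ i"
proof -
  define A where "A = real a + 2"
  define A' where "A' = A + 1 + 1 / c"
  define C1 where "C1 = 12 * A * A' / c"
  define C2 where "C2 = 2 * (1 + 8 * A' / c)"
  \<comment> \<open>The total bound divided by 2^i: the first term comes from type I, the second
    from type II.\<close>
  define g where "g m = C1 * (real m ^ 2 / 2 ^ m) + A\<^sup>2 * sqrt C2 * (real m ^ 2 * sqrt (real m / 2 ^ m))" for m :: nat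
  have A0: "A \<ge> 0" "A' \<ge> 1" using c by (auto simp: A_def A'_def)
  have C0: "C1 \<ge> 0" "C2 \<ge> 0" using A0 c by (auto simp: C1_def C2_def)
  have "(\<lambda>m. real m ^ 2 / 2 ^ m) \<longlonglongrightarrow> 0" by real_asymp
  moreover have "(\<lambda>m. real m ^ 2 * sqrt (real m / 2 ^ m)) \<longlonglongrightarrow> 0" by real_asymp
  ultimately have "g \<longlonglongrightarrow> C1 * 0 + A\<^sup>2 * sqrt C2 * 0" unfolding g_def by (intro tendsto_intros)
  then have "eventually (\<lambda>m. g m < \<epsilon>) sequentially" using \<epsilon> by (intro order_tendstoD(2)[where y = "C1 * 0 + A\<^sup>2 * sqrt C2 * 0"]) auto
  then obtain M0 where M0: "\<And>m. M0 \<le> m \<Longrightarrow> g m < \<epsilon>" unfolding eventually_sequentially by blast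
  show thesis
  proof (rule that[of "max 1 M0"])
    fix m i \<alpha>
    assume m: "max 1 M0 \<le> m" and i: "m * (a + 1) \<le> i" "i < m * (a + 2)"
      and bad: "bad_window c (2 ^ (m * a)) (2 ^ (m * (a + 3))) \<alpha>"
    have m1: "1 \<le> m" using m by simp
    have mi: "m \<le> i" "m * a + m \<le> i" using i by (simp_all add: algebra_simps)
    have m3: "3 * m \<le> Suc i"
    proof -
      have "m * 3 \<le> m * (a + 1)" using a by (intro mult_le_mono2) simp
      then show ?thesis using i by linarith
    qed
    define B where "B = spacing_bound c (2 ^ (Suc i - m))"
    define L where "L = ln ((2::real) ^ Suc i)"
    have main: "norm (\<Sum>n\<in>dyadic i. of_real (mangoldt n) * expi (real n * \<alpha>))
       \<le> 3 * L * B + real (Suc i) * sqrt (L\<^sup>2 * 2 ^ Suc i * (2 ^ (i - m) + 2 * B))"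
      unfolding B_def L_def
    proof (rule norm_mangoldt_expi_dyadic_le[OF bad c m3])
      show "(2::real) ^ (m * a) \<le> 2 ^ (Suc i - m)" using mi by (intro power_increasing) auto
      show "(2::real) ^ (Suc i - m) \<le> 2 ^ (m * (a + 3))"
      proof (intro power_increasing)
        have "m * (a + 2) \<le> m * (a + 3)" by (intro mult_le_mono2) simp
        then show "Suc i - m \<le> m * (a + 3)" using i by linarith
      qed simp
    qed (use mi in auto)
    have Si: "real (Suc i) \<le> real m * A"
    proof -
      have "Suc i \<le> m * (a + 2)" using i by simp
      then have "real (Suc i) \<le> real (m * (a + 2))" by (rule of_nat_mono)
      then show ?thesis by (simp add: A_def algebra_simps)
    qed
    have ln2: "ln (2::real) \<le> 1" using ln_le_minus_one[of 2] by simp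
    have L_le: "L \<le> real m * A"
    proof -
      have "L = real (Suc i) * ln 2" unfolding L_def by (rule ln_realpow)
      also have "\<dots> \<le> real (Suc i) * 1" using ln2 by (intro mult_left_mono) auto
      finally show ?thesis using Si by simp
    qed
    have L0: "0 \<le> L" unfolding L_def by (simp add: ln_realpow del: power_Suc)
    define Y where "Y = (2::real) ^ (Suc i - m)"
    define N where "N = (2::real) ^ i"
    define q where "q = 1 / (2::real) ^ m"
    have q0: "0 < q" by (simp add: q_def)
    have N0: "0 < N" by (simp add: N_def)
    have Yq: "Y = 2 * N * q"
    proof -
      have "Y * 2 ^ m = 2 ^ Suc i" unfolding Y_def power_add[symmetric] using mi by simp
      then show ?thesis by (simp add: N_def q_def field_simps)
    qed
    have iq: "(2::real) ^ (i - m) = N * q"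
    proof -
      have "(2::real) ^ (i - m) * 2 ^ m = 2 ^ i" unfolding power_add[symmetric] using mi by simp
      then show ?thesis by (simp add: N_def q_def field_simps)
    qed
    have lnY: "1 + ln (Y / c) \<le> real m * A'"
    proof -
      have "Y \<le> 2 ^ Suc i" unfolding Y_def by (intro power_increasing) auto
      then have "ln Y \<le> L" unfolding L_def Y_def by (subst ln_le_cancel_iff) auto
      moreover have "ln (Y / c) = ln Y + ln (1 / c)" using c by (simp add: Y_def ln_div)
      moreover have "ln (1 / c) \<le> 1 / c - 1" using c by (intro ln_le_minus_one) auto
      ultimately have "1 + ln (Y / c) \<le> real m * A + 1 / c" using L_le by linarith
      moreover have "D + 1 \<le> real m * (D + 1)" if "D \<ge> 0" for D
        using mult_right_mono[of 1 "real m" "D + 1"] m1 that by simp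
      from this[of "1 / c"] have "1 / c + 1 \<le> real m * (1 / c + 1)" using c by simp
      moreover have "real m * A' = real m * A + real m * (1 / c + 1)" by (simp add: A'_def distrib_left)
      ultimately show ?thesis by argo
    qed
    have Bq: "B \<le> 4 * N * q * real m * A' / c"
    proof -
      have "B = 2 * (Y / c) * (1 + ln (Y / c))" by (simp add: B_def spacing_bound_def Y_def)
      also have "\<dots> \<le> 2 * (Y / c) * (real m * A')" using lnY c by (intro mult_left_mono) (auto simp: Y_def)
      finally show ?thesis unfolding Yq by simp
    qed
    have t1: "3 * L * B \<le> N * (C1 * (real m ^ 2 * q))"
    proof -
      have "3 * L * B \<le> 3 * L * (4 * N * q * real m * A' / c)" using Bq L0 by (intro mult_left_mono) auto
      also have "\<dots> \<le> 3 * (real m * A) * (4 * N * q * real m * A' / c)"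
        using L_le A0 c q0 N0 by (intro mult_right_mono mult_left_mono) auto
      also have "\<dots> = N * (C1 * (real m ^ 2 * q))" by (simp add: C1_def power2_eq_square)
      finally show ?thesis .
    qed
    have t2: "sqrt (L\<^sup>2 * 2 ^ Suc i * (2 ^ (i - m) + 2 * B)) \<le> real m * A * N * (sqrt C2 * sqrt (real m * q))"
    proof -
      have "2 ^ (i - m) + 2 * B \<le> N * q * (real m * (1 + 8 * A' / c))"
      proof -
        have "N * q * 1 \<le> N * q * real m" using N0 q0 m1 by (intro mult_left_mono) auto
        moreover have "N * q * (real m * (1 + 8 * A' / c)) = N * q * real m + 2 * (4 * N * q * real m * A' / c)"
          by (simp add: algebra_simps)
        ultimately show ?thesis using Bq unfolding iq by linarith
      qed
      then have "L\<^sup>2 * 2 ^ Suc i * (2 ^ (i - m) + 2 * B) \<le> L\<^sup>2 * 2 ^ Suc i * (N * q * (real m * (1 + 8 * A' / c)))"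
        by (intro mult_left_mono) auto
      also have "\<dots> = L\<^sup>2 * N\<^sup>2 * (C2 * (real m * q))" by (simp add: C2_def N_def power2_eq_square)
      also have "\<dots> \<le> (real m * A)\<^sup>2 * N\<^sup>2 * (C2 * (real m * q))"
        using L_le L0 C0 q0 by (intro mult_right_mono power_mono) auto
      finally have "sqrt (L\<^sup>2 * 2 ^ Suc i * (2 ^ (i - m) + 2 * B)) \<le> sqrt ((real m * A)\<^sup>2 * N\<^sup>2 * (C2 * (real m * q)))"
        by (rule real_sqrt_le_mono)
      also have "\<dots> = real m * A * N * (sqrt C2 * sqrt (real m * q))"
        using A0 N0 by (simp add: real_sqrt_mult)
      finally show ?thesis .
    qed
    have "real (Suc i) * sqrt (L\<^sup>2 * 2 ^ Suc i * (2 ^ (i - m) + 2 * B))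
        \<le> (real m * A) * (real m * A * N * (sqrt C2 * sqrt (real m * q)))"
    proof (rule mult_mono[OF Si t2])
      have "1 \<le> Y" by (simp add: Y_def)
      then have "1 \<le> Y / c" using c by (simp add: pos_le_divide_eq)
      then have "0 \<le> 2 * (Y / c) * (1 + ln (Y / c))"
        by (intro mult_nonneg_nonneg add_nonneg_nonneg ln_ge_zero) auto
      then have "0 \<le> B" by (simp only: B_def spacing_bound_def Y_def)
      then show "0 \<le> sqrt (L\<^sup>2 * 2 ^ Suc i * (2 ^ (i - m) + 2 * B))"
        by (intro real_sqrt_ge_zero mult_nonneg_nonneg add_nonneg_nonneg) auto
    qed (use A0 in simp)
    also have "\<dots> = N * (A\<^sup>2 * sqrt C2 * (real m ^ 2 * sqrt (real m * q)))" by (simp add: power2_eq_square)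
    finally have "norm (\<Sum>n\<in>dyadic i. of_real (mangoldt n) * expi (real n * \<alpha>)) \<le> N * g m"
      using main t1 by (simp add: g_def q_def distrib_left)
    also have "\<dots> \<le> N * \<epsilon>" using M0[of m] m N0 by (intro mult_left_mono) auto
    finally show "norm (\<Sum>n\<in>dyadic i. of_real (mangoldt n) * expi (real n * \<alpha>)) \<le> \<epsilon> * 2 ^ i"
      by (simp add: N_def mult.commute)
  qed
qed

section \<open>Close pairs of prime multiples\<close>

definition dyadic_primes :: "nat \<Rightarrow> nat set" where
  "dyadic_primes i = {p \<in> dyadic i. prime p}"

lemma finite_dyadic_primes [simp]: "finite (dyadic_primes i)"
  by (simp add: dyadic_primes_def)

definition close_pairs :: "real \<Rightarrow> nat \<Rightarrow> nat \<Rightarrow> real \<Rightarrow> (nat \<times> nat) set" where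
  "close_pairs \<beta> i i' Y = {(p, q) \<in> dyadic_primes i \<times> dyadic_primes i'. p < q \<and> dist_to_int ((real q - real p) * \<beta>) < Y}"

text \<open>A pair is determined by n = q - p and p. The distance condition concerns n alone, and
  for each n the sieve bounds the number of p by a multiple of \<open>inv_divisor_sum n\<close>;
  summing over n is \<open>sum_inv_divisor_sum_bohr_le\<close>.\<close>

lemma card_close_pairs_le:
  assumes bad: "bad_window c Q Z \<beta>" and "0 < c" "0 < Q" "1 \<le> i" "0 < Y" "2 ^ Suc i' \<le> Z" "2 * Y * Q \<le> c"
  shows "real (card (close_pairs \<beta> i i' Y)) \<le> 40000 * 2 ^ i / (real i)\<^sup>2 *
    (36 * (1 + 1 / (2 * sqrt c)) * 2 ^ Suc i' * Y + sqrt (2 ^ Suc i' * Y / c) * (1 + ln (2 ^ Suc i')))"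
proof -
  define S where "S = {n. 1 \<le> n \<and> n \<le> 2 ^ Suc i' \<and> dist_to_int (real n * \<beta>) < Y}"
  define T where "T n = {p::nat. 2 ^ i < p \<and> p \<le> 2 ^ i + 2 ^ i \<and> prime p \<and> prime (p + n)}" for n :: nat
  have finS: "finite S" unfolding S_def by (rule finite_subset[of _ "{..2 ^ Suc i'}"]) auto
  have finT: "finite (T n)" for n unfolding T_def by (rule finite_subset[of _ "{..2 ^ i + 2 ^ i}"]) auto
  define j where "j = (\<lambda>(p, q). (q - p, p) :: nat \<times> nat)"
  have inj: "inj_on j (close_pairs \<beta> i i' Y)"
    by (rule inj_onI) (auto simp: j_def close_pairs_def)
  have sub: "j ` close_pairs \<beta> i i' Y \<subseteq> (SIGMA n:S. T n)"
  proof
    fix z assume "z \<in> j ` close_pairs \<beta> i i' Y"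
    then obtain p q where z: "z = (q - p, p)" and p: "p \<in> dyadic_primes i" and q: "q \<in> dyadic_primes i'"
      and pq: "p < q" "dist_to_int ((real q - real p) * \<beta>) < Y"
      by (auto simp: j_def close_pairs_def)
    have "q \<le> 2 ^ Suc i'" using q by (simp add: dyadic_primes_def dyadic_def)
    then have "1 \<le> q - p" "q - p \<le> 2 ^ Suc i'" using pq by linarith+
    then have "q - p \<in> S" using pq by (simp add: S_def of_nat_diff del: power_Suc)
    moreover have "p \<in> T (q - p)" using p q pq by (simp add: T_def dyadic_primes_def dyadic_def)
    ultimately show "z \<in> (SIGMA n:S. T n)" using z by simp
  qed
  have "card (close_pairs \<beta> i i' Y) = card (j ` close_pairs \<beta> i i' Y)" using inj by (simp add: card_image)
  also have "\<dots> \<le> card (SIGMA n:S. T n)" using sub finS finT by (intro card_mono finite_SigmaI)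
  also have "card (SIGMA n:S. T n) = (\<Sum>n\<in>S. card (T n))" using finS finT by (intro card_SigmaI) auto
  finally have "real (card (close_pairs \<beta> i i' Y)) \<le> real (\<Sum>n\<in>S. card (T n))" by (rule of_nat_mono)
  also have "\<dots> = (\<Sum>n\<in>S. real (card (T n)))" by (rule of_nat_sum)
  also have "\<dots> \<le> (\<Sum>n\<in>S. 40000 * 2 ^ i / (real i)\<^sup>2 * inv_divisor_sum n)"
    unfolding T_def using assms by (intro sum_mono card_twin_primes_dyadic_le) (auto simp: S_def)
  also have "\<dots> = 40000 * 2 ^ i / (real i)\<^sup>2 * (\<Sum>n\<in>S. inv_divisor_sum n)" by (simp only: sum_distrib_left)
  also have "\<dots> \<le> 40000 * 2 ^ i / (real i)\<^sup>2 *
    (36 * (1 + 1 / (2 * sqrt c)) * real (2 ^ Suc i') * Y + sqrt (real (2 ^ Suc i') * Y / c) * (1 + ln (real (2 ^ Suc i'))))"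
    unfolding S_def using assms by (intro mult_left_mono sum_inv_divisor_sum_bohr_le[OF bad]) auto
  finally show ?thesis by simp
qed

definition window_blocks :: "nat \<Rightarrow> nat \<Rightarrow> nat set" where
  "window_blocks a m = {m * (a + 1)..<m * (a + 2)}"

lemma card_window_blocks [simp]: "card (window_blocks a m) = m"
  by (simp add: window_blocks_def)

lemma finite_window_blocks [simp]: "finite (window_blocks a m)"
  by (simp add: window_blocks_def)

lemma geometric_sqrt_half_le:
  assumes "finite A"
  shows "(\<Sum>k\<in>A. 1 / sqrt (2 ^ k)) \<le> (4::real)"
proof -
  define x where "x = 1 / sqrt (2::real)"
  have x: "0 \<le> x" "x \<le> 3 / 4"
  proof -
    have "sqrt ((4 / 3)\<^sup>2) \<le> sqrt (2::real)" by (intro real_sqrt_le_mono) (simp add: power2_eq_square)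
    then have "4 / 3 \<le> sqrt (2::real)" by simp
    then show "0 \<le> x" "x \<le> 3 / 4" unfolding x_def by (auto simp: field_simps)
  qed
  have "(\<Sum>k\<in>A. 1 / sqrt (2 ^ k)) = (\<Sum>k\<in>A. x ^ k)"
    by (intro sum.cong refl) (simp add: x_def power_one_over real_sqrt_power)
  also have "\<dots> \<le> (\<Sum>k. x ^ k)" using x assms by (intro sum_le_suminf summable_geometric) auto
  also have "\<dots> = 1 / (1 - x)" using x by (intro suminf_geometric) auto
  also have "\<dots> \<le> 4" using x by (simp add: pos_divide_le_eq)
  finally show ?thesis .
qed

text \<open>For each pair of blocks the sieve supplies a factor of order 1 / m^2. The main term is
  then summed over at most m^2 pairs. The collinear term carries an extra logarithm M of order m but
  decays like 2^(-(i' - i) / 2), so only about m pairs count. Both totals are bounded independently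
  of m.\<close>

lemma sum_close_pairs_le:
  fixes c \<epsilon> :: real and a m :: nat
  assumes bad: "bad_window c (2 ^ (m * a)) (2 ^ (m * (a + 4))) \<beta>" and c: "0 < c" and \<epsilon>: "0 < \<epsilon>" "2 * \<epsilon> \<le> c" and m: "1 \<le> m"
  shows "(\<Sum>i\<in>window_blocks a m. \<Sum>i'\<in>window_blocks a m. if i \<le> i' then \<epsilon> / 2 ^ i' * real (card (close_pairs \<beta> i i' (\<epsilon> / 2 ^ i))) else 0)
    \<le> 40000 * \<epsilon> * (72 * (1 + 1 / (2 * sqrt c)) * \<epsilon> + 4 * sqrt (2 * \<epsilon> / c) * (real a + 3))"
proof -
  let ?W = "window_blocks a m"
  define D where "D = 72 * (1 + 1 / (2 * sqrt c)) * \<epsilon>"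
  define E where "E = sqrt (2 * \<epsilon> / c)"
  define M where "M = 1 + real m * (real a + 2)"
  have D0: "D \<ge> 0" "E \<ge> 0" using c \<epsilon> by (auto simp: D_def E_def)
  have M0: "M \<ge> 1" by (simp add: M_def)
  have ln2: "ln (2::real) \<le> 1" using ln_le_minus_one[of 2] by simp
  have one: "\<epsilon> / 2 ^ i' * real (card (close_pairs \<beta> i i' (\<epsilon> / 2 ^ i))) \<le> 40000 * \<epsilon> / (real m)\<^sup>2 * (D + E * M * (1 / sqrt (2 ^ (i' - i))))"
    if i: "i \<in> ?W" and i': "i' \<in> ?W" and ii: "i \<le> i'" for i i'
  proof -
    have i_ge: "m * a + m \<le> i" using i by (simp add: window_blocks_def algebra_simps)
    have i'_le: "Suc i' \<le> m * (a + 2)" using i' by (simp add: window_blocks_def)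
    have mi: "m \<le> i" using i_ge by simp
    have cnt: "real (card (close_pairs \<beta> i i' (\<epsilon> / 2 ^ i))) \<le> 40000 * 2 ^ i / (real i)\<^sup>2 *
      (36 * (1 + 1 / (2 * sqrt c)) * 2 ^ Suc i' * (\<epsilon> / 2 ^ i) + sqrt (2 ^ Suc i' * (\<epsilon> / 2 ^ i) / c) * (1 + ln (2 ^ Suc i')))"
    proof (rule card_close_pairs_le[OF bad c])
      show "(2::real) ^ Suc i' \<le> 2 ^ (m * (a + 4))"
      proof (rule power_increasing)
        have "m * (a + 2) \<le> m * (a + 4)" by (intro mult_le_mono2) simp
        then show "Suc i' \<le> m * (a + 4)" using i'_le by linarith
      qed simp
      \<comment> \<open>The primes lie above Q = 2^(m a), so 2 \<epsilon> <= c yields the smallness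
        condition on Y Q.\<close>
      have "(2::real) ^ (m * a) \<le> 2 ^ i" using i_ge by (intro power_increasing) auto
      then have "2 * \<epsilon> * 2 ^ (m * a) \<le> c * 2 ^ i" using \<epsilon> c by (intro mult_mono) auto
      then show "2 * (\<epsilon> / 2 ^ i) * 2 ^ (m * a) \<le> c" by (simp add: pos_divide_le_eq)
    qed (use mi m \<epsilon> in auto)
    define k where "k = i' - i"
    have pk: "(2::real) ^ i' = 2 ^ i * 2 ^ k" unfolding k_def power_add[symmetric] using ii by simp
    have "36 * (1 + 1 / (2 * sqrt c)) * 2 ^ Suc i' * (\<epsilon> / 2 ^ i) = D * 2 ^ k" by (simp add: D_def pk)
    moreover have "sqrt (2 ^ Suc i' * (\<epsilon> / 2 ^ i) / c) = E * sqrt (2 ^ k)"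
      unfolding E_def real_sqrt_mult[symmetric] by (simp add: pk)
    moreover have "1 + ln (2 ^ Suc i') \<le> M"
    proof -
      have "ln ((2::real) ^ Suc i') = real (Suc i') * ln 2" by (rule ln_realpow)
      also have "\<dots> \<le> real (Suc i') * 1" using ln2 by (intro mult_left_mono) auto
      also have "\<dots> \<le> real (m * (a + 2))" using of_nat_mono[OF i'_le, where ?'a = real] by simp
      finally show ?thesis by (simp add: M_def algebra_simps)
    qed
    ultimately have "real (card (close_pairs \<beta> i i' (\<epsilon> / 2 ^ i))) \<le> 40000 * 2 ^ i / (real i)\<^sup>2 * (D * 2 ^ k + E * sqrt (2 ^ k) * (1 + ln (2 ^ Suc i')))"
      using cnt by (simp only:)
    also have "\<dots> \<le> 40000 * 2 ^ i / (real m)\<^sup>2 * (D * 2 ^ k + E * sqrt (2 ^ k) * M)"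
    proof (rule mult_mono)
      show "40000 * 2 ^ i / (real i)\<^sup>2 \<le> 40000 * 2 ^ i / (real m)\<^sup>2"
        using mi m by (intro divide_left_mono power_mono mult_pos_pos) auto
      show "D * 2 ^ k + E * sqrt (2 ^ k) * (1 + ln (2 ^ Suc i')) \<le> D * 2 ^ k + E * sqrt (2 ^ k) * M"
        using \<open>1 + ln (2 ^ Suc i') \<le> M\<close> D0 by (intro add_left_mono mult_left_mono) auto
      have "0 \<le> ln ((2::real) ^ Suc i')" by (intro ln_ge_zero one_le_power) simp
      then show "0 \<le> D * 2 ^ k + E * sqrt (2 ^ k) * (1 + ln (2 ^ Suc i'))"
        using D0 by (intro add_nonneg_nonneg mult_nonneg_nonneg) auto
    qed simp
    finally have "\<epsilon> / 2 ^ i' * real (card (close_pairs \<beta> i i' (\<epsilon> / 2 ^ i))) \<le> \<epsilon> / 2 ^ i' * (40000 * 2 ^ i / (real m)\<^sup>2 * (D * 2 ^ k + E * sqrt (2 ^ k) * M))"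
      using \<epsilon> by (intro mult_left_mono) auto
    also have "\<dots> = 40000 * \<epsilon> / (real m)\<^sup>2 * (D + E * M * (sqrt (2 ^ k) / 2 ^ k))"
    proof -
      have "\<epsilon> / (N * x) * (40000 * N / z * (D * x + E * y * M)) = 40000 * \<epsilon> / z * (D + E * M * (y / x))"
        if "N > 0" "x > 0" for N x y z :: real
      proof -
        have "(D * x + E * y * M) / x = D + E * M * (y / x)" using that by (simp add: add_divide_distrib)
        moreover have "\<epsilon> / (N * x) * (40000 * N / z * V) = 40000 * \<epsilon> / z * (V / x)" for V using that by (simp add: mult.commute mult.left_commute)
        ultimately show ?thesis by (simp only:)
      qed
      then show ?thesis unfolding pk by this simp_all
    qed
    also have "sqrt (2 ^ k) / 2 ^ k = 1 / sqrt ((2::real) ^ k)"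
      using sqrt_divide_self_eq[of "2 ^ k"] by (simp add: inverse_eq_divide)
    finally show ?thesis unfolding k_def .
  qed
  have "(\<Sum>i\<in>?W. \<Sum>i'\<in>?W. if i \<le> i' then \<epsilon> / 2 ^ i' * real (card (close_pairs \<beta> i i' (\<epsilon> / 2 ^ i))) else 0)
     \<le> (\<Sum>i\<in>?W. 40000 * \<epsilon> / (real m)\<^sup>2 * (D * real m + E * M * 4))"
  proof (rule sum_mono)
    fix i assume i: "i \<in> ?W"
    have "(\<Sum>i'\<in>?W. if i \<le> i' then \<epsilon> / 2 ^ i' * real (card (close_pairs \<beta> i i' (\<epsilon> / 2 ^ i))) else 0)
       = (\<Sum>i'\<in>{i'\<in>?W. i \<le> i'}. \<epsilon> / 2 ^ i' * real (card (close_pairs \<beta> i i' (\<epsilon> / 2 ^ i))))"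
      by (rule sum.inter_filter[symmetric]) simp
    also have "\<dots> \<le> (\<Sum>i'\<in>{i'\<in>?W. i \<le> i'}. 40000 * \<epsilon> / (real m)\<^sup>2 * (D + E * M * (1 / sqrt (2 ^ (i' - i)))))"
      using one[OF i] by (intro sum_mono) auto
    also have "\<dots> = 40000 * \<epsilon> / (real m)\<^sup>2 * (D * real (card {i'\<in>?W. i \<le> i'}) + E * M * (\<Sum>i'\<in>{i'\<in>?W. i \<le> i'}. 1 / sqrt (2 ^ (i' - i))))"
      unfolding sum_distrib_left[symmetric] sum.distrib by simp
    also have "\<dots> \<le> 40000 * \<epsilon> / (real m)\<^sup>2 * (D * real m + E * M * 4)"
    proof (intro mult_left_mono add_mono)
      have "card {i'\<in>?W. i \<le> i'} \<le> card ?W" by (intro card_mono) auto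
      then show "real (card {i'\<in>?W. i \<le> i'}) \<le> real m" by simp
      have "(\<Sum>i'\<in>{i'\<in>?W. i \<le> i'}. 1 / sqrt (2 ^ (i' - i))) = (\<Sum>k\<in>(\<lambda>i'. i' - i) ` {i'\<in>?W. i \<le> i'}. 1 / sqrt (2 ^ k))"
        by (subst sum.reindex) (auto intro: inj_onI)
      also have "\<dots> \<le> 4" by (rule geometric_sqrt_half_le) simp
      finally show "(\<Sum>i'\<in>{i'\<in>?W. i \<le> i'}. 1 / sqrt (2 ^ (i' - i))) \<le> 4" .
    qed (use D0 M0 \<epsilon> in auto)
    finally show "(\<Sum>i'\<in>?W. if i \<le> i' then \<epsilon> / 2 ^ i' * real (card (close_pairs \<beta> i i' (\<epsilon> / 2 ^ i))) else 0)
       \<le> 40000 * \<epsilon> / (real m)\<^sup>2 * (D * real m + E * M * 4)" .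
  qed
  also have "\<dots> = 40000 * \<epsilon> * (D + 4 * E * (M / real m))"
    using m by (simp add: field_simps power2_eq_square)
  also have "\<dots> \<le> 40000 * \<epsilon> * (D + 4 * E * (real a + 3))"
  proof (intro mult_left_mono add_left_mono)
    have "M \<le> (real a + 3) * real m" using m by (simp add: M_def algebra_simps)
    then show "M / real m \<le> real a + 3" using m by (simp add: pos_divide_le_eq)
  qed (use D0 \<epsilon> in auto)
  finally show ?thesis unfolding D_def E_def .
qed

section \<open>Arcs and trigonometric polynomials\<close>

lemma dist_to_int_less_iff:
  assumes "\<bar>z\<bar> < 1" "0 < r" "r \<le> 1 / 2"
  shows "dist_to_int z < r \<longleftrightarrow> \<bar>z\<bar> < r \<or> 1 - r < \<bar>z\<bar>"
proof
  assume l: "dist_to_int z < r"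
  obtain k where k: "dist_to_int z = \<bar>z - of_int k\<bar>" using dist_to_int_attained by blast
  then have "\<bar>real_of_int k\<bar> < 2" using l assms by linarith
  then have "\<bar>k\<bar> < 2" by linarith
  then have "k = -1 \<or> k = 0 \<or> k = 1" by linarith
  then show "\<bar>z\<bar> < r \<or> 1 - r < \<bar>z\<bar>" using l k by auto
next
  assume "\<bar>z\<bar> < r \<or> 1 - r < \<bar>z\<bar>"
  then show "dist_to_int z < r"
    using dist_to_int_le[of z 0] dist_to_int_le[of z 1] dist_to_int_le[of z "-1"] assms by auto
qed

text \<open>The arc is cut to the fundamental domain [0, 1), so near an endpoint it consists of two
  pieces.\<close>

definition circle_arc :: "real \<Rightarrow> real \<Rightarrow> real set" where
  "circle_arc y r = {x \<in> {0..<1}. dist_to_int (x - y) < r}"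

lemma circle_arc_subset: "circle_arc y r \<subseteq> {0..<1}"
  by (auto simp: circle_arc_def)

lemma continuous_dist_to_int: "continuous_on A (\<lambda>x. dist_to_int (x - y))"
  unfolding dist_to_int_def by (intro continuous_intros)

lemma sets_circle_arc [measurable]: "circle_arc y r \<in> sets borel"
proof -
  have "open {x. dist_to_int (x - y) < r}"
    by (intro open_Collect_less continuous_dist_to_int continuous_intros)
  moreover have "circle_arc y r = {0..<1} \<inter> {x. dist_to_int (x - y) < r}" by (auto simp: circle_arc_def)
  ultimately show ?thesis by simp
qed

lemma fmeasurable_subset_unit:
  assumes "A \<in> sets borel" "A \<subseteq> {0..<1::real}"
  shows "A \<in> fmeasurable lborel"
proof (rule fmeasurableI2)
  show "{0..<1::real} \<in> fmeasurable lborel" by (intro fmeasurableI) simp_all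
qed (use assms in auto)

lemma measure_circle_arc:
  assumes "0 < r" "r \<le> 1 / 2"
  shows "measure lborel (circle_arc y r) = 2 * r"
proof -
  define t where "t = frac y"
  have t: "0 \<le> t" "t < 1" by (simp_all add: t_def frac_lt_1)
  have "dist_to_int (x - y) = dist_to_int (x - t)" for x
  proof -
    have "x - y = (x - t) + of_int (- \<lfloor>y\<rfloor>)" by (simp add: t_def frac_def)
    then show ?thesis by (simp only: dist_to_int_add_int)
  qed
  then have arc: "circle_arc y r = {x \<in> {0..<1}. \<bar>x - t\<bar> < r \<or> 1 - r < \<bar>x - t\<bar>}"
    unfolding circle_arc_def using t assms by (auto simp: dist_to_int_less_iff abs_less_iff)
  have m2: "measure lborel (A \<union> B) = measure lborel A + measure lborel B"
    if "A \<inter> B = {}" "A \<in> sets borel" "B \<in> sets borel" "A \<subseteq> {0..<1}" "B \<subseteq> {0..<1}" for A B :: "real set"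
    using that fmeasurable_subset_unit[of A] fmeasurable_subset_unit[of B]
    by (intro measure_Union) (auto dest: fmeasurableD2)
  \<comment> \<open>The arc crosses the left endpoint, stays inside, or crosses the right
    endpoint.\<close>
  consider "t < r" | "r \<le> t" "t \<le> 1 - r" | "1 - r < t" by linarith
  then show ?thesis
  proof cases
    case 1
    then have "circle_arc y r = {0..<t + r} \<union> {t + 1 - r<..<1}" unfolding arc using t assms by (auto simp: abs_if)
    moreover have "measure lborel ({0..<t + r} \<union> {t + 1 - r<..<1}) = measure lborel {0..<t + r} + measure lborel {t + 1 - r<..<1}"
      by (rule m2) (use 1 t assms in auto)
    ultimately show ?thesis using 1 t assms by simp
  next
    case 2
    then have "circle_arc y r = {t - r<..<t + r}" unfolding arc using t assms by (auto simp: abs_if)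
    then show ?thesis using assms by simp
  next
    case 3
    then have "circle_arc y r = {0..<t - 1 + r} \<union> {t - r<..<1}" unfolding arc using t assms by (auto simp: abs_if)
    moreover have "measure lborel ({0..<t - 1 + r} \<union> {t - r<..<1}) = measure lborel {0..<t - 1 + r} + measure lborel {t - r<..<1}"
      by (rule m2) (use 3 t assms in auto)
    ultimately show ?thesis using 3 t assms by simp
  qed
qed

text \<open>Cauchy-Schwarz for \<open>\<Sum>s. w s * indicator (E s)\<close> and the indicator of \<open>V\<close>, in the form
  \<open>2 F v \<le> t F\<^sup>2 + v\<^sup>2 / t\<close>.\<close>

lemma weighted_measure_le:
  fixes E :: "'s \<Rightarrow> real set" and w :: "'s \<Rightarrow> real"
  assumes "finite S" and E: "\<And>s. s \<in> S \<Longrightarrow> E s \<in> fmeasurable lborel" and V: "V \<in> fmeasurable lborel" and t: "0 < t"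
  shows "(\<Sum>s\<in>S. w s * measure lborel (E s \<inter> V))
    \<le> (t * (\<Sum>s\<in>S. \<Sum>s'\<in>S. w s * w s' * measure lborel (E s \<inter> E s')) + measure lborel V / t) / 2"
proof -
  define F where "F x = (\<Sum>s\<in>S. w s * indicator (E s) x)" for x :: real
  have int1: "integrable lborel (\<lambda>x. w s * indicator (E s \<inter> V) x :: real)" if "s \<in> S" for s
    using fmeasurable_Int_fmeasurable[OF E[OF that] fmeasurableD[OF V]]
    by (intro integrable_mult_right integrable_real_indicator) (auto simp: fmeasurable_def)
  have int2: "integrable lborel (\<lambda>x. w s * w s' * indicator (E s \<inter> E s') x :: real)" if "s \<in> S" "s' \<in> S" for s s'
    using fmeasurable_Int_fmeasurable[OF E[OF that(1)] fmeasurableD[OF E[OF that(2)]]]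
    by (intro integrable_mult_right integrable_real_indicator) (auto simp: fmeasurable_def)
  have intV: "integrable lborel (indicator V :: real \<Rightarrow> real)"
    using V by (intro integrable_real_indicator) (auto simp: fmeasurable_def)
  have e1: "(\<Sum>s\<in>S. w s * indicator (E s \<inter> V) x) = F x * indicator V x" for x
    unfolding F_def sum_distrib_right by (intro sum.cong refl) (simp add: indicator_inter_arith)
  have e2: "(\<Sum>s\<in>S. \<Sum>s'\<in>S. w s * w s' * indicator (E s \<inter> E s') x) = F x * F x" for x
    unfolding F_def sum_product by (intro sum.cong refl) (simp add: indicator_inter_arith)
  have "(\<Sum>s\<in>S. w s * measure lborel (E s \<inter> V)) = (\<integral>x. (\<Sum>s\<in>S. w s * indicator (E s \<inter> V) x) \<partial>lborel)"
    using int1 by (subst Bochner_Integration.integral_sum) auto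
  also have "\<dots> \<le> (\<integral>x. (t * (\<Sum>s\<in>S. \<Sum>s'\<in>S. w s * w s' * indicator (E s \<inter> E s') x) + indicator V x / t) / 2 \<partial>lborel)"
  proof (rule integral_mono)
    show "integrable lborel (\<lambda>x. \<Sum>s\<in>S. w s * indicator (E s \<inter> V) x :: real)"
      using int1 by (intro Bochner_Integration.integrable_sum)
    show "integrable lborel (\<lambda>x. (t * (\<Sum>s\<in>S. \<Sum>s'\<in>S. w s * w s' * indicator (E s \<inter> E s') x) + indicator V x / t) / 2 :: real)"
    proof -
      have "integrable lborel (\<lambda>x. \<Sum>s\<in>S. \<Sum>s'\<in>S. w s * w s' * indicator (E s \<inter> E s') x :: real)"
        by (intro Bochner_Integration.integrable_sum int2)
      then show ?thesis
        by (intro integrable_divide Bochner_Integration.integrable_add integrable_mult_right intV)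
    qed
    fix x :: real
    have "F x * v \<le> (t * (F x * F x) + v / t) / 2" if "v = 0 \<or> v = 1" for v
    proof -
      have "0 \<le> (t * F x - v)\<^sup>2" by simp
      then have "2 * t * (F x * v) \<le> t * (t * (F x * F x)) + v * v" by (simp add: power2_eq_square algebra_simps)
      also have "v * v = v" using that by auto
      finally have "2 * t * (F x * v) / t \<le> (t * (t * (F x * F x)) + v) / t" using t by (intro divide_right_mono) auto
      then have "2 * (F x * v) \<le> t * (F x * F x) + v / t" using t by (simp add: add_divide_distrib)
      then show ?thesis by simp
    qed
    then show "(\<Sum>s\<in>S. w s * indicator (E s \<inter> V) x) \<le> (t * (\<Sum>s\<in>S. \<Sum>s'\<in>S. w s * w s' * indicator (E s \<inter> E s') x) + indicator V x / t) / 2"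
      unfolding e1 e2 by (auto simp: indicator_def)
  qed
  also have "\<dots> = (t * (\<Sum>s\<in>S. \<Sum>s'\<in>S. w s * w s' * measure lborel (E s \<inter> E s')) + measure lborel V / t) / 2"
  proof -
    have "(\<integral>x. (\<Sum>s\<in>S. \<Sum>s'\<in>S. w s * w s' * indicator (E s \<inter> E s') x) \<partial>lborel) = (\<Sum>s\<in>S. \<Sum>s'\<in>S. w s * w s' * measure lborel (E s \<inter> E s'))"
    proof -
      have "(\<integral>x. (\<Sum>s\<in>S. \<Sum>s'\<in>S. w s * w s' * indicator (E s \<inter> E s') x) \<partial>lborel)
        = (\<Sum>s\<in>S. \<integral>x. (\<Sum>s'\<in>S. w s * w s' * indicator (E s \<inter> E s') x) \<partial>lborel)"
        by (rule Bochner_Integration.integral_sum) (intro Bochner_Integration.integrable_sum int2)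
      also have "\<dots> = (\<Sum>s\<in>S. \<Sum>s'\<in>S. \<integral>x. w s * w s' * indicator (E s \<inter> E s') x \<partial>lborel)"
        by (intro sum.cong refl Bochner_Integration.integral_sum int2)
      finally show ?thesis by simp
    qed
    moreover have "integrable lborel (\<lambda>x. \<Sum>s\<in>S. \<Sum>s'\<in>S. w s * w s' * indicator (E s \<inter> E s') x :: real)"
      by (intro Bochner_Integration.integrable_sum int2)
    moreover have "(\<integral>x. (t * D x + indicator V x / t) / 2 \<partial>lborel) = (t * (\<integral>x. D x \<partial>lborel) + measure lborel V / t) / 2"
      if "integrable lborel D" for D :: "real \<Rightarrow> real" using that intV by simp
    ultimately show ?thesis by (simp only:)
  qed
  finally show ?thesis .
qed

section \<open>Trigonometric polynomials\<close>

inductive trig_poly :: "(real \<Rightarrow> complex) \<Rightarrow> bool" where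
  mono: "trig_poly (\<lambda>x. c * expi (of_int h * x))"
| add: "trig_poly \<phi> \<Longrightarrow> trig_poly \<psi> \<Longrightarrow> trig_poly (\<lambda>x. \<phi> x + \<psi> x)"

lemma trig_poly_const: "trig_poly (\<lambda>x. c)"
proof -
  have "trig_poly (\<lambda>x. c * expi (of_int 0 * x))" by (rule trig_poly.mono)
  then show ?thesis by (simp add: expi_def)
qed

lemma trig_poly_mult:
  assumes "trig_poly \<phi>" "trig_poly \<psi>"
  shows "trig_poly (\<lambda>x. \<phi> x * \<psi> x)"
  using assms(1)
proof induction
  case (mono c h)
  show ?case using assms(2)
  proof induction
    case (mono d k)
    have "c * expi (of_int h * x) * (d * expi (of_int k * x)) = (c * d) * expi (of_int (h + k) * x)" for x
    proof -
      have "expi (of_int h * x) * expi (of_int k * x) = expi (of_int (h + k) * x)"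
        by (simp add: expi_add[symmetric] distrib_right)
      then show ?thesis by (simp add: mult_ac)
    qed
    then show ?case using trig_poly.mono[of "c * d" "h + k"] by (simp only:)
  next
    case (add \<phi> \<psi>)
    then have "trig_poly (\<lambda>x. c * expi (of_int h * x) * \<phi> x + c * expi (of_int h * x) * \<psi> x)" by (intro trig_poly.add)
    then show ?case by (simp add: distrib_left)
  qed
next
  case (add \<phi> \<phi>')
  then have "trig_poly (\<lambda>x. \<phi> x * \<psi> x + \<phi>' x * \<psi> x)" by (intro trig_poly.add)
  then show ?case by (simp add: distrib_right)
qed

text \<open>Stone-Weierstrass yields real polynomials on the plane. A real linear form is a
  combination of Re z and Im z, hence of z and \<open>cnj z\<close>, which on the circle are
  \<open>expi x\<close> and \<open>expi (- x)\<close>.\<close>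

lemma trig_poly_real_polynomial:
  assumes "real_polynomial_function p"
  shows "trig_poly (\<lambda>x. of_real (p (expi x)))"
  using assms
proof induction
  case (linear f)
  then interpret bounded_linear f .
  have f: "f z = Re z * f 1 + Im z * f \<i>" for z
  proof -
    have "z = Re z *\<^sub>R 1 + Im z *\<^sub>R \<i>" by (simp add: complex_eq_iff)
    then have "f z = f (Re z *\<^sub>R 1 + Im z *\<^sub>R \<i>)" by simp
    then show ?thesis by (simp add: add scaleR)
  qed
  have re: "complex_of_real (Re z) = (1 / 2) * z + (1 / 2) * cnj z" for z
    by (simp add: complex_eq_iff)
  have im: "complex_of_real (Im z) = (- \<i> / 2) * z + (\<i> / 2) * cnj z" for z
    by (simp add: complex_eq_iff)
  have 1: "trig_poly (\<lambda>x. a * expi x)" for a using trig_poly.mono[of a 1] by simp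
  have 2: "trig_poly (\<lambda>x. a * cnj (expi x))" for a using trig_poly.mono[of a "-1"] by (simp add: expi_cnj)
  have "trig_poly (\<lambda>x. ((1 / 2) * expi x + (1 / 2) * cnj (expi x)) * of_real (f 1)
       + ((- \<i> / 2) * expi x + (\<i> / 2) * cnj (expi x)) * of_real (f \<i>))"
    by (intro trig_poly.add trig_poly_mult 1 2 trig_poly_const)
  then show ?case unfolding f[of "expi _"] of_real_add of_real_mult re im .
next
  case (const c)
  show ?case by (rule trig_poly_const)
next
  case (add f g)
  then show ?case by (simp add: trig_poly.add)
next
  case (mult f g)
  then show ?case by (simp add: trig_poly_mult)
qed

lemma continuous_expi: "continuous_on A expi"
  unfolding expi_def cis_conv_exp by (intro continuous_intros)

lemma expi_has_integral:
  assumes "h \<noteq> 0"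
  shows "((\<lambda>x. expi (of_int h * x)) has_integral 0) {0..1}"
proof -
  define w where "w = 2 * pi * of_int h * \<i>"
  have w0: "w \<noteq> 0" using assms by (simp add: w_def)
  have e: "expi (of_int h * x) = exp (w * of_real x)" for x
    by (simp add: expi_def cis_conv_exp w_def mult_ac)
  have "((\<lambda>x. exp (w * of_real x)) has_integral (exp (w * of_real 1) / w - exp (w * of_real 0) / w)) {0..1}"
    using w0 by (intro fundamental_theorem_of_calculus)
      (auto intro!: derivative_eq_intros has_vector_derivative_real_field)
  moreover have "exp (w * of_real 1) = 1" using e[of 1] by simp
  ultimately show ?thesis unfolding e by simp
qed

section \<open>Equidistribution of prime multiples\<close>

text \<open>The bound of \<open>mangoldt_nonprime_dyadic_le\<close> relative to the length of the
  block.\<close>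

definition nonprime_error :: "nat \<Rightarrow> real" where
  "nonprime_error i = real (2 ^ (i div 2 + 1) * (i + 1)\<^sup>2) / 2 ^ i"

lemma nonprime_error_tendsto: "nonprime_error \<longlonglongrightarrow> 0"
proof (rule tendsto_sandwich)
  show "eventually (\<lambda>i. 0 \<le> nonprime_error i) sequentially"
    by (intro always_eventually) (simp add: nonprime_error_def)
  show "eventually (\<lambda>i. nonprime_error i \<le> 2 * (real i + 1)\<^sup>2 / sqrt (2 ^ i)) sequentially"
  proof (intro always_eventually allI)
    fix i
    have "((2::real) ^ (i div 2))\<^sup>2 \<le> 2 ^ i"
      unfolding power_mult[symmetric] by (intro power_increasing) auto
    then have "(2::real) ^ (i div 2) \<le> sqrt (2 ^ i)" by (rule real_le_rsqrt)
    then have "nonprime_error i \<le> 2 * sqrt (2 ^ i) * (real i + 1)\<^sup>2 / 2 ^ i"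
      unfolding nonprime_error_def by (intro divide_right_mono) (auto intro!: mult_right_mono simp: add.commute)
    also have "\<dots> = 2 * (real i + 1)\<^sup>2 * (sqrt (2 ^ i) / 2 ^ i)" by simp
    also have "sqrt (2 ^ i) / (2::real) ^ i = 1 / sqrt (2 ^ i)"
      using sqrt_divide_self_eq[of "2 ^ i"] by (simp add: inverse_eq_divide)
    finally show "nonprime_error i \<le> 2 * (real i + 1)\<^sup>2 / sqrt (2 ^ i)" by simp
  qed
  show "(\<lambda>i. 2 * (real i + 1)\<^sup>2 / sqrt (2 ^ i)) \<longlonglongrightarrow> 0" by real_asymp
qed simp

lemma sum_dyadic_primes_eq:
  fixes f :: "nat \<Rightarrow> 'a::real_normed_algebra_1"
  shows "(\<Sum>p\<in>dyadic_primes i. of_real (ln (real p)) * f p)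
    = (\<Sum>n\<in>dyadic i. of_real (mangoldt n) * f n) - (\<Sum>n | n \<in> dyadic i \<and> \<not> prime n. of_real (mangoldt n) * f n)"
proof -
  let ?F = "\<lambda>n. of_real (mangoldt n) * f n" and ?B = "{n. n \<in> dyadic i \<and> \<not> prime n}"
  have "dyadic i = dyadic_primes i \<union> ?B" by (auto simp: dyadic_primes_def)
  then have "sum ?F (dyadic i) = sum ?F (dyadic_primes i \<union> ?B)" by (rule arg_cong)
  also have "\<dots> = sum ?F (dyadic_primes i) + sum ?F ?B"
    by (rule sum.union_disjoint) (auto simp: dyadic_primes_def)
  also have "sum ?F (dyadic_primes i) = (\<Sum>p\<in>dyadic_primes i. of_real (ln (real p)) * f p)"
    by (intro sum.cong refl) (simp add: dyadic_primes_def)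
  finally show ?thesis by (simp only: add_diff_cancel_right')
qed

text \<open>The arc of p has length \<epsilon> / 2^i, so this is the integral of F_m \<phi> with
  \<phi> frozen at the centre of each arc. For \<phi> = 1 it is \<open>prime_mass\<close>, the
  integral of F_m.\<close>

definition prime_mean :: "nat \<Rightarrow> nat \<Rightarrow> real \<Rightarrow> real \<Rightarrow> (real \<Rightarrow> complex) \<Rightarrow> complex" where
  "prime_mean a m \<epsilon> \<beta> \<phi> =
     (\<Sum>i\<in>window_blocks a m. \<Sum>p\<in>dyadic_primes i. of_real (ln (real p) / real m * (\<epsilon> / 2 ^ i)) * \<phi> (real p * \<beta>))"

definition prime_mass :: "nat \<Rightarrow> nat \<Rightarrow> real \<Rightarrow> real" where
  "prime_mass a m \<epsilon> = (\<Sum>i\<in>window_blocks a m. \<Sum>p\<in>dyadic_primes i. ln (real p) / real m * (\<epsilon> / 2 ^ i))"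

lemma window_blocks_ge: "i \<in> window_blocks a m \<Longrightarrow> m \<le> i"
  by (simp add: window_blocks_def)

lemma prime_mass_le:
  assumes "1 \<le> m" "0 < \<epsilon>"
  shows "prime_mass a m \<epsilon> \<le> 2 * \<epsilon>"
proof -
  have ln2: "ln (2::real) \<le> 1" using ln_le_minus_one[of 2] by simp
  have "prime_mass a m \<epsilon> \<le> (\<Sum>i\<in>window_blocks a m. 2 * \<epsilon> / real m)"
    unfolding prime_mass_def
  proof (rule sum_mono)
    fix i
    have "(\<Sum>p\<in>dyadic_primes i. ln (real p)) = (\<Sum>p\<in>dyadic_primes i. mangoldt p)"
      by (intro sum.cong refl) (simp add: dyadic_primes_def)
    also have "\<dots> \<le> (\<Sum>p\<in>dyadic i. mangoldt p)"
      by (intro sum_mono2) (auto simp: dyadic_primes_def mangoldt_nonneg)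
    also have "\<dots> \<le> 2 * 2 ^ i * ln 2" by (rule mangoldt_dyadic_le)
    also have "\<dots> \<le> 2 * 2 ^ i * 1" using ln2 by (intro mult_left_mono) auto
    finally have "(\<Sum>p\<in>dyadic_primes i. ln (real p)) * (\<epsilon> / 2 ^ i / real m) \<le> 2 * 2 ^ i * 1 * (\<epsilon> / 2 ^ i / real m)"
      using assms by (intro mult_right_mono) auto
    also have "\<dots> = 2 * \<epsilon> / real m" by simp
    also have "(\<Sum>p\<in>dyadic_primes i. ln (real p)) * (\<epsilon> / 2 ^ i / real m) = (\<Sum>p\<in>dyadic_primes i. ln (real p) / real m * (\<epsilon> / 2 ^ i))"
      unfolding sum_distrib_right by (intro sum.cong refl) simp
    finally show "(\<Sum>p\<in>dyadic_primes i. ln (real p) / real m * (\<epsilon> / 2 ^ i)) \<le> 2 * \<epsilon> / real m" .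
  qed
  also have "\<dots> = 2 * \<epsilon>" using assms by simp
  finally show ?thesis .
qed

lemma prime_mass_ge:
  assumes "0 < \<epsilon>"
  obtains M where "\<And>m. M \<le> m \<Longrightarrow> \<epsilon> / 2 \<le> prime_mass a m \<epsilon>"
proof -
  have "eventually (\<lambda>i. nonprime_error i < 1 / 24) sequentially"
    by (rule order_tendstoD(2)[OF nonprime_error_tendsto]) simp
  then obtain M0 where M0: "\<And>i. M0 \<le> i \<Longrightarrow> nonprime_error i < 1 / 24" unfolding eventually_sequentially by blast
  show thesis
  proof (rule that[of "max 72 M0"])
    fix m assume m: "max 72 M0 \<le> m"
    let ?W = "window_blocks a m"
    have m1: "1 \<le> m" "72 \<le> m" using m by auto
    have ln2: "2 / 3 \<le> ln (2::real)" by (rule ln2_ge_two_thirds)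
    have block: "(\<Sum>k\<in>dyadic i. mangoldt k) / 2 ^ i - 1 / 24 \<le> (\<Sum>p\<in>dyadic_primes i. ln (real p)) / 2 ^ i" if i: "i \<in> ?W" for i
    proof -
      have "(\<Sum>p\<in>dyadic_primes i. ln (real p)) = (\<Sum>n\<in>dyadic i. mangoldt n) - (\<Sum>n | n \<in> dyadic i \<and> \<not> prime n. mangoldt n)"
        using sum_dyadic_primes_eq[of "\<lambda>_. 1::real" i] by simp
      also have "\<dots> \<ge> (\<Sum>n\<in>dyadic i. mangoldt n) - real (2 ^ (i div 2 + 1) * (i + 1)\<^sup>2)"
        using mangoldt_nonprime_dyadic_le[of i] by linarith
      finally have "((\<Sum>n\<in>dyadic i. mangoldt n) - real (2 ^ (i div 2 + 1) * (i + 1)\<^sup>2)) / 2 ^ i \<le> (\<Sum>p\<in>dyadic_primes i. ln (real p)) / 2 ^ i"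
        by (intro divide_right_mono) auto
      moreover have "nonprime_error i < 1 / 24" using window_blocks_ge[OF i] m by (intro M0) simp
      ultimately show ?thesis unfolding nonprime_error_def diff_divide_distrib by linarith
    qed
    have len: "m * (a + 1) \<le> m * (a + 2)" "m * (a + 2) - m * (a + 1) = m" by (simp_all add: algebra_simps)
    have "real m * (2 / 3) \<le> real m * ln 2" by (intro mult_left_mono ln2) simp
    moreover have "72 \<le> real m" using m1 by simp
    \<comment> \<open>2/3 - 1/24 - 1/2 = 1/8, and m / 8 absorbs the 3 lost in
      \<open>sum_mangoldt_dyadic_ge\<close>.\<close>
    ultimately have "real m * (1 / 2) \<le> real m * ln 2 - 3 - real m * (1 / 24)" by linarith
    also have "\<dots> \<le> (\<Sum>i\<in>?W. (\<Sum>k\<in>dyadic i. mangoldt k) / 2 ^ i) - (\<Sum>i\<in>?W. 1 / 24)"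
      using sum_mangoldt_dyadic_ge[OF len(1)] unfolding len(2) by (simp add: window_blocks_def)
    also have "\<dots> = (\<Sum>i\<in>?W. (\<Sum>k\<in>dyadic i. mangoldt k) / 2 ^ i - 1 / 24)" by (rule sum_subtractf[symmetric])
    also have "\<dots> \<le> (\<Sum>i\<in>?W. (\<Sum>p\<in>dyadic_primes i. ln (real p)) / 2 ^ i)" by (rule sum_mono) (rule block)
    finally have "\<epsilon> / real m * (real m * (1 / 2)) \<le> \<epsilon> / real m * (\<Sum>i\<in>?W. (\<Sum>p\<in>dyadic_primes i. ln (real p)) / 2 ^ i)"
      using assms by (intro mult_left_mono) auto
    also have "\<dots> = prime_mass a m \<epsilon>"
      unfolding prime_mass_def sum_distrib_left sum_divide_distrib by (intro sum.cong refl) simp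
    finally show "\<epsilon> / 2 \<le> prime_mass a m \<epsilon>" using m1 by simp
  qed
qed

text \<open>n h \<beta> has the same distance as (n |h|) \<beta>. This costs a factor |h| in the
  constant and at most 2^m in the range, the step from a + 4 to a + 3.\<close>

lemma bad_window_mult:
  fixes h :: int
  assumes bad: "bad_window c (2 ^ (m * a)) (2 ^ (m * (a + 4))) \<beta>" and "0 < c" "h \<noteq> 0" "nat \<bar>h\<bar> \<le> 2 ^ m"
  shows "bad_window (c / real (nat \<bar>h\<bar>)) (2 ^ (m * a)) (2 ^ (m * (a + 3))) (of_int h * \<beta>)"
  unfolding bad_window_def
proof (intro allI impI)
  fix n :: nat assume n: "1 \<le> n" "real n \<le> 2 ^ (m * (a + 3))"
  define k where "k = nat \<bar>h\<bar>"
  have k: "1 \<le> k" "k \<le> 2 ^ m" using assms by (auto simp: k_def)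
  have "of_int h * \<beta> = real k * \<beta> \<or> of_int h * \<beta> = - (real k * \<beta>)" by (auto simp: k_def abs_if)
  then have "real n * (of_int h * \<beta>) = real (n * k) * \<beta> \<or> real n * (of_int h * \<beta>) = - (real (n * k) * \<beta>)"
    by auto
  then have d: "dist_to_int (real n * (of_int h * \<beta>)) = dist_to_int (real (n * k) * \<beta>)"
    using dist_to_int_minus by metis
  have "real (n * k) \<le> 2 ^ (m * (a + 3)) * 2 ^ m"
    unfolding of_nat_mult using n of_nat_mono[OF k(2), where ?'a = real] by (intro mult_mono) auto
  also have "\<dots> = 2 ^ (m * (a + 4))" unfolding power_add[symmetric] by (simp add: algebra_simps)
  finally have le: "real (n * k) \<le> 2 ^ (m * (a + 4))" .
  have "max (real (n * k)) (2 ^ (m * a)) \<le> real k * max (real n) (2 ^ (m * a))"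
  proof -
    have "real (n * k) \<le> real k * max (real n) (2 ^ (m * a))" by (simp add: mult.commute mult_left_mono)
    moreover have "1 * 2 ^ (m * a) \<le> real k * max (real n) (2 ^ (m * a))" using k by (intro mult_mono) auto
    ultimately show ?thesis by simp
  qed
  moreover have "0 < max (real (n * k)) (2 ^ (m * a))" using n k by (simp add: less_max_iff_disj)
  ultimately have "c / (real k * max (real n) (2 ^ (m * a))) \<le> c / max (real (n * k)) (2 ^ (m * a))"
    by (intro divide_left_mono mult_pos_pos) (use assms(2) k n in \<open>auto simp: less_max_iff_disj\<close>)
  also have "\<dots> \<le> dist_to_int (real (n * k) * \<beta>)" using n k by (intro bad_windowD[OF bad _ le]) (simp add: Suc_le_eq)
  finally show "c / real (nat \<bar>h\<bar>) / max (real n) (2 ^ (m * a)) \<le> dist_to_int (real n * (of_int h * \<beta>))"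
    unfolding d k_def by simp
qed

text \<open>The constant becomes c / |h|, so M depends on h. This is harmless, since the
  trigonometric polynomial is fixed before m is chosen.\<close>

lemma prime_mean_expi_small:
  fixes c \<epsilon> \<eta> \<beta> :: real and a :: nat and h :: int
  assumes c: "0 < c" "c \<le> 1" and a: "2 \<le> a" and \<epsilon>: "0 < \<epsilon>" and h: "h \<noteq> 0" and \<eta>: "0 < \<eta>"
  obtains M where "\<And>m. M \<le> m \<Longrightarrow> bad_window c (2 ^ (m * a)) (2 ^ (m * (a + 4))) \<beta> \<Longrightarrow>
    norm (prime_mean a m \<epsilon> \<beta> (\<lambda>x. expi (of_int h * x))) \<le> \<eta>"
proof -
  define k where "k = nat \<bar>h\<bar>"
  have k: "1 \<le> k" using h by (simp add: k_def)
  define \<zeta> where "\<zeta> = \<eta> / (2 * \<epsilon>)"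
  have \<zeta>: "0 < \<zeta>" using \<epsilon> \<eta> by (simp add: \<zeta>_def)
  have ck: "0 < c / real k" "c / real k \<le> 1" using c k by (auto simp: pos_divide_le_eq)
  obtain M1 where M1: "\<And>m i \<alpha>. M1 \<le> m \<Longrightarrow> m * (a + 1) \<le> i \<Longrightarrow> i < m * (a + 2) \<Longrightarrow>
    bad_window (c / real k) (2 ^ (m * a)) (2 ^ (m * (a + 3))) \<alpha> \<Longrightarrow>
    norm (\<Sum>n\<in>dyadic i. of_real (mangoldt n) * expi (real n * \<alpha>)) \<le> \<zeta> * 2 ^ i"
    using norm_mangoldt_expi_dyadic_small[OF ck a \<zeta>] by blast
  have "eventually (\<lambda>i. nonprime_error i < \<zeta>) sequentially"
    by (rule order_tendstoD(2)[OF nonprime_error_tendsto \<zeta>])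
  then obtain M2 where M2: "\<And>i. M2 \<le> i \<Longrightarrow> nonprime_error i < \<zeta>" unfolding eventually_sequentially by blast
  show thesis
  proof (rule that[of "max (max M1 M2) (max 1 k)"])
    fix m assume m: "max (max M1 M2) (max 1 k) \<le> m" and bad: "bad_window c (2 ^ (m * a)) (2 ^ (m * (a + 4))) \<beta>"
    have "k \<le> m" using m by simp
    then have "k \<le> 2 ^ m" using less_exp[of m] by linarith
    then have bad': "bad_window (c / real k) (2 ^ (m * a)) (2 ^ (m * (a + 3))) (of_int h * \<beta>)"
      unfolding k_def using bad c h by (intro bad_window_mult) auto
    have m0: "0 < real m" using m by simp
    have block: "norm (\<Sum>p\<in>dyadic_primes i. of_real (ln (real p) / real m * (\<epsilon> / 2 ^ i)) * expi (of_int h * (real p * \<beta>))) \<le> \<eta> / real m"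
      if i: "i \<in> window_blocks a m" for i
    proof -
      define f where "f n = expi (real n * (of_int h * \<beta>))" for n :: nat
      have "norm (\<Sum>n | n \<in> dyadic i \<and> \<not> prime n. of_real (mangoldt n) * f n)
          \<le> (\<Sum>n | n \<in> dyadic i \<and> \<not> prime n. mangoldt n)"
        by (rule sum_norm_le) (simp add: norm_mult f_def)
      also have "\<dots> \<le> real (2 ^ (i div 2 + 1) * (i + 1)\<^sup>2)" by (rule mangoldt_nonprime_dyadic_le)
      also have "\<dots> = nonprime_error i * 2 ^ i" by (simp add: nonprime_error_def)
      also have "\<dots> \<le> \<zeta> * 2 ^ i" using M2[of i] window_blocks_ge[OF i] m by (intro mult_right_mono) auto
      finally have np: "norm (\<Sum>n | n \<in> dyadic i \<and> \<not> prime n. of_real (mangoldt n) * f n) \<le> \<zeta> * 2 ^ i" .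
      have main: "norm (\<Sum>n\<in>dyadic i. of_real (mangoldt n) * f n) \<le> \<zeta> * 2 ^ i"
        unfolding f_def using m i by (intro M1[OF _ _ _ bad']) (auto simp: window_blocks_def)
      have "norm (\<Sum>p\<in>dyadic_primes i. of_real (ln (real p)) * f p) \<le> \<zeta> * 2 ^ i + \<zeta> * 2 ^ i"
        unfolding sum_dyadic_primes_eq by (rule order_trans[OF norm_triangle_ineq4 add_mono[OF main np]])
      then have s: "norm (\<Sum>p\<in>dyadic_primes i. of_real (ln (real p)) * f p) \<le> 2 * \<zeta> * 2 ^ i" by simp
      have "(\<Sum>p\<in>dyadic_primes i. of_real (ln (real p) / real m * (\<epsilon> / 2 ^ i)) * expi (of_int h * (real p * \<beta>)))
         = of_real (\<epsilon> / 2 ^ i / real m) * (\<Sum>p\<in>dyadic_primes i. of_real (ln (real p)) * f p)"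
        unfolding sum_distrib_left f_def by (intro sum.cong refl) (simp add: mult_ac)
      then have "norm (\<Sum>p\<in>dyadic_primes i. of_real (ln (real p) / real m * (\<epsilon> / 2 ^ i)) * expi (of_int h * (real p * \<beta>)))
         = \<epsilon> / 2 ^ i / real m * norm (\<Sum>p\<in>dyadic_primes i. of_real (ln (real p)) * f p)"
        using \<epsilon> by (simp only: norm_mult norm_of_real abs_divide) simp
      also have "\<dots> \<le> \<epsilon> / 2 ^ i / real m * (2 * \<zeta> * 2 ^ i)" using s \<epsilon> by (intro mult_left_mono) auto
      also have "\<dots> = \<eta> / real m" using \<epsilon> by (simp add: \<zeta>_def)
      finally show ?thesis .
    qed
    have "norm (prime_mean a m \<epsilon> \<beta> (\<lambda>x. expi (of_int h * x))) \<le> (\<Sum>i\<in>window_blocks a m. \<eta> / real m)"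
      unfolding prime_mean_def by (rule sum_norm_le) (rule block)
    also have "\<dots> = \<eta>" using m0 by simp
    finally show "norm (prime_mean a m \<epsilon> \<beta> (\<lambda>x. expi (of_int h * x))) \<le> \<eta>" .
  qed
qed

lemma prime_mean_add: "prime_mean a m \<epsilon> \<beta> (\<lambda>x. \<phi> x + \<psi> x) = prime_mean a m \<epsilon> \<beta> \<phi> + prime_mean a m \<epsilon> \<beta> \<psi>"
  by (simp add: prime_mean_def distrib_left sum.distrib)

lemma prime_mean_cmult: "prime_mean a m \<epsilon> \<beta> (\<lambda>x. c * \<phi> x) = c * prime_mean a m \<epsilon> \<beta> \<phi>"
  unfolding prime_mean_def sum_distrib_left by (intro sum.cong refl) simp

lemma prime_mean_1: "prime_mean a m \<epsilon> \<beta> (\<lambda>x. 1) = of_real (prime_mass a m \<epsilon>)"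
  by (simp add: prime_mean_def prime_mass_def)

text \<open>The mass is only known to stay between two positive multiples of \<epsilon>, so the mean
  is compared with I times the mass, which also keeps the statement additive in \<phi>.\<close>

lemma prime_mean_trig_poly:
  fixes c \<epsilon> \<beta> :: real and a :: nat
  assumes c: "0 < c" "c \<le> 1" and a: "2 \<le> a" and \<epsilon>: "0 < \<epsilon>" and \<phi>: "trig_poly \<phi>"
  obtains I where "(\<phi> has_integral I) {0..1}" and "\<And>\<eta>. 0 < \<eta> \<Longrightarrow>
    \<exists>M. \<forall>m\<ge>M. bad_window c (2 ^ (m * a)) (2 ^ (m * (a + 4))) \<beta> \<longrightarrow>
      norm (prime_mean a m \<epsilon> \<beta> \<phi> - I * of_real (prime_mass a m \<epsilon>)) \<le> \<eta>"
proof -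
  have "\<exists>I. (\<phi> has_integral I) {0..1} \<and> (\<forall>\<eta>>0. \<exists>M. \<forall>m\<ge>M. bad_window c (2 ^ (m * a)) (2 ^ (m * (a + 4))) \<beta> \<longrightarrow>
      norm (prime_mean a m \<epsilon> \<beta> \<phi> - I * of_real (prime_mass a m \<epsilon>)) \<le> \<eta>)"
    using \<phi>
  proof induction
    case (mono d h)
    show ?case
    proof (cases "h = 0")
      case True
      have e: "(\<lambda>x. d * expi (of_int h * x)) = (\<lambda>x. d)" using True by (simp add: expi_def)
      have "((\<lambda>x::real. d) has_integral d) {0..1}" using has_integral_const_real[of d 0 1] by simp
      moreover have "prime_mean a m \<epsilon> \<beta> (\<lambda>x. d) = d * of_real (prime_mass a m \<epsilon>)" for m
        using prime_mean_cmult[of a m \<epsilon> \<beta> d "\<lambda>x. 1"] by (simp add: prime_mean_1)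
      ultimately show ?thesis unfolding e by (intro exI[of _ d]) auto
    next
      case False
      have "((\<lambda>x. d * expi (of_int h * x)) has_integral d * 0) {0..1}"
        by (intro has_integral_mult_right expi_has_integral False)
      moreover have "\<exists>M. \<forall>m\<ge>M. bad_window c (2 ^ (m * a)) (2 ^ (m * (a + 4))) \<beta> \<longrightarrow>
          norm (prime_mean a m \<epsilon> \<beta> (\<lambda>x. d * expi (of_int h * x)) - d * 0 * of_real (prime_mass a m \<epsilon>)) \<le> \<eta>"
        if \<eta>: "\<eta> > 0" for \<eta>
      proof -
        have pos: "0 < \<eta> / (norm d + 1)" using \<eta> by (intro divide_pos_pos add_nonneg_pos) auto
        obtain M where M: "\<And>m. M \<le> m \<Longrightarrow> bad_window c (2 ^ (m * a)) (2 ^ (m * (a + 4))) \<beta> \<Longrightarrow>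
          norm (prime_mean a m \<epsilon> \<beta> (\<lambda>x. expi (of_int h * x))) \<le> \<eta> / (norm d + 1)"
          using prime_mean_expi_small[OF c a \<epsilon> False pos] by blast
        have "norm (prime_mean a m \<epsilon> \<beta> (\<lambda>x. d * expi (of_int h * x)) - d * 0 * of_real (prime_mass a m \<epsilon>)) \<le> \<eta>"
          if "M \<le> m" "bad_window c (2 ^ (m * a)) (2 ^ (m * (a + 4))) \<beta>" for m
        proof -
          have "norm (prime_mean a m \<epsilon> \<beta> (\<lambda>x. d * expi (of_int h * x)) - d * 0 * of_real (prime_mass a m \<epsilon>))
             = norm d * norm (prime_mean a m \<epsilon> \<beta> (\<lambda>x. expi (of_int h * x)))"
            by (simp add: prime_mean_cmult norm_mult)
          also have "\<dots> \<le> (norm d + 1) * (\<eta> / (norm d + 1))"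
            using M[OF that] by (intro mult_mono) auto
          also have "\<dots> = \<eta>" by (simp add: add_nonneg_eq_0_iff)
          finally show ?thesis .
        qed
        then show ?thesis by blast
      qed
      ultimately show ?thesis by (intro exI[of _ "d * 0"] conjI allI impI)
    qed
  next
    case (add \<phi> \<psi>)
    then obtain I J where I: "(\<phi> has_integral I) {0..1}" and J: "(\<psi> has_integral J) {0..1}"
      and I': "\<forall>\<eta>>0. \<exists>M. \<forall>m\<ge>M. bad_window c (2 ^ (m * a)) (2 ^ (m * (a + 4))) \<beta> \<longrightarrow>
        norm (prime_mean a m \<epsilon> \<beta> \<phi> - I * of_real (prime_mass a m \<epsilon>)) \<le> \<eta>"
      and J': "\<forall>\<eta>>0. \<exists>M. \<forall>m\<ge>M. bad_window c (2 ^ (m * a)) (2 ^ (m * (a + 4))) \<beta> \<longrightarrow>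
        norm (prime_mean a m \<epsilon> \<beta> \<psi> - J * of_real (prime_mass a m \<epsilon>)) \<le> \<eta>" by blast
    have "((\<lambda>x. \<phi> x + \<psi> x) has_integral (I + J)) {0..1}" using I J by (rule has_integral_add)
    moreover have "\<exists>M. \<forall>m\<ge>M. bad_window c (2 ^ (m * a)) (2 ^ (m * (a + 4))) \<beta> \<longrightarrow>
        norm (prime_mean a m \<epsilon> \<beta> (\<lambda>x. \<phi> x + \<psi> x) - (I + J) * of_real (prime_mass a m \<epsilon>)) \<le> \<eta>"
      if \<eta>: "\<eta> > 0" for \<eta>
    proof -
      obtain M1 M2 where M1: "\<And>m. M1 \<le> m \<Longrightarrow> bad_window c (2 ^ (m * a)) (2 ^ (m * (a + 4))) \<beta> \<Longrightarrow>
          norm (prime_mean a m \<epsilon> \<beta> \<phi> - I * of_real (prime_mass a m \<epsilon>)) \<le> \<eta> / 2"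
        and M2: "\<And>m. M2 \<le> m \<Longrightarrow> bad_window c (2 ^ (m * a)) (2 ^ (m * (a + 4))) \<beta> \<Longrightarrow>
          norm (prime_mean a m \<epsilon> \<beta> \<psi> - J * of_real (prime_mass a m \<epsilon>)) \<le> \<eta> / 2"
        using I'[rule_format, of "\<eta> / 2"] J'[rule_format, of "\<eta> / 2"] \<eta> by auto
      have "norm (prime_mean a m \<epsilon> \<beta> (\<lambda>x. \<phi> x + \<psi> x) - (I + J) * of_real (prime_mass a m \<epsilon>)) \<le> \<eta>"
        if "max M1 M2 \<le> m" "bad_window c (2 ^ (m * a)) (2 ^ (m * (a + 4))) \<beta>" for m
      proof -
        have "prime_mean a m \<epsilon> \<beta> (\<lambda>x. \<phi> x + \<psi> x) - (I + J) * of_real (prime_mass a m \<epsilon>)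
          = (prime_mean a m \<epsilon> \<beta> \<phi> - I * of_real (prime_mass a m \<epsilon>)) + (prime_mean a m \<epsilon> \<beta> \<psi> - J * of_real (prime_mass a m \<epsilon>))"
          by (simp add: prime_mean_add algebra_simps)
        then show ?thesis using norm_triangle_mono[OF M1[OF _ that(2)] M2[OF _ that(2)]] that(1) by simp
      qed
      then show ?thesis by blast
    qed
    ultimately show ?case by (intro exI[of _ "I + J"] conjI allI impI)
  qed
  then show thesis using that by blast
qed

section \<open>The second moment\<close>

text \<open>Dividing by m normalises the total mass to order \<epsilon> and keeps each weight at
  most a + 2 on the window.\<close>

definition prime_weight :: "nat \<Rightarrow> nat \<times> nat \<Rightarrow> real" where
  "prime_weight m = (\<lambda>(i, p). ln (real p) / real m)"

definition prime_arc :: "real \<Rightarrow> real \<Rightarrow> nat \<times> nat \<Rightarrow> real set" where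
  "prime_arc \<epsilon> \<beta> = (\<lambda>(i, p). circle_arc (real p * \<beta>) (\<epsilon> / 2 ^ Suc i))"

text \<open>The block i is determined by p; it is carried along because it fixes the radius of the
  arc.\<close>

definition window_primes :: "nat \<Rightarrow> nat \<Rightarrow> (nat \<times> nat) set" where
  "window_primes a m = (SIGMA i:window_blocks a m. dyadic_primes i)"

lemma finite_window_primes [simp]: "finite (window_primes a m)"
  by (simp add: window_primes_def)

lemma sum_window_primes: "(\<Sum>s\<in>window_primes a m. f s) = (\<Sum>i\<in>window_blocks a m. \<Sum>p\<in>dyadic_primes i. f (i, p))"
  unfolding window_primes_def by (subst sum.Sigma) auto

lemma prime_arc_fmeasurable: "prime_arc \<epsilon> \<beta> s \<in> fmeasurable lborel"
  unfolding prime_arc_def by (cases s) (auto intro!: fmeasurable_subset_unit sets_circle_arc circle_arc_subset)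

lemma measure_prime_arc:
  assumes "0 < \<epsilon>" "\<epsilon> \<le> 1 / 2"
  shows "measure lborel (prime_arc \<epsilon> \<beta> (i, p)) = \<epsilon> / 2 ^ i"
proof -
  have "\<epsilon> / 2 ^ Suc i \<le> \<epsilon> / 1" using assms by (intro divide_left_mono one_le_power) auto
  then have "\<epsilon> / 2 ^ Suc i \<le> 1 / 2" using assms(2) unfolding div_by_1 by (rule order_trans)
  moreover have "0 < \<epsilon> / 2 ^ Suc i" using assms(1) by simp
  ultimately have "measure lborel (circle_arc (real p * \<beta>) (\<epsilon> / 2 ^ Suc i)) = 2 * (\<epsilon> / 2 ^ Suc i)"
    by (intro measure_circle_arc)
  then show ?thesis by (simp add: prime_arc_def)
qed

text \<open>If two arcs meet, their centres are closer than the sum of the radii, at most \<epsilon>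
  / 2^i. The intersection is no longer than the shorter arc.\<close>

lemma measure_prime_arc_Int_le:
  assumes "0 < \<epsilon>" "\<epsilon> \<le> 1 / 2" "i \<le> i'"
  shows "measure lborel (prime_arc \<epsilon> \<beta> (i, p) \<inter> prime_arc \<epsilon> \<beta> (i', q))
    \<le> (if dist_to_int ((real q - real p) * \<beta>) < \<epsilon> / 2 ^ i then \<epsilon> / 2 ^ i' else 0)"
proof (cases "prime_arc \<epsilon> \<beta> (i, p) \<inter> prime_arc \<epsilon> \<beta> (i', q) = {}")
  case True
  then show ?thesis using assms by simp
next
  case False
  then obtain x where x: "dist_to_int (x - real p * \<beta>) < \<epsilon> / 2 ^ Suc i" "dist_to_int (x - real q * \<beta>) < \<epsilon> / 2 ^ Suc i'"
    by (auto simp: prime_arc_def circle_arc_def)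
  have "dist_to_int ((real q - real p) * \<beta>) = dist_to_int ((x - real p * \<beta>) + - (x - real q * \<beta>))"
    by (simp add: algebra_simps)
  also have "\<dots> \<le> dist_to_int (x - real p * \<beta>) + dist_to_int (x - real q * \<beta>)"
    using dist_to_int_triangle[of "x - real p * \<beta>" "- (x - real q * \<beta>)"] unfolding dist_to_int_minus .
  also have "\<dots> < \<epsilon> / 2 ^ Suc i + \<epsilon> / 2 ^ Suc i'" using x by (rule add_strict_mono)
  also have "\<dots> \<le> \<epsilon> / 2 ^ Suc i + \<epsilon> / 2 ^ Suc i"
    using assms by (intro add_left_mono divide_left_mono power_increasing) auto
  finally have d: "dist_to_int ((real q - real p) * \<beta>) < \<epsilon> / 2 ^ i" by simp
  have "measure lborel (prime_arc \<epsilon> \<beta> (i, p) \<inter> prime_arc \<epsilon> \<beta> (i', q)) \<le> measure lborel (prime_arc \<epsilon> \<beta> (i', q))"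
    using prime_arc_fmeasurable by (intro measure_mono_fmeasurable) (auto intro: fmeasurableD)
  then show ?thesis using d measure_prime_arc[OF assms(1,2)] by simp
qed

text \<open>The diagonal is at most (a + 2) times the mass. Off it, the weights are bounded by a +
  2, the symmetry allows p < q at the price of a factor 2, and p < q places q in the same or a later
  block, so \<open>sum_close_pairs_le\<close> applies.\<close>

lemma second_moment_le:
  fixes c \<epsilon> :: real and a m :: nat
  assumes bad: "bad_window c (2 ^ (m * a)) (2 ^ (m * (a + 4))) \<beta>" and c: "0 < c" "c \<le> 1"
    and \<epsilon>: "0 < \<epsilon>" "2 * \<epsilon> \<le> c" and m: "1 \<le> m"
  shows "(\<Sum>s\<in>window_primes a m. \<Sum>s'\<in>window_primes a m. prime_weight m s * prime_weight m s' *
      measure lborel (prime_arc \<epsilon> \<beta> s \<inter> prime_arc \<epsilon> \<beta> s'))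
    \<le> 2 * (real a + 2) * \<epsilon> + 2 * (real a + 2)\<^sup>2 *
        (40000 * \<epsilon> * (72 * (1 + 1 / (2 * sqrt c)) * \<epsilon> + 4 * sqrt (2 * \<epsilon> / c) * (real a + 3)))"
proof -
  let ?S = "window_primes a m"
  define A where "A = real a + 2"
  define w where "w = prime_weight m"
  define M where "M s s' = measure lborel (prime_arc \<epsilon> \<beta> s \<inter> prime_arc \<epsilon> \<beta> s')" for s s'
  define L where "L s s' = (if snd s < snd s' then A\<^sup>2 * M s s' else 0)" for s s'
  define D where "D s s' = (if s = s' then A * w s * (\<epsilon> / 2 ^ fst s) else 0)" for s s' :: "nat \<times> nat"
  have e2: "\<epsilon> \<le> 1 / 2" using c \<epsilon> by simp
  have ln2: "ln (2::real) \<le> 1" using ln_le_minus_one[of 2] by simp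
  have w: "0 \<le> w s \<and> w s \<le> A" if s: "s \<in> ?S" for s
  proof -
    obtain i p where ip: "s = (i, p)" "i \<in> window_blocks a m" "p \<in> dyadic_primes i" using s by (auto simp: window_primes_def)
    have p: "p \<ge> 1" "p \<le> 2 ^ Suc i" using ip(3) by (auto simp: dyadic_primes_def dyadic_def Suc_le_eq intro: prime_gt_0_nat)
    have "real p \<le> real (2 ^ Suc i)" using p by (intro of_nat_mono)
    then have "ln (real p) \<le> ln (2 ^ Suc i)" using p by (subst ln_le_cancel_iff) auto
    also have "\<dots> = real (Suc i) * ln 2" by (rule ln_realpow)
    also have "\<dots> \<le> real (Suc i) * 1" using ln2 by (intro mult_left_mono) auto
    also have "\<dots> \<le> real (m * (a + 2))" using ip(2) unfolding mult_1_right by (intro of_nat_mono) (simp add: window_blocks_def)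
    finally have "ln (real p) \<le> A * real m" by (simp add: A_def algebra_simps)
    then show ?thesis using m p by (simp add: ip w_def prime_weight_def pos_divide_le_eq)
  qed
  have M0: "0 \<le> M s s'" for s s' by (simp add: M_def)
  have Msym: "M s s' = M s' s" for s s' by (simp add: M_def Int_commute)
  \<comment> \<open>Dyadic blocks are disjoint, so equal primes give equal pairs (i, p) and the case
    of equal primes is exactly the diagonal.\<close>
  have blocks: "i = i'" if "p \<in> dyadic i" "p \<in> dyadic i'" for p i i'
  proof -
    have "i \<le> i'" if "p \<in> dyadic i" "p \<in> dyadic i'" for p i i'
    proof (rule ccontr)
      assume "\<not> i \<le> i'"
      then have "(2::nat) ^ Suc i' \<le> 2 ^ i" by (intro power_increasing) auto
      moreover have "2 ^ i < p" "p \<le> 2 ^ Suc i'" using that by (simp_all add: dyadic_def)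
      ultimately show False by linarith
    qed
    then show ?thesis using that by (meson le_antisym)
  qed
  have pointwise: "w s * w s' * M s s' \<le> D s s' + (L s s' + L s' s)" if s: "s \<in> ?S" and s': "s' \<in> ?S" for s s'
  proof -
    have L0: "0 \<le> L s s'" "0 \<le> L s' s" using M0 by (auto simp: L_def)
    have D0: "0 \<le> D s s'" using w[OF s] \<epsilon> by (auto simp: D_def A_def)
    consider "snd s = snd s'" | "snd s < snd s'" | "snd s' < snd s" by linarith
    then show ?thesis
    proof cases
      case 1
      obtain i p i' p' where ip: "s = (i, p)" "p \<in> dyadic i" "s' = (i', p')" "p' \<in> dyadic i'"
        using s s' by (auto simp: window_primes_def dyadic_primes_def)
      then have "i = i'" using 1 blocks[of p i i'] by simp
      then have ss: "s = s'" using 1 ip by simp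
      have "M s s = \<epsilon> / 2 ^ fst s" unfolding M_def ip(1) using measure_prime_arc[OF \<epsilon>(1) e2] by simp
      then have "w s * w s' * M s s' = w s * (w s * (\<epsilon> / 2 ^ fst s))" using ss by simp
      also have "\<dots> \<le> A * (w s * (\<epsilon> / 2 ^ fst s))" using w[OF s] \<epsilon> by (intro mult_right_mono) auto
      also have "\<dots> = D s s'" using ss by (simp add: D_def)
      finally show ?thesis using L0 by linarith
    next
      case 2
      have "w s * w s' * M s s' \<le> A * A * M s s'" using w[OF s] w[OF s'] M0 by (intro mult_right_mono mult_mono) auto
      also have "\<dots> = L s s'" using 2 by (simp add: L_def power2_eq_square)
      finally show ?thesis using L0 D0 by linarith
    next
      case 3
      have "w s * w s' * M s s' \<le> A * A * M s s'" using w[OF s] w[OF s'] M0 by (intro mult_right_mono mult_mono) auto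
      also have "\<dots> = L s' s" using 3 by (simp add: L_def power2_eq_square Msym)
      finally show ?thesis using L0 D0 by linarith
    qed
  qed
  have sumL: "(\<Sum>s\<in>?S. \<Sum>s'\<in>?S. L s s') \<le> A\<^sup>2 *
     (40000 * \<epsilon> * (72 * (1 + 1 / (2 * sqrt c)) * \<epsilon> + 4 * sqrt (2 * \<epsilon> / c) * (real a + 3)))"
  proof -
    have inner: "(\<Sum>p\<in>dyadic_primes i. \<Sum>q\<in>dyadic_primes i'. L (i, p) (i', q))
        \<le> A\<^sup>2 * (if i \<le> i' then \<epsilon> / 2 ^ i' * real (card (close_pairs \<beta> i i' (\<epsilon> / 2 ^ i))) else 0)" for i i'
    proof (cases "i \<le> i'")
      case True
      have "(\<Sum>p\<in>dyadic_primes i. \<Sum>q\<in>dyadic_primes i'. L (i, p) (i', q))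
        = (\<Sum>(p, q)\<in>dyadic_primes i \<times> dyadic_primes i'. L (i, p) (i', q))"
        by (rule sum.cartesian_product)
      also have "\<dots> \<le> (\<Sum>z\<in>dyadic_primes i \<times> dyadic_primes i'. if z \<in> close_pairs \<beta> i i' (\<epsilon> / 2 ^ i) then A\<^sup>2 * (\<epsilon> / 2 ^ i') else 0)"
      proof (rule sum_mono)
        fix z assume z: "z \<in> dyadic_primes i \<times> dyadic_primes i'"
        obtain p q where pq: "z = (p, q)" by (cases z)
        have "M (i, p) (i', q) \<le> (if dist_to_int ((real q - real p) * \<beta>) < \<epsilon> / 2 ^ i then \<epsilon> / 2 ^ i' else 0)"
          unfolding M_def by (rule measure_prime_arc_Int_le[OF \<epsilon>(1) e2 True])
        then have "A\<^sup>2 * M (i, p) (i', q) \<le> A\<^sup>2 * (if dist_to_int ((real q - real p) * \<beta>) < \<epsilon> / 2 ^ i then \<epsilon> / 2 ^ i' else 0)"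
          by (intro mult_left_mono) auto
        then show "(case z of (p, q) \<Rightarrow> L (i, p) (i', q)) \<le> (if z \<in> close_pairs \<beta> i i' (\<epsilon> / 2 ^ i) then A\<^sup>2 * (\<epsilon> / 2 ^ i') else 0)"
          using z by (auto simp: pq L_def close_pairs_def split: if_splits)
      qed
      also have "\<dots> = (\<Sum>z\<in>{z \<in> dyadic_primes i \<times> dyadic_primes i'. z \<in> close_pairs \<beta> i i' (\<epsilon> / 2 ^ i)}. A\<^sup>2 * (\<epsilon> / 2 ^ i'))"
        by (rule sum.inter_filter[symmetric]) simp
      also have "{z \<in> dyadic_primes i \<times> dyadic_primes i'. z \<in> close_pairs \<beta> i i' (\<epsilon> / 2 ^ i)} = close_pairs \<beta> i i' (\<epsilon> / 2 ^ i)"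
        by (auto simp: close_pairs_def)
      finally show ?thesis using True by (simp add: mult_ac)
    next
      case False
      have "L (i, p) (i', q) = 0" if "p \<in> dyadic_primes i" "q \<in> dyadic_primes i'" for p q
      proof -
        have "(2::nat) ^ Suc i' \<le> 2 ^ i" using False by (intro power_increasing) auto
        moreover have "2 ^ i < p" "q \<le> 2 ^ Suc i'" using that by (simp_all add: dyadic_primes_def dyadic_def)
        ultimately have "\<not> p < q" by linarith
        then show ?thesis by (simp add: L_def)
      qed
      then have "(\<Sum>p\<in>dyadic_primes i. \<Sum>q\<in>dyadic_primes i'. L (i, p) (i', q)) = 0"
        by (intro sum.neutral ballI)
      then show ?thesis using False by simp
    qed
    have "(\<Sum>s\<in>?S. \<Sum>s'\<in>?S. L s s') = (\<Sum>i\<in>window_blocks a m. \<Sum>i'\<in>window_blocks a m. \<Sum>p\<in>dyadic_primes i. \<Sum>q\<in>dyadic_primes i'. L (i, p) (i', q))"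
      unfolding sum_window_primes by (intro sum.cong refl sum.swap)
    also have "\<dots> \<le> (\<Sum>i\<in>window_blocks a m. \<Sum>i'\<in>window_blocks a m. A\<^sup>2 * (if i \<le> i' then \<epsilon> / 2 ^ i' * real (card (close_pairs \<beta> i i' (\<epsilon> / 2 ^ i))) else 0))"
      by (intro sum_mono inner)
    also have "\<dots> = A\<^sup>2 * (\<Sum>i\<in>window_blocks a m. \<Sum>i'\<in>window_blocks a m. if i \<le> i' then \<epsilon> / 2 ^ i' * real (card (close_pairs \<beta> i i' (\<epsilon> / 2 ^ i))) else 0)"
      by (simp only: sum_distrib_left)
    also have "\<dots> \<le> A\<^sup>2 * (40000 * \<epsilon> * (72 * (1 + 1 / (2 * sqrt c)) * \<epsilon> + 4 * sqrt (2 * \<epsilon> / c) * (real a + 3)))"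
      by (intro mult_left_mono sum_close_pairs_le[OF bad c(1) \<epsilon> m]) simp
    finally show ?thesis .
  qed
  have sumD: "(\<Sum>s\<in>?S. \<Sum>s'\<in>?S. D s s') \<le> 2 * A * \<epsilon>"
  proof -
    have "(\<Sum>s\<in>?S. \<Sum>s'\<in>?S. D s s') = (\<Sum>s\<in>?S. A * w s * (\<epsilon> / 2 ^ fst s))"
      unfolding D_def by (intro sum.cong refl) (simp add: sum.delta)
    also have "\<dots> = A * prime_mass a m \<epsilon>"
      unfolding sum_window_primes prime_mass_def sum_distrib_left w_def prime_weight_def
      by (intro sum.cong refl) simp
    also have "\<dots> \<le> A * (2 * \<epsilon>)" by (intro mult_left_mono prime_mass_le m \<epsilon>) (simp add: A_def)
    finally show ?thesis by simp
  qed
  have "(\<Sum>s\<in>?S. \<Sum>s'\<in>?S. w s * w s' * M s s') \<le> (\<Sum>s\<in>?S. \<Sum>s'\<in>?S. D s s' + (L s s' + L s' s))"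
    by (intro sum_mono pointwise)
  also have "\<dots> = (\<Sum>s\<in>?S. \<Sum>s'\<in>?S. D s s') + ((\<Sum>s\<in>?S. \<Sum>s'\<in>?S. L s s') + (\<Sum>s\<in>?S. \<Sum>s'\<in>?S. L s' s))"
    by (simp only: sum.distrib)
  also have "(\<Sum>s\<in>?S. \<Sum>s'\<in>?S. L s' s) = (\<Sum>s\<in>?S. \<Sum>s'\<in>?S. L s s')" by (rule sum.swap)
  finally show ?thesis using sumL sumD unfolding w_def M_def A_def by argo
qed

lemma dist_to_int_eq_0_of_expi_eq: "expi x = expi y \<Longrightarrow> dist_to_int (x - y) = 0"
proof -
  assume "expi x = expi y"
  then have "expi (x - y) = 1" using expi_add[of "x - y" y] by (metis add_diff_cancel diff_add_cancel expi_add mult_cancel_right1 norm_expi norm_zero zero_neq_one)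
  then show ?thesis using norm_expi_minus_1_ge[of "x - y"] dist_to_int_nonneg[of "x - y"] by simp
qed

lemma norm_expi_diff_le: "norm (expi x - expi y) \<le> 2 * pi * dist_to_int (x - y)"
proof -
  obtain k where k: "dist_to_int (x - y) = \<bar>x - y - of_int k\<bar>" using dist_to_int_attained by blast
  define s where "s = x - y - of_int k"
  have x: "x = y + (s + of_int k)" by (simp add: s_def)
  have "expi x - expi y = expi y * (expi s - 1)"
    by (subst x) (simp only: expi_add expi_of_int, simp add: algebra_simps)
  then have "norm (expi x - expi y) = norm (expi s - 1)" by (simp add: norm_mult)
  also have "\<dots> = 2 * \<bar>sin (pi * s)\<bar>"
    unfolding expi_def cis_conv_exp using dist_exp_i_1[of "2 * pi * s"] by simp
  also have "\<dots> \<le> 2 * \<bar>pi * s\<bar>" using abs_sin_x_le_abs_x[of "pi * s"] by simp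
  finally show ?thesis unfolding k by (simp add: abs_mult s_def)
qed

section \<open>Conclusion\<close>

lemma measure_le_integral_trig_poly:
  fixes K :: "real set" and \<phi> :: "real \<Rightarrow> complex" and I :: complex and \<zeta> :: real
  assumes K: "compact K" "K \<subseteq> {0..1}" and \<phi>: "(\<phi> has_integral I) {0..1}"
    and ge: "\<And>x. x \<in> {0..1} \<Longrightarrow> (if x \<in> K then 1 else 0) \<le> Re (\<phi> x) + \<zeta>"
  shows "measure lborel K \<le> Re I + \<zeta>"
proof -
  have KB: "K \<in> sets borel" using K(1) by (simp add: compact_imp_closed)
  have "emeasure lborel K < \<infinity>" using K(1) by (rule emeasure_compact_finite)
  then have "((\<lambda>x. 1) has_integral measure lborel K) K" by (rule has_integral_measure_lborel[OF KB])
  then have 1: "((\<lambda>x. if x \<in> K then 1 else 0) has_integral measure lborel K) {0..1::real}"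
    using has_integral_restrict[OF K(2), of "\<lambda>x. 1::real"] by simp
  have "((\<lambda>x. Re (\<phi> x)) has_integral Re I) {0..1}"
    using has_integral_linear[OF \<phi> bounded_linear_Re] by (simp add: o_def)
  moreover have "((\<lambda>x. \<zeta>) has_integral \<zeta>) {0..1::real}" using has_integral_const_real[of \<zeta> 0 1] by simp
  ultimately have 2: "((\<lambda>x. Re (\<phi> x) + \<zeta>) has_integral (Re I + \<zeta>)) {0..1}" by (rule has_integral_add)
  show ?thesis by (rule has_integral_le[OF 1 2]) (rule ge)
qed

text \<open>All quantities are measured in units of \<epsilon> \<kappa>, with \<kappa> the measure
  of \<open>K\<close>. The second moment allows at most 3/16 of F_m on V, while equidistribution
  puts at least 5/16 - 1/16 there, because an arc inside U that misses K lies in V.\<close>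

lemma measure_non_approximable_compact:
  fixes c \<epsilon> \<beta> :: real and a P :: nat
  assumes windows: "\<And>M. \<exists>m\<ge>M. bad_window c (2 ^ (m * a)) (2 ^ (m * (a + 4))) \<beta>"
    and c: "0 < c" "c \<le> 1" and a: "2 \<le> a" and \<epsilon>: "0 < \<epsilon>" "2 * \<epsilon> \<le> c"
    and K: "compact K" "K \<subseteq> {0<..<1}"
    and far: "\<And>x p. x \<in> K \<Longrightarrow> prime p \<Longrightarrow> P < p \<Longrightarrow> \<epsilon> \<le> real p * dist_to_int (real p * \<beta> - x)"
  shows "measure lborel K = 0"
proof (rule ccontr)
  assume "measure lborel K \<noteq> 0"
  define \<kappa> where "\<kappa> = measure lborel K"
  have \<kappa>: "0 < \<kappa>" using \<open>measure lborel K \<noteq> 0\<close> by (simp add: \<kappa>_def zero_less_measure_iff)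
  define C where "C = 2 * (real a + 2) * \<epsilon> + 2 * (real a + 2)\<^sup>2 *
        (40000 * \<epsilon> * (72 * (1 + 1 / (2 * sqrt c)) * \<epsilon> + 4 * sqrt (2 * \<epsilon> / c) * (real a + 3)))"
  have C: "0 < C" unfolding C_def using \<epsilon> c by (intro add_pos_nonneg mult_nonneg_nonneg add_nonneg_nonneg) auto
  have e2: "\<epsilon> \<le> 1 / 2" using c \<epsilon> by simp
  \<comment> \<open>t C = \<epsilon> \<kappa> / 4 and \<eta> / t = \<epsilon> \<kappa> / 8; half
    their sum is the 3/16 of \<open>upper\<close>.\<close>
  define t where "t = \<epsilon> * \<kappa> / (4 * C)"
  have t: "0 < t" using \<epsilon> \<kappa> C by (simp add: t_def)
  define \<eta> where "\<eta> = t * \<epsilon> * \<kappa> / 8"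
  have \<eta>: "0 < \<eta>" using t \<epsilon> \<kappa> by (simp add: \<eta>_def)
  have KB: "K \<in> sets borel" using K(1) by (simp add: compact_imp_closed)
  then have "K \<in> sets lebesgue" by simp
  then obtain U where U: "open U" "K \<subseteq> U" "U - K \<in> lmeasurable" "emeasure lebesgue (U - K) < ennreal \<eta>"
    using \<eta> by (rule sets_lebesgue_outer_open)
  define V where "V = U \<inter> {0..<1} - K"
  have VB: "V \<in> sets borel" using U(1) KB by (simp add: V_def)
  have Vf: "V \<in> fmeasurable lborel" using VB by (rule fmeasurable_subset_unit) (auto simp: V_def)
  have mV: "measure lborel V \<le> \<eta>"
  proof -
    have "emeasure lborel V = emeasure lebesgue V" using VB by simp
    also have "\<dots> \<le> emeasure lebesgue (U - K)" using U(3) by (intro emeasure_mono) (auto simp: V_def fmeasurableD)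
    finally have "emeasure lborel V \<le> ennreal \<eta>" using U(4) by simp
    then show ?thesis using \<eta> by (simp add: measure_def enn2real_leI)
  qed
  have contI: "continuous_on B expi" for B by (rule continuous_expi)
  have clS: "closed (expi ` ({0..1} - U))" "closed (expi ` K)"
    using U(1) K(1) by (auto intro!: compact_imp_closed compact_continuous_image contI compact_diff)
  \<comment> \<open>\<open>expi\<close> identifies 0 and 1. As K avoids both, a point of [0, 1] with
    the same image as a point of K equals that point.\<close>
  have disj: "expi ` ({0..1} - U) \<inter> expi ` K = {}"
  proof (rule equals0I)
    fix z assume "z \<in> expi ` ({0..1} - U) \<inter> expi ` K"
    then obtain x y where xy: "x \<in> {0..1}" "x \<notin> U" "y \<in> K" "expi x = expi y" by auto
    have "dist_to_int (x - y) = 0" by (rule dist_to_int_eq_0_of_expi_eq[OF xy(4)])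
    then obtain k where "x - y = real_of_int k" using dist_to_int_attained[of "x - y"] by auto
    moreover have "\<bar>x - y\<bar> < 1" using xy(1,3) K(2) by fastforce
    ultimately have "k = 0" by simp
    then show False using xy U(2) \<open>x - y = real_of_int k\<close> by auto
  qed
  \<comment> \<open>Separating on the circle instead of the interval makes the test function
    periodic from the start.\<close>
  obtain f :: "complex \<Rightarrow> real" where f: "continuous_on UNIV f" "\<And>z. f z \<in> closed_segment 0 1"
    "\<And>z. z \<in> expi ` ({0..1} - U) \<Longrightarrow> f z = 0" "\<And>z. z \<in> expi ` K \<Longrightarrow> f z = 1"
    using Urysohn[OF clS disj, of "0::real" 1] by blast
  have f01: "0 \<le> f z \<and> f z \<le> 1" for z using f(2)[of z] by (simp add: closed_segment_eq_real_ivl)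
  \<comment> \<open>One \<zeta> is lost in bounding Re I from below and 2 \<zeta> in
    \<open>lower\<close>; from \<kappa> there remain 5/8 \<kappa>, and mass at least \<epsilon> / 2
    turns this into 5/16.\<close>
  define \<zeta> where "\<zeta> = \<kappa> / 8"
  have \<zeta>: "0 < \<zeta>" using \<kappa> by (simp add: \<zeta>_def)
  have fS: "continuous_on (sphere 0 1) f" using f(1) by (rule continuous_on_subset) simp
  obtain g where g: "real_polynomial_function g" "\<And>z. z \<in> sphere 0 1 \<Longrightarrow> \<bar>f z - g z\<bar> < \<zeta>"
    using Stone_Weierstrass_real_polynomial_function[OF compact_sphere fS \<zeta>] by blast
  have fg: "\<bar>f (expi x) - g (expi x)\<bar> < \<zeta>" for x by (rule g(2)) simp
  define \<phi> where "\<phi> x = complex_of_real (g (expi x))" for x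
  have "trig_poly \<phi>" unfolding \<phi>_def using g(1) by (rule trig_poly_real_polynomial)
  then obtain I where I: "(\<phi> has_integral I) {0..1}" "\<And>\<eta>. 0 < \<eta> \<Longrightarrow>
    \<exists>M. \<forall>m\<ge>M. bad_window c (2 ^ (m * a)) (2 ^ (m * (a + 4))) \<beta> \<longrightarrow>
      norm (prime_mean a m \<epsilon> \<beta> \<phi> - I * of_real (prime_mass a m \<epsilon>)) \<le> \<eta>"
    using prime_mean_trig_poly[OF c a \<epsilon>(1)] by blast
  have I_ge: "\<kappa> - \<zeta> \<le> Re I"
  proof -
    have "measure lborel K \<le> Re I + \<zeta>"
    proof (rule measure_le_integral_trig_poly[OF K(1) _ I(1)])
      show "K \<subseteq> {0..1}" using K(2) by auto
      fix x assume "x \<in> {0..1::real}"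
      show "(if x \<in> K then 1 else 0) \<le> Re (\<phi> x) + \<zeta>"
        using fg[of x] f01[of "expi x"] f(4)[of "expi x"] by (auto simp: \<phi>_def)
    qed
    then show ?thesis by (simp add: \<kappa>_def)
  qed
  have "uniformly_continuous_on (sphere 0 1) f" using fS by (intro compact_uniformly_continuous) auto
  then obtain d where d: "0 < d" "\<And>z z'. z \<in> sphere 0 1 \<Longrightarrow> z' \<in> sphere 0 1 \<Longrightarrow> dist z' z < d \<Longrightarrow> dist (f z') (f z) < \<zeta>"
    unfolding uniformly_continuous_on_def using \<zeta> by meson
  \<comment> \<open>An equidistribution error of 1/16 still leaves 4/16 > 3/16.\<close>
  define \<eta>' where "\<eta>' = \<epsilon> * \<kappa> / 16"
  have \<eta>': "0 < \<eta>'" using \<epsilon> \<kappa> by (simp add: \<eta>'_def)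
  obtain M1 where M1: "\<And>m. M1 \<le> m \<Longrightarrow> bad_window c (2 ^ (m * a)) (2 ^ (m * (a + 4))) \<beta> \<Longrightarrow>
      norm (prime_mean a m \<epsilon> \<beta> \<phi> - I * of_real (prime_mass a m \<epsilon>)) \<le> \<eta>'"
    using I(2)[OF \<eta>'] by blast
  obtain M2 where M2: "\<And>m. M2 \<le> m \<Longrightarrow> \<epsilon> / 2 \<le> prime_mass a m \<epsilon>" using prime_mass_ge[OF \<epsilon>(1)] by blast
  \<comment> \<open>For m >= M3 the arcs are so short that f varies by less than \<zeta> between the
    centre and any point of the arc.\<close>
  obtain M3 :: nat where M3: "2 * pi / d < real M3" using reals_Archimedean2 by blast
  obtain m where m: "max (max M1 M2) (max M3 (max 1 P)) \<le> m" and bad: "bad_window c (2 ^ (m * a)) (2 ^ (m * (a + 4))) \<beta>"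
    using windows by blast
  define S where "S = window_primes a m"
  define w where "w = prime_weight m"
  define E where "E = prime_arc \<epsilon> \<beta>"
  have w0: "0 \<le> w s" if "s \<in> S" for s
  proof -
    obtain i p where ip: "s = (i, p)" by (cases s)
    have "prime p" using that by (auto simp: ip S_def window_primes_def dyadic_primes_def)
    then have "1 \<le> p" by (rule prime_ge_1_nat)
    then have "0 \<le> ln (real p)" by simp
    then show ?thesis by (simp add: ip w_def prime_weight_def)
  qed
  have upper: "(\<Sum>s\<in>S. w s * measure lborel (E s \<inter> V)) \<le> 3 / 16 * (\<epsilon> * \<kappa>)"
  proof -
    have "(\<Sum>s\<in>S. w s * measure lborel (E s \<inter> V)) \<le> (t * (\<Sum>s\<in>S. \<Sum>s'\<in>S. w s * w s' * measure lborel (E s \<inter> E s')) + measure lborel V / t) / 2"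
      unfolding S_def E_def by (rule weighted_measure_le[OF finite_window_primes prime_arc_fmeasurable Vf t])
    also have "\<dots> \<le> (t * C + \<eta> / t) / 2"
      unfolding S_def E_def w_def C_def using second_moment_le[OF bad c \<epsilon>, of] m t mV
      by (intro divide_right_mono add_mono mult_left_mono) auto
    also have "\<dots> = 3 / 16 * (\<epsilon> * \<kappa>)" using t C by (simp add: \<eta>_def t_def)
    finally show ?thesis .
  qed
  \<comment> \<open>Either f is at most \<zeta> at the centre and the left side is not positive, or
    f stays positive on the whole arc, which then lies in U, avoids K, and is contained in
    V.\<close>
  have lower: "\<epsilon> / 2 ^ i * (Re (\<phi> (real p * \<beta>)) - 2 * \<zeta>) \<le> measure lborel (E (i, p) \<inter> V)" if ip: "(i, p) \<in> S" for i p
  proof (cases "f (expi (real p * \<beta>)) \<le> \<zeta>")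
    case True
    then have "Re (\<phi> (real p * \<beta>)) - 2 * \<zeta> \<le> 0" using fg[of "real p * \<beta>"] by (simp add: \<phi>_def)
    then have "\<epsilon> / 2 ^ i * (Re (\<phi> (real p * \<beta>)) - 2 * \<zeta>) \<le> 0" using \<epsilon> by (intro mult_nonneg_nonpos) auto
    then show ?thesis using measure_nonneg[of lborel "E (i, p) \<inter> V"] by linarith
  next
    case False
    have i: "m \<le> i" and p: "prime p" "2 ^ i < p" "p \<le> 2 ^ Suc i"
      using ip window_blocks_ge by (auto simp: S_def window_primes_def dyadic_primes_def dyadic_def)
    have mi: "real m \<le> 2 ^ i"
    proof -
      have "i < 2 ^ i" by (rule less_exp)
      then have "m \<le> 2 ^ i" using i by linarith
      then show ?thesis using of_nat_mono[of m "2 ^ i", where ?'a = real] by simp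
    qed
    have "E (i, p) \<subseteq> V"
    proof
      fix x assume x: "x \<in> E (i, p)"
      then have x01: "x \<in> {0..<1}" and xd: "dist_to_int (x - real p * \<beta>) < \<epsilon> / 2 ^ Suc i"
        by (auto simp: E_def prime_arc_def circle_arc_def)
      \<comment> \<open>The radius is \<epsilon> / 2^(i + 1) and p <= 2^(i + 1), so a point of K in
        the arc would violate \<open>far\<close>.\<close>
      have "x \<notin> K"
      proof
        assume xK: "x \<in> K"
        have "P \<le> m" using m by simp
        moreover have "i < 2 ^ i" by (rule less_exp)
        ultimately have "P < p" using p(2) i by linarith
        then have "\<epsilon> \<le> real p * dist_to_int (real p * \<beta> - x)" using far[OF xK p(1)] by simp
        also have "dist_to_int (real p * \<beta> - x) = dist_to_int (x - real p * \<beta>)"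
          using dist_to_int_minus[of "x - real p * \<beta>"] by simp
        also have "real p * dist_to_int (x - real p * \<beta>) < real p * (\<epsilon> / 2 ^ Suc i)"
          using xd p(2) by (intro mult_strict_left_mono) auto
        also have "\<dots> \<le> 2 ^ Suc i * (\<epsilon> / 2 ^ Suc i)"
          using of_nat_mono[OF p(3), where ?'a = real] \<epsilon> by (intro mult_right_mono) auto
        finally show False by simp
      qed
      moreover have "x \<in> U"
      proof (rule ccontr)
        assume "x \<notin> U"
        then have f0: "f (expi x) = 0" using x01 by (intro f(3)) auto
        have "norm (expi x - expi (real p * \<beta>)) \<le> 2 * pi * dist_to_int (x - real p * \<beta>)" by (rule norm_expi_diff_le)
        also have "\<dots> \<le> 2 * pi * (1 / 2 ^ i)"
        proof (intro mult_left_mono)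
          have "\<epsilon> / 2 ^ Suc i \<le> 1 / 2 ^ i" using e2 by (simp add: field_simps)
          then show "dist_to_int (x - real p * \<beta>) \<le> 1 / 2 ^ i" using xd by linarith
        qed simp
        also have "\<dots> < d"
        proof -
          have "2 * pi / d < 2 ^ i" using M3 m mi by linarith
          then show ?thesis using d(1) by (simp add: pos_divide_less_eq mult.commute)
        qed
        finally have "dist (expi x) (expi (real p * \<beta>)) < d" by (simp add: dist_norm)
        then have "dist (f (expi x)) (f (expi (real p * \<beta>))) < \<zeta>" by (intro d(2)) auto
        then show False using f0 False by (simp add: dist_real_def)
      qed
      ultimately show "x \<in> V" using x01 by (simp add: V_def)
    qed
    then have "E (i, p) \<inter> V = E (i, p)" by blast
    then have "measure lborel (E (i, p) \<inter> V) = \<epsilon> / 2 ^ i"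
      unfolding E_def using measure_prime_arc[OF \<epsilon>(1) e2] by simp
    moreover have "g (expi (real p * \<beta>)) - 2 * \<zeta> \<le> 1"
      using fg[of "real p * \<beta>"] f01[of "expi (real p * \<beta>)"] \<zeta> by linarith
    then have "Re (\<phi> (real p * \<beta>)) - 2 * \<zeta> \<le> 1" by (simp add: \<phi>_def)
    then have "\<epsilon> / 2 ^ i * (Re (\<phi> (real p * \<beta>)) - 2 * \<zeta>) \<le> \<epsilon> / 2 ^ i * 1" using \<epsilon> by (intro mult_left_mono) auto
    ultimately show ?thesis by simp
  qed
  have "Re (prime_mean a m \<epsilon> \<beta> \<phi>) - 2 * \<zeta> * prime_mass a m \<epsilon>
     = (\<Sum>s\<in>S. w s * (\<epsilon> / 2 ^ fst s * (Re (\<phi> (real (snd s) * \<beta>)) - 2 * \<zeta>)))"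
  proof -
    have "Re (prime_mean a m \<epsilon> \<beta> \<phi>) = (\<Sum>s\<in>S. w s * (\<epsilon> / 2 ^ fst s * Re (\<phi> (real (snd s) * \<beta>))))"
      unfolding prime_mean_def S_def sum_window_primes w_def prime_weight_def Re_sum
      by (intro sum.cong refl) simp
    moreover have "prime_mass a m \<epsilon> = (\<Sum>s\<in>S. w s * (\<epsilon> / 2 ^ fst s))"
      unfolding prime_mass_def S_def sum_window_primes w_def prime_weight_def by simp
    ultimately show ?thesis by (simp add: sum_distrib_left right_diff_distrib sum_subtractf mult_ac)
  qed
  also have "\<dots> \<le> (\<Sum>s\<in>S. w s * measure lborel (E s \<inter> V))"
  proof (intro sum_mono mult_left_mono)
    fix s assume s: "s \<in> S"
    obtain i p where ip: "s = (i, p)" by (cases s)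
    show "\<epsilon> / 2 ^ fst s * (Re (\<phi> (real (snd s) * \<beta>)) - 2 * \<zeta>) \<le> measure lborel (E s \<inter> V)"
      using lower[of i p] s by (simp add: ip)
  qed (rule w0)
  finally have 1: "Re (prime_mean a m \<epsilon> \<beta> \<phi>) - 2 * \<zeta> * prime_mass a m \<epsilon> \<le> 3 / 16 * (\<epsilon> * \<kappa>)" using upper by linarith
  have "\<bar>Re (prime_mean a m \<epsilon> \<beta> \<phi> - I * of_real (prime_mass a m \<epsilon>))\<bar> \<le> \<eta>'"
    using M1[OF _ bad] m abs_Re_le_cmod order_trans by (metis max.boundedE)
  then have 2: "Re I * prime_mass a m \<epsilon> - \<eta>' \<le> Re (prime_mean a m \<epsilon> \<beta> \<phi>)" by simp
  have mass: "\<epsilon> / 2 \<le> prime_mass a m \<epsilon>" using m by (intro M2) simp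
  have "(5 / 8 * \<kappa>) * (\<epsilon> / 2) \<le> (Re I - 2 * \<zeta>) * prime_mass a m \<epsilon>"
    using mass I_ge \<kappa> \<epsilon> by (intro mult_mono) (auto simp: \<zeta>_def)
  also have "\<dots> = Re I * prime_mass a m \<epsilon> - 2 * \<zeta> * prime_mass a m \<epsilon>" by (rule left_diff_distrib)
  finally have "(5 / 8 * \<kappa>) * (\<epsilon> / 2) \<le> 3 / 16 * (\<epsilon> * \<kappa>) + \<eta>'" using 1 2 by linarith
  moreover have "(5 / 8 * \<kappa>) * (\<epsilon> / 2) = 5 / 16 * (\<epsilon> * \<kappa>)" by simp
  moreover have "0 < \<epsilon> * \<kappa>" using \<epsilon> \<kappa> by simp
  ultimately show False unfolding \<eta>'_def by linarith
qed

text \<open>A point with positive lower limit satisfies the inequality with some e n for all primes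
  beyond some P. Apart from 0, these points are covered by countably many compact sets of measure
  zero.\<close>

theorem theorem1p11:
  fixes \<beta> :: real
  assumes "\<beta> \<notin> \<rat>"
    and "intermittently_badly_approximable \<beta>"
  shows "emeasure lebesgue
           {x \<in> {0..<1::real}.
              Liminf (inf at_top (principal {p::nat. prime p}))
                (\<lambda>p. ereal (real p * dist_to_int (real p * \<beta> - x))) = 0} = 1"
proof -
  obtain c0 :: real and a :: nat where c0: "0 < c0" and a: "2 \<le> a"
    and win0: "\<And>M. \<exists>m\<ge>M. bad_window c0 (2 ^ (m * a)) (2 ^ (m * (a + 4))) \<beta>"
    by (rule iba_imp_windows[OF assms(2)]) blast
  define c where "c = min c0 1"
  have c: "0 < c" "c \<le> 1" using c0 by (auto simp: c_def)
  have win: "\<exists>m\<ge>M. bad_window c (2 ^ (m * a)) (2 ^ (m * (a + 4))) \<beta>" for M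
  proof -
    obtain m where m: "m \<ge> M" "bad_window c0 (2 ^ (m * a)) (2 ^ (m * (a + 4))) \<beta>" using win0 by blast
    have "bad_window c (2 ^ (m * a)) (2 ^ (m * (a + 4))) \<beta>"
      unfolding bad_window_def
    proof (intro allI impI)
      fix n :: nat assume n: "1 \<le> n" "real n \<le> 2 ^ (m * (a + 4))"
      have "c / max (real n) (2 ^ (m * a)) \<le> c0 / max (real n) (2 ^ (m * a))"
        by (intro divide_right_mono) (auto simp: c_def)
      also have "\<dots> \<le> dist_to_int (real n * \<beta>)" using n by (rule bad_windowD[OF m(2)])
      finally show "c / max (real n) (2 ^ (m * a)) \<le> dist_to_int (real n * \<beta>)" .
    qed
    then show ?thesis using m(1) by blast
  qed
  define val where "val x p = real p * dist_to_int (real p * \<beta> - x)" for x :: real and p :: nat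
  \<comment> \<open>A sequence tending to 0 that respects the condition 2 \<epsilon> <= c.\<close>
  define e where "e n = c / (2 * real (Suc n))" for n
  have e: "0 < e n" "2 * e n \<le> c" for n
    using c by (auto simp: e_def field_simps)
  \<comment> \<open>The margins 1 / (j + 2) keep the set compact inside the open interval; j + 2
    keeps the first margin at 1/2.\<close>
  define K where "K n P j = {1 / real (j + 2)..1 - 1 / real (j + 2)} \<inter> (\<Inter>p\<in>{p. prime p \<and> P < p}. {x. e n \<le> val x p})" for n P j :: nat
  have Kcomp: "compact (K n P j)" for n P j
  proof -
    have "closed {x. e n \<le> val x p}" for p
    proof -
      have "continuous_on UNIV (\<lambda>x. val x p)"
        unfolding val_def dist_to_int_def by (intro continuous_intros)
      then show ?thesis by (intro closed_Collect_le continuous_intros)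
    qed
    then show ?thesis unfolding K_def by (intro compact_Int_closed closed_INT) auto
  qed
  have Kneg: "negligible (K n P j)" for n P j
  proof -
    have "measure lborel (K n P j) = 0"
    proof (rule measure_non_approximable_compact[OF win c a e Kcomp])
      show "K n P j \<subseteq> {0<..<1}"
      proof
        fix x assume "x \<in> K n P j"
        then have "x \<in> {1 / real (j + 2)..1 - 1 / real (j + 2)}" unfolding K_def by (rule IntD1)
        then have "1 / real (j + 2) \<le> x \<and> x \<le> 1 - 1 / real (j + 2)" by (simp only: atLeastAtMost_iff)
        moreover have "0 < 1 / real (j + 2)" by simp
        ultimately have "0 < x \<and> x < 1" by linarith
        then show "x \<in> {0<..<1}" by simp
      qed
      fix x p assume "x \<in> K n P j" "prime p" "P < p"
      then show "e n \<le> real p * dist_to_int (real p * \<beta> - x)" by (auto simp: K_def val_def)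
    qed
    then show ?thesis using Kcomp[of n P j] by (simp add: negligible_iff_measure0 lmeasurable_compact compact_imp_closed)
  qed
  define L where "L x = Liminf (inf at_top (principal {p::nat. prime p})) (\<lambda>p. ereal (val x p))" for x
  define B where "B = {x \<in> {0..<1}. L x \<noteq> 0}"
  \<comment> \<open>Nonnegativity turns L x \<noteq> 0 into L x > 0.\<close>
  have L0: "0 \<le> L x" for x
    unfolding L_def by (intro Liminf_bounded always_eventually allI) (simp add: val_def dist_to_int_nonneg)
  have cover: "B \<subseteq> {0} \<union> (\<Union>n. \<Union>P. \<Union>j. K n P j)"
  proof
    fix x assume x: "x \<in> B"
    show "x \<in> {0} \<union> (\<Union>n. \<Union>P. \<Union>j. K n P j)"
    proof (cases "x = 0")
      case False
      then have x01: "0 < x" "x < 1" using x by (auto simp: B_def)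
      have "0 < L x" using x L0[of x] by (simp add: B_def order_less_le)
      then obtain r where r: "0 < ereal r" "ereal r < L x" using ereal_dense2 by blast
      have "eventually (\<lambda>p. ereal r < ereal (val x p)) (inf at_top (principal {p::nat. prime p}))"
        using r(2) unfolding L_def by (rule less_LiminfD)
      then obtain P where P: "\<And>p. P \<le> p \<Longrightarrow> prime p \<Longrightarrow> r < val x p"
        unfolding eventually_inf_principal eventually_at_top_linorder by auto
      have "0 < r" using r by simp
      obtain n :: nat where n: "c / r < real n" using reals_Archimedean2 by blast
      have "e n \<le> r"
      proof -
        have "c < real n * r" using n \<open>0 < r\<close> by (simp add: pos_divide_less_eq)
        also have "\<dots> \<le> r * (2 * real (Suc n))" using \<open>0 < r\<close> by (simp add: algebra_simps)
        finally show ?thesis unfolding e_def by (simp add: pos_divide_le_eq)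
      qed
      define \<mu> where "\<mu> = min x (1 - x)"
      have \<mu>: "0 < \<mu>" "\<mu> \<le> x" "\<mu> \<le> 1 - x" using x01 by (simp_all add: \<mu>_def)
      obtain j :: nat where j: "1 / \<mu> < real j" using reals_Archimedean2 by blast
      have "1 < real j * \<mu>" using j \<mu>(1) by (simp add: pos_divide_less_eq)
      also have "\<dots> \<le> \<mu> * real (j + 2)" using \<mu>(1) by (simp add: algebra_simps)
      finally have "1 / real (j + 2) < \<mu>" by (subst pos_divide_less_eq) auto
      then have "1 / real (j + 2) \<le> x \<and> x \<le> 1 - 1 / real (j + 2)" using \<mu> by linarith
      then have "x \<in> {1 / real (j + 2)..1 - 1 / real (j + 2)}" by (simp only: atLeastAtMost_iff)
      moreover have "e n \<le> val x p" if "prime p" "P < p" for p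
        using P[of p] that \<open>e n \<le> r\<close> by simp
      ultimately have "x \<in> K n P j" by (simp add: K_def)
      then show ?thesis by blast
    qed simp
  qed
  have "negligible ({0} \<union> (\<Union>n. \<Union>P. \<Union>j. K n P j))"
    by (intro negligible_Un negligible_Union_nat Kneg) simp
  then have "negligible B" using cover by (rule negligible_subset)
  then have BN: "B \<in> null_sets lebesgue" by (simp add: negligible_iff_null_sets)
  have "{x \<in> {0..<1::real}. L x = 0} = {0..<1} - B" by (auto simp: B_def)
  then have "emeasure lebesgue {x \<in> {0..<1::real}. L x = 0} = emeasure lebesgue ({0..<1::real} - B)" by (rule arg_cong)
  also have "\<dots> = emeasure lebesgue {0..<1::real}" using BN by (intro emeasure_Diff_null_set) auto
  also have "\<dots> = 1" by simp
  finally show ?thesis unfolding L_def val_def .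
qed

end
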